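(* Let $\mathbf{k}$ be a field of characteristic zero, $X=\mathbb{A}^n$ over $\mathbf{k}$, $A=\mathbf{k}[x_1,\dots,x_n]$, and let $W_n=\operatorname{Der}(A)$ be the Lie algebra of polynomial vector fields on $\mathbb{A}^n$. Let $W$ be a finite-dimensional $\mathcal{L}_+$-module, and let $M=A\otimes W$ be the corresponding tensor $AV$-module (with $V=W_n$). Then $$H^*(W_n,A\otimes W)\cong H^*(\mathcal{L}_+,W).$$
   Context: $H^*$ denotes ordinary Chevalley–Eilenberg Lie algebra cohomology over $\mathbf{k}$ (no continuity, finiteness or $A$-linearity condition on cochains), i.e. the cohomology of $C^k(\mathfrak{g},M)=\operatorname{Hom}_{\mathbf{k}}(\bigwedge^k\mathfrak{g},M)$. $\mathcal{L}_+$: let $\mathcal{L}=\operatorname{Der}(\mathbf{k}[X_1,\dots,X_n])=\bigoplus_{d\ge-1}\mathcal{L}_d$ be graded by total degree ($X^k\frac{\partial}{\partial X_i}$ has degree $|k|-1$); $\mathcal{L}_+=\bigoplus_{d\ge0}\mathcal{L}_d$. On a finite-dimensional $\mathcal{L}_+$-module, $\mathcal{L}_d$ acts as zero for all large $d$. Tensor module $A\otimes W$: $A$ acts by multiplication on the left factor, and for $f,s\in A$, $w\in W$, $$f\tfrac{\partial}{\partial x_i}(s\otimes w)=\left(f\tfrac{\partial s}{\partial x_i}\right)\otimes w+\sum_{k\in\mathbb{Z}_{\ge0}^n\setminus\{0\}}\frac1{k!}\frac{\partial^kf}{\partial x^k}\,s\otimes\left(X^k\tfrac{\partial}{\partial X_i}\right)w$$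 (a finite sum). *)

theory Defs
  imports
    Complex_Main
    "HOL-Library.Poly_Mapping"
    "HOL-Library.Function_Algebras"
    "HOL-Library.Set_Algebras"
begin

section \<open>Lie algebras, modules and Chevalley--Eilenberg cohomology\<close>

text \<open>
  A Lie algebra is a subspace \<open>g\<close> of an ambient vector space together with a bracket
  of which only the values on \<open>g\<close> matter.
\<close>

locale lie_algebra = vector_space scale
  for scale :: "'k::field \<Rightarrow> 'g::ab_group_add \<Rightarrow> 'g" +
  fixes g :: "'g set" and bracket :: "'g \<Rightarrow> 'g \<Rightarrow> 'g"
  assumes subspace_carrier: "subspace g"
    and bracket_closed: "\<lbrakk>x \<in> g; y \<in> g\<rbrakk> \<Longrightarrow> bracket x y \<in> g"
    and bracket_add_left: "\<lbrakk>x \<in> g; y \<in> g; z \<in> g\<rbrakk> \<Longrightarrow> bracket (x + y) z = bracket x z + bracket y z"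
    and bracket_add_right: "\<lbrakk>x \<in> g; y \<in> g; z \<in> g\<rbrakk> \<Longrightarrow> bracket x (y + z) = bracket x y + bracket x z"
    and bracket_scale_left: "\<lbrakk>x \<in> g; y \<in> g\<rbrakk> \<Longrightarrow> bracket (scale c x) y = scale c (bracket x y)"
    and bracket_scale_right: "\<lbrakk>x \<in> g; y \<in> g\<rbrakk> \<Longrightarrow> bracket x (scale c y) = scale c (bracket x y)"
    and bracket_self: "x \<in> g \<Longrightarrow> bracket x x = 0"
    and jacobi: "\<lbrakk>x \<in> g; y \<in> g; z \<in> g\<rbrakk> \<Longrightarrow>
      bracket x (bracket y z) + bracket y (bracket z x) + bracket z (bracket x y) = 0"

locale lie_module = lie_algebra scale g bracket + M: vector_space scaleM
  for scale :: "'k::field \<Rightarrow> 'g::ab_group_add \<Rightarrow> 'g" and g bracket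
    and scaleM :: "'k \<Rightarrow> 'm::ab_group_add \<Rightarrow> 'm" +
  fixes act :: "'g \<Rightarrow> 'm \<Rightarrow> 'm"
  assumes act_linear: "x \<in> g \<Longrightarrow> Vector_Spaces.linear scaleM scaleM (act x)"
    and act_add: "\<lbrakk>x \<in> g; y \<in> g\<rbrakk> \<Longrightarrow> act (x + y) m = act x m + act y m"
    and act_scale: "x \<in> g \<Longrightarrow> act (scale c x) m = scaleM c (act x m)"
    and act_bracket: "\<lbrakk>x \<in> g; y \<in> g\<rbrakk> \<Longrightarrow> act (bracket x y) m = act x (act y m) - act y (act x m)"

definition tuples :: "'g set \<Rightarrow> nat \<Rightarrow> 'g list set" where
  "tuples g k = {xs. length xs = k \<and> set xs \<subseteq> g}"

text \<open>
  Linear maps from the \<open>k\<close>-th exterior power of \<open>g\<close> to \<open>M\<close> are encoded as alternating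
  \<open>k\<close>-linear maps on \<open>k\<close>-tuples in \<open>g\<close>, extended by \<open>0\<close> to all other lists so
  that equal cochains are equal functions.
\<close>

definition cochains :: "('k::field \<Rightarrow> 'g::ab_group_add \<Rightarrow> 'g) \<Rightarrow> 'g set \<Rightarrow>
    ('k \<Rightarrow> 'm::ab_group_add \<Rightarrow> 'm) \<Rightarrow> nat \<Rightarrow> ('g list \<Rightarrow> 'm) set" where
  "cochains scale g scaleM k = {\<omega>.
     (\<forall>xs. xs \<notin> tuples g k \<longrightarrow> \<omega> xs = 0) \<and>
     (\<forall>xs\<in>tuples g k. \<forall>i<k. \<forall>x\<in>g. \<forall>y\<in>g. \<omega> (xs[i := x + y]) = \<omega> (xs[i := x]) + \<omega> (xs[i := y])) \<and>
     (\<forall>xs\<in>tuples g k. \<forall>i<k. \<forall>c. \<forall>x\<in>g. \<omega> (xs[i := scale c x]) = scaleM c (\<omega> (xs[i := x]))) \<and>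
     (\<forall>xs\<in>tuples g k. \<forall>j<k. \<forall>i<j. xs ! i = xs ! j \<longrightarrow> \<omega> xs = 0)}"

definition omit :: "nat \<Rightarrow> 'a list \<Rightarrow> 'a list" where
  "omit i xs = take i xs @ drop (Suc i) xs"

text \<open>In the second sum \<open>i < j\<close>, so omitting entry \<open>j\<close> first leaves entry \<open>i\<close> in place.\<close>

definition ce_differential :: "'g set \<Rightarrow> ('g \<Rightarrow> 'g \<Rightarrow> 'g) \<Rightarrow>
    ('k::field \<Rightarrow> 'm::ab_group_add \<Rightarrow> 'm) \<Rightarrow> ('g \<Rightarrow> 'm \<Rightarrow> 'm) \<Rightarrow> nat \<Rightarrow> ('g list \<Rightarrow> 'm) \<Rightarrow> 'g list \<Rightarrow> 'm" where
  "ce_differential g bracket scaleM act k \<omega> xs =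
    (if xs \<in> tuples g (Suc k) then
       (\<Sum>i\<le>k. scaleM ((-1) ^ i) (act (xs ! i) (\<omega> (omit i xs)))) +
       (\<Sum>j\<le>k. \<Sum>i<j. scaleM ((-1) ^ (i + j)) (\<omega> (bracket (xs ! i) (xs ! j) # omit i (omit j xs))))
     else 0)"

definition cocycles where
  "cocycles scale g bracket scaleM act k =
     {\<omega> \<in> cochains scale g scaleM k. ce_differential g bracket scaleM act k \<omega> = 0}"

fun coboundaries where
  "coboundaries scale g bracket scaleM act 0 = {0}"
| "coboundaries scale g bracket scaleM act (Suc k) =
     ce_differential g bracket scaleM act k ` cochains scale g scaleM k"

text \<open>
  The quotient \<open>Z / B\<close> of a subspace by a smaller subspace is the set of cosets of \<open>B\<close>, with
  elementwise addition of cosets.  Adding \<open>B\<close> in the scalar multiplication only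
  matters for the scalar \<open>0\<close>.
\<close>

definition quotient_space :: "'a::ab_group_add set \<Rightarrow> 'a set \<Rightarrow> 'a set set" where
  "quotient_space Z B = (\<lambda>z. z +o B) ` Z"

definition coset_scale :: "('k \<Rightarrow> 'a::ab_group_add \<Rightarrow> 'a) \<Rightarrow> 'a set \<Rightarrow> 'k \<Rightarrow> 'a set \<Rightarrow> 'a set" where
  "coset_scale scale B c X = scale c ` X + B"

definition quotients_isomorphic :: "('k::field \<Rightarrow> 'a::ab_group_add \<Rightarrow> 'a) \<Rightarrow> 'a set \<Rightarrow> 'a set \<Rightarrow>
    ('k \<Rightarrow> 'b::ab_group_add \<Rightarrow> 'b) \<Rightarrow> 'b set \<Rightarrow> 'b set \<Rightarrow> bool" where
  "quotients_isomorphic s\<^sub>1 Z\<^sub>1 B\<^sub>1 s\<^sub>2 Z\<^sub>2 B\<^sub>2 \<longleftrightarrow>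
    (\<exists>\<phi>. bij_betw \<phi> (quotient_space Z\<^sub>1 B\<^sub>1) (quotient_space Z\<^sub>2 B\<^sub>2) \<and>
       (\<forall>X\<in>quotient_space Z\<^sub>1 B\<^sub>1. \<forall>Y\<in>quotient_space Z\<^sub>1 B\<^sub>1. \<phi> (X + Y) = \<phi> X + \<phi> Y) \<and>
       (\<forall>c. \<forall>X\<in>quotient_space Z\<^sub>1 B\<^sub>1. \<phi> (coset_scale s\<^sub>1 B\<^sub>1 c X) = coset_scale s\<^sub>2 B\<^sub>2 c (\<phi> X)))"

definition pointwise_scale :: "('k \<Rightarrow> 'm \<Rightarrow> 'm) \<Rightarrow> 'k \<Rightarrow> ('x \<Rightarrow> 'm) \<Rightarrow> 'x \<Rightarrow> 'm" where
  "pointwise_scale scale c f = (\<lambda>x. scale c (f x))"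

definition cohomology_isomorphic where
  "cohomology_isomorphic scale g bracket scaleM act scale' g' bracket' scaleM' act' k \<longleftrightarrow>
     quotients_isomorphic
       (pointwise_scale scaleM) (cocycles scale g bracket scaleM act k) (coboundaries scale g bracket scaleM act k)
       (pointwise_scale scaleM') (cocycles scale' g' bracket' scaleM' act' k) (coboundaries scale' g' bracket' scaleM' act' k)"


section \<open>Polynomials and polynomial vector fields\<close>

type_synonym ('n, 'k) mpoly = "('n \<Rightarrow>\<^sub>0 nat) \<Rightarrow>\<^sub>0 'k"
type_synonym ('n, 'k) vfield = "('n, 'k) mpoly \<Rightarrow> ('n, 'k) mpoly"

definition coeff_scale :: "('k \<Rightarrow> 'w::zero \<Rightarrow> 'w) \<Rightarrow> 'k \<Rightarrow> ('a \<Rightarrow>\<^sub>0 'w) \<Rightarrow> ('a \<Rightarrow>\<^sub>0 'w)" where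
  "coeff_scale scale c m = Poly_Mapping.map (scale c) m"

abbreviation poly_scale :: "'k::field \<Rightarrow> ('n, 'k) mpoly \<Rightarrow> ('n, 'k) mpoly" where
  "poly_scale \<equiv> coeff_scale (*)"

definition monomial :: "('n \<Rightarrow>\<^sub>0 nat) \<Rightarrow> ('n, 'k::field) mpoly" where
  "monomial a = Poly_Mapping.single a 1"

definition var :: "'n \<Rightarrow> ('n, 'k::field) mpoly" where
  "var i = monomial (Poly_Mapping.single i 1)"

text \<open>The summands with \<open>a i = 0\<close> vanish, so truncated subtraction of exponents is harmless.\<close>

definition partial :: "'n \<Rightarrow> ('n, 'k::field) mpoly \<Rightarrow> ('n, 'k) mpoly" where
  "partial i p = (\<Sum>a\<in>Poly_Mapping.keys p.
     Poly_Mapping.single (a - Poly_Mapping.single i 1)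
       (of_nat (Poly_Mapping.lookup a i) * Poly_Mapping.lookup p a))"

text \<open>
  The iterated derivative of multi-index \<open>k\<close>: the commuting operators
  \<open>partial i ^^ k i\<close> are applied one after the other.
\<close>

definition multi_partial :: "('n::finite \<Rightarrow>\<^sub>0 nat) \<Rightarrow> ('n, 'k::field) mpoly \<Rightarrow> ('n, 'k) mpoly" where
  "multi_partial k p = Finite_Set.fold (\<lambda>i. partial i ^^ Poly_Mapping.lookup k i) p UNIV"

definition multi_fact :: "('n::finite \<Rightarrow>\<^sub>0 nat) \<Rightarrow> nat" where
  "multi_fact k = (\<Prod>i\<in>UNIV. fact (Poly_Mapping.lookup k i))"

definition total_degree :: "('n::finite \<Rightarrow>\<^sub>0 nat) \<Rightarrow> nat" where
  "total_degree k = (\<Sum>i\<in>UNIV. Poly_Mapping.lookup k i)"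

definition derivations :: "('n, 'k::field) vfield set" where
  "derivations = {D. Vector_Spaces.linear poly_scale poly_scale D \<and> (\<forall>p q. D (p * q) = D p * q + p * D q)}"

abbreviation vf_scale :: "'k::field \<Rightarrow> ('n, 'k) vfield \<Rightarrow> ('n, 'k) vfield" where
  "vf_scale \<equiv> pointwise_scale poly_scale"

definition vf_bracket :: "('n, 'k::field) vfield \<Rightarrow> ('n, 'k) vfield \<Rightarrow> ('n, 'k) vfield" where
  "vf_bracket D E = (\<lambda>p. D (E p) - E (D p))"

definition vf :: "('n, 'k::field) mpoly \<Rightarrow> 'n \<Rightarrow> ('n, 'k) vfield" where
  "vf f i = (\<lambda>p. f * partial i p)"

definition vf_graded :: "int \<Rightarrow> ('n::finite, 'k::field) vfield set" where
  "vf_graded d = module.span vf_scale {vf (monomial k) i | k i. int (total_degree k) - 1 = d}"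

definition lie_plus :: "('n::finite, 'k::field) vfield set" where
  "lie_plus = module.span vf_scale (\<Union>d\<in>{0..}. vf_graded d)"


section \<open>Tensor modules\<close>

text \<open>
  The tensor product of the polynomial ring with \<open>W\<close> is realised as the space of polynomials
  with coefficients in \<open>W\<close>; \<open>tensor_product_universal\<close> below is its universal property.
\<close>

definition tensor :: "('k::field \<Rightarrow> 'w::ab_group_add \<Rightarrow> 'w) \<Rightarrow> ('n, 'k) mpoly \<Rightarrow> 'w \<Rightarrow> (('n \<Rightarrow>\<^sub>0 nat) \<Rightarrow>\<^sub>0 'w)" where
  "tensor scaleW s w = Poly_Mapping.map (\<lambda>c. scaleW c w) s"

text \<open>
  The action of a derivation \<open>D\<close>, whose components are \<open>D (var i)\<close>, on the pure tensor of
  \<open>s\<close> and \<open>w\<close>.  The sum over \<open>k\<close> is restricted to the finitely many non-zero derivatives.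
\<close>

definition tensor_act_pure :: "('k::field_char_0 \<Rightarrow> 'w::ab_group_add \<Rightarrow> 'w) \<Rightarrow>
    (('n::finite, 'k) vfield \<Rightarrow> 'w \<Rightarrow> 'w) \<Rightarrow> ('n, 'k) vfield \<Rightarrow> ('n, 'k) mpoly \<Rightarrow> 'w \<Rightarrow> (('n \<Rightarrow>\<^sub>0 nat) \<Rightarrow>\<^sub>0 'w)" where
  "tensor_act_pure scaleW act D s w =
     tensor scaleW (D s) w +
     (\<Sum>i\<in>UNIV. \<Sum>k | k \<noteq> 0 \<and> multi_partial k (D (var i)) \<noteq> 0.
        tensor scaleW (poly_scale (1 / of_nat (multi_fact k)) (multi_partial k (D (var i))) * s)
          (act (vf (monomial k) i) w))"

text \<open>
  The linear extension to all tensors, using that \<open>m\<close> is the sum of the pure tensors of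
  \<open>monomial a\<close> and \<open>lookup m a\<close>; compare \<open>tensor_act_tensor\<close> and
  \<open>tensor_act_vf\<close> below.
\<close>

definition tensor_act :: "('k::field_char_0 \<Rightarrow> 'w::ab_group_add \<Rightarrow> 'w) \<Rightarrow>
    (('n::finite, 'k) vfield \<Rightarrow> 'w \<Rightarrow> 'w) \<Rightarrow> ('n, 'k) vfield \<Rightarrow> (('n \<Rightarrow>\<^sub>0 nat) \<Rightarrow>\<^sub>0 'w) \<Rightarrow> (('n \<Rightarrow>\<^sub>0 nat) \<Rightarrow>\<^sub>0 'w)" where
  "tensor_act scaleW act D m =
     (\<Sum>a\<in>Poly_Mapping.keys m. tensor_act_pure scaleW act D (monomial a) (Poly_Mapping.lookup m a))"



section \<open>Consistency of the definitions\<close>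

lemma vector_space_pointwise_scale:
  assumes "vector_space s" shows "vector_space (pointwise_scale s)"
proof -
  interpret vector_space s by (fact assms)
  show ?thesis
    by unfold_locales (auto simp: pointwise_scale_def fun_eq_iff scale_right_distrib scale_left_distrib)
qed

lemma lookup_coeff_scale:
  assumes "vector_space s"
  shows "Poly_Mapping.lookup (coeff_scale s c m) a = s c (Poly_Mapping.lookup m a)"
proof -
  interpret vector_space s by (fact assms)
  show ?thesis by (auto simp: coeff_scale_def map.rep_eq when_def)
qed

lemma vector_space_coeff_scale:
  assumes "vector_space s" shows "vector_space (coeff_scale s)"
proof -
  interpret vector_space s by (fact assms)
  show ?thesis
    by unfold_locales
      (auto simp: lookup_coeff_scale[OF assms] poly_mapping_eq_iff fun_eq_iff lookup_add
        scale_right_distrib scale_left_distrib)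
qed

lemma vector_space_mult: "vector_space ((*) :: 'k::field \<Rightarrow> 'k \<Rightarrow> 'k)"
  by unfold_locales (auto simp: algebra_simps)

lemma poly_scale_eq: "poly_scale c p = Poly_Mapping.single 0 c * p"
  by (simp add: coeff_scale_def mult_map_scale_conv_mult)

lemma poly_scale_mult_left: "poly_scale c p * q = poly_scale c (p * q)"
  by (simp add: poly_scale_eq mult.assoc)

lemma poly_scale_mult_right: "p * poly_scale c q = poly_scale c (p * q)"
  by (simp add: poly_scale_eq mult.left_commute)

lemma lookup_poly_scale: "Poly_Mapping.lookup (poly_scale c p) a = c * Poly_Mapping.lookup p a"
  by (rule lookup_coeff_scale[OF vector_space_mult])

global_interpretation poly: vector_space poly_scale
  by (rule vector_space_coeff_scale[OF vector_space_mult])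

global_interpretation vfield: vector_space vf_scale
  by (rule vector_space_pointwise_scale[OF poly.vector_space_axioms])

lemma poly_mapping_sum_single: "m = (\<Sum>a\<in>Poly_Mapping.keys m. Poly_Mapping.single a (Poly_Mapping.lookup m a))"
  by (auto simp: poly_mapping_eq_iff fun_eq_iff lookup_sum lookup_single when_def sum.delta in_keys_iff
      sum.delta' cong: if_cong)

lemma additive_sum:
  fixes F :: "'a::comm_monoid_add \<Rightarrow> 'b::ab_group_add"
  assumes "\<And>x y. F (x + y) = F x + F y"
  shows "F (\<Sum>a\<in>A. f a) = (\<Sum>a\<in>A. F (f a))"
proof -
  have "F 0 = F 0 + F 0" using assms[of 0 0] by simp
  then have "F 0 = 0" by simp
  then show ?thesis by (induction A rule: infinite_finite_induct) (auto simp: assms)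
qed

lemma additive_eqI:
  fixes F G :: "('a \<Rightarrow>\<^sub>0 'w::comm_monoid_add) \<Rightarrow> 'b::ab_group_add"
  assumes F: "\<And>x y. F (x + y) = F x + F y" and G: "\<And>x y. G (x + y) = G x + G y"
    and "\<And>a c. F (Poly_Mapping.single a c) = G (Poly_Mapping.single a c)"
  shows "F m = G m"
proof -
  have "F m = (\<Sum>a\<in>Poly_Mapping.keys m. F (Poly_Mapping.single a (Poly_Mapping.lookup m a)))"
    using additive_sum[of F, OF F] poly_mapping_sum_single[of m] by metis
  also have "\<dots> = (\<Sum>a\<in>Poly_Mapping.keys m. G (Poly_Mapping.single a (Poly_Mapping.lookup m a)))"
    by (simp add: assms)
  also have "\<dots> = G m"
    using additive_sum[of G, OF G] poly_mapping_sum_single[of m] by metis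
  finally show ?thesis .
qed

lemma single_eq_scale_monomial: "Poly_Mapping.single a c = poly_scale c (monomial a)"
  by (auto simp: poly_mapping_eq_iff fun_eq_iff lookup_poly_scale monomial_def lookup_single when_def)

lemma monomial_mult: "monomial a * monomial b = monomial (a + b)"
  by (simp add: monomial_def mult_single)

lemma monomial_0: "monomial 0 = 1"
  by (simp add: monomial_def)

lemma lookup_partial:
  "Poly_Mapping.lookup (partial i p) a =
     of_nat (Poly_Mapping.lookup a i + 1) * Poly_Mapping.lookup p (a + Poly_Mapping.single i 1)"
proof -
  let ?e = "Poly_Mapping.single i (1::nat)"
  have "Poly_Mapping.lookup (partial i p) a =
    (\<Sum>b\<in>Poly_Mapping.keys p. if b = a + ?e then of_nat (Poly_Mapping.lookup b i) * Poly_Mapping.lookup p b else 0)"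
    unfolding partial_def lookup_sum
  proof (rule sum.cong[OF refl])
    fix b
    show "Poly_Mapping.lookup (Poly_Mapping.single (b - ?e) (of_nat (Poly_Mapping.lookup b i) * Poly_Mapping.lookup p b)) a
      = (if b = a + ?e then of_nat (Poly_Mapping.lookup b i) * Poly_Mapping.lookup p b else 0)"
    proof (cases "Poly_Mapping.lookup b i = 0")
      case True
      then have "b \<noteq> a + ?e" by (auto simp: lookup_add)
      with True show ?thesis by simp
    next
      case False
      then have "b - ?e + ?e = b"
        by (auto simp: poly_mapping_eq_iff fun_eq_iff lookup_add lookup_minus lookup_single when_def)
      then have "b - ?e = a \<longleftrightarrow> b = a + ?e"
        by (metis add_diff_cancel_right')
      then show ?thesis by (auto simp: lookup_single when_def)
    qed
  qed
  also have "\<dots> = of_nat (Poly_Mapping.lookup a i + 1) * Poly_Mapping.lookup p (a + ?e)"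
    by (auto simp: in_keys_iff lookup_add)
  finally show ?thesis .
qed

lemma partial_add: "partial i (p + q) = partial i p + partial i q"
  by (simp add: poly_mapping_eq_iff fun_eq_iff lookup_partial lookup_add algebra_simps)

lemma partial_scale: "partial i (poly_scale c p) = poly_scale c (partial i p)"
  by (simp add: poly_mapping_eq_iff fun_eq_iff lookup_partial lookup_poly_scale algebra_simps)

lemma partial_commute: "partial i (partial j p) = partial j (partial i p)"
proof (cases "i = j")
  case False
  then show ?thesis
    by (simp add: poly_mapping_eq_iff fun_eq_iff lookup_partial lookup_add lookup_single when_def ac_simps)
qed simp

lemma partial_monomial:
  "partial i (monomial a) = poly_scale (of_nat (Poly_Mapping.lookup a i)) (monomial (a - Poly_Mapping.single i 1))"
  by (simp add: partial_def monomial_def flip: single_eq_scale_monomial)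
    (simp add: poly_mapping_eq_iff fun_eq_iff lookup_poly_scale lookup_single when_def)

lemma partial_var: "partial i (var j) = (if i = j then 1 else 0)"
  by (auto simp: var_def partial_monomial lookup_single monomial_0 when_def)

lemma partial_mult_monomial:
  fixes m m' :: "('n, 'k::field) mpoly"
  assumes m: "m = monomial a" "m' = monomial b"
  shows "partial i (m * m') = partial i m * m' + m * partial i m'"
proof -
  let ?e = "Poly_Mapping.single i (1::nat)"
  let ?t = "\<lambda>n. poly_scale (of_nat n) (monomial (a + b - ?e)) :: ('n, 'k) mpoly"
  have "a - ?e + b = a + b - ?e" if "Poly_Mapping.lookup a i \<noteq> 0"
    using that by (auto simp: poly_mapping_eq_iff fun_eq_iff lookup_add lookup_minus lookup_single when_def)
  then have 1: "partial i m * m' = ?t (Poly_Mapping.lookup a i)"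
    by (cases "Poly_Mapping.lookup a i = 0") (auto simp: m partial_monomial poly_scale_mult_left monomial_mult)
  have "a + (b - ?e) = a + b - ?e" if "Poly_Mapping.lookup b i \<noteq> 0"
    using that by (auto simp: poly_mapping_eq_iff fun_eq_iff lookup_add lookup_minus lookup_single when_def)
  then have 2: "m * partial i m' = ?t (Poly_Mapping.lookup b i)"
    by (cases "Poly_Mapping.lookup b i = 0") (auto simp: m partial_monomial poly_scale_mult_right monomial_mult)
  show ?thesis
    by (simp only: 1 2) (simp add: m monomial_mult partial_monomial lookup_add poly.scale_left_distrib)
qed

lemma partial_mult: "partial i (p * q) = partial i p * q + p * partial i q"
proof -
  have 1: "partial i (monomial a * q) = partial i (monomial a) * q + monomial a * partial i q" for a q
  proof (rule additive_eqI[where F = "\<lambda>q. partial i (monomial a * q)"])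
    show "partial i (monomial a * Poly_Mapping.single b c) =
        partial i (monomial a) * Poly_Mapping.single b c + monomial a * partial i (Poly_Mapping.single b c)" for b c
      by (simp add: single_eq_scale_monomial partial_scale poly_scale_mult_right partial_mult_monomial[OF refl refl]
          poly.scale_right_distrib)
  qed (auto simp: partial_add algebra_simps)
  show ?thesis
  proof (rule additive_eqI[where F = "\<lambda>p. partial i (p * q)"])
    show "partial i (Poly_Mapping.single b c * q) =
        partial i (Poly_Mapping.single b c) * q + Poly_Mapping.single b c * partial i q" for b c
      by (simp add: single_eq_scale_monomial partial_scale poly_scale_mult_left 1 poly.scale_right_distrib)
  qed (auto simp: partial_add algebra_simps)
qed

lemma derivationsI:
  assumes "\<And>p q. D (p + q) = D p + D q" "\<And>c p. D (poly_scale c p) = poly_scale c (D p)"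
    "\<And>p q. D (p * q) = D p * q + p * D q"
  shows "D \<in> derivations"
  unfolding derivations_def using assms
  by (auto simp: Vector_Spaces.linear_iff poly.vector_space_axioms)

lemma derivationsD:
  assumes "D \<in> derivations"
  shows "D (p + q) = D p + D q" "D (poly_scale c p) = poly_scale c (D p)" "D (p * q) = D p * q + p * D q"
  using assms unfolding derivations_def by (auto simp: Vector_Spaces.linear_iff)

lemma derivation_diff: "D \<in> derivations \<Longrightarrow> D (p - q) = D p - D q"
  using derivationsD(1)[of D "p - q" q] by simp

lemma vf_in_derivations: "vf f i \<in> derivations"
  by (rule derivationsI)
    (auto simp: vf_def partial_add partial_mult partial_scale poly_scale_mult_right algebra_simps)

lemma subspace_derivations: "vfield.subspace (derivations :: ('n, 'k::field) vfield set)"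
proof (rule vfield.subspaceI)
  show "(0 :: ('n, 'k) vfield) \<in> derivations" by (rule derivationsI) auto
next
  fix D E :: "('n, 'k) vfield" assume "D \<in> derivations" "E \<in> derivations"
  then show "D + E \<in> derivations"
    by (intro derivationsI) (auto simp: derivationsD poly.scale_right_distrib algebra_simps)
next
  fix c and D :: "('n, 'k) vfield" assume D: "D \<in> derivations"
  show "vf_scale c D \<in> derivations"
    by (intro derivationsI)
      (auto simp: pointwise_scale_def derivationsD[OF D] poly.scale_right_distrib
        poly_scale_mult_left poly_scale_mult_right mult.commute)
qed

lemma vf_bracket_in_derivations:
  assumes D: "D \<in> derivations" and E: "E \<in> derivations"
  shows "vf_bracket D E \<in> derivations"
  by (intro derivationsI)
    (auto simp: vf_bracket_def derivationsD[OF D] derivationsD[OF E] poly.scale_right_diff_distrib algebra_simps)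

text \<open>Every derivation is the sum of the fields \<open>D (var i)\<close> times the \<open>i\<close>-th partial derivative.\<close>

lemma derivation_one: "D \<in> derivations \<Longrightarrow> D 1 = 0"
  using derivationsD(3)[of D 1 1] by simp

lemma derivation_eqI:
  fixes D :: "('n::finite, 'k::field) vfield"
  assumes D: "D \<in> derivations" and E: "E \<in> derivations" and v: "\<And>i. D (var i) = E (var i)"
  shows "D = E"
proof -
  have mono: "D (monomial a) = E (monomial a)" for a
  proof (induction "total_degree a" arbitrary: a)
    case 0
    then have "a = 0" by (simp add: total_degree_def poly_mapping_eq_iff fun_eq_iff)
    then show ?case using D E by (simp add: monomial_0 derivation_one)
  next
    case (Suc n)
    then obtain i where i: "Poly_Mapping.lookup a i \<noteq> 0"
      unfolding total_degree_def by (metis nat.distinct(1) sum.neutral)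
    define b where "b = a - Poly_Mapping.single i 1"
    have a: "a = b + Poly_Mapping.single i 1"
      using i by (auto simp: b_def poly_mapping_eq_iff fun_eq_iff lookup_add lookup_minus lookup_single when_def)
    have "total_degree a = total_degree b + 1"
      by (simp add: total_degree_def a lookup_add sum.distrib lookup_single when_def)
    then have "D (monomial b) = E (monomial b)" using Suc by simp
    moreover have "monomial a = monomial b * (var i :: ('n, 'k) mpoly)" by (simp add: a var_def monomial_mult)
    ultimately show ?case by (simp add: derivationsD(3)[OF D] derivationsD(3)[OF E] v)
  qed
  have "D p = E p" for p
    by (rule additive_eqI[where F = D and G = E])
      (auto simp: derivationsD[OF D] derivationsD[OF E] single_eq_scale_monomial mono)
  then show ?thesis by auto
qed

lemma derivation_eq_sum_vf:
  fixes D :: "('n::finite, 'k::field) vfield"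
  assumes D: "D \<in> derivations"
  shows "D = (\<Sum>i\<in>UNIV. vf (D (var i)) i)"
proof (rule derivation_eqI[OF D])
  show "(\<Sum>i\<in>UNIV. vf (D (var i)) i) \<in> derivations"
    by (intro vfield.subspace_sum subspace_derivations vf_in_derivations)
  fix j
  have "(\<Sum>i\<in>A. vf (D (var i)) i) p = (\<Sum>i\<in>A. vf (D (var i)) i p)" for A p
    by (induction A rule: infinite_finite_induct) auto
  then show "D (var j) = (\<Sum>i\<in>UNIV. vf (D (var i)) i) (var j)"
    by (simp add: vf_def partial_var if_distrib cong: if_cong)
qed

lemma lie_algebra_derivations:
  "lie_algebra vf_scale (derivations :: ('n, 'k::field) vfield set) vf_bracket"
proof (unfold_locales, goal_cases)
  case 1 show ?case by (rule subspace_derivations)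
next
  case (2 x y) then show ?case by (rule vf_bracket_in_derivations)
next
  case (8 x y z)
  then show ?case by (simp add: vf_bracket_def fun_eq_iff derivation_diff)
qed (auto simp: vf_bracket_def fun_eq_iff pointwise_scale_def derivationsD poly.scale_right_diff_distrib)

lemma lookup_mult_0:
  fixes p q :: "('n, 'k::field) mpoly"
  shows "Poly_Mapping.lookup (p * q) 0 = Poly_Mapping.lookup p 0 * Poly_Mapping.lookup q 0"
proof -
  have a0: "a + b = 0 \<longleftrightarrow> a = 0 \<and> b = 0" for a b :: "'n \<Rightarrow>\<^sub>0 nat"
    by (auto simp: poly_mapping_eq_iff fun_eq_iff lookup_add)
  have 1: "Poly_Mapping.lookup (Poly_Mapping.single a c * q) 0 = Poly_Mapping.lookup (Poly_Mapping.single a c) 0 * Poly_Mapping.lookup q 0"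
    for a c and q :: "('n, 'k) mpoly"
    by (rule additive_eqI[where F = "\<lambda>q. Poly_Mapping.lookup (Poly_Mapping.single a c * q) 0"])
      (auto simp: lookup_add distrib_left mult_single lookup_single when_def a0)
  show ?thesis
    by (rule additive_eqI[where F = "\<lambda>p. Poly_Mapping.lookup (p * q) 0"])
      (auto simp: lookup_add distrib_right 1)
qed

text \<open>\<open>lie_plus\<close> consists of the derivations vanishing at the origin.\<close>

lemma total_degree_eq_0_iff: "total_degree a = 0 \<longleftrightarrow> a = 0"
  by (simp add: total_degree_def poly_mapping_eq_iff fun_eq_iff)

lemma vf_sum_monomials:
  fixes f :: "('n, 'k::field) mpoly"
  shows "vf f i = (\<Sum>a\<in>Poly_Mapping.keys f. vf_scale (Poly_Mapping.lookup f a) (vf (monomial a) i))"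
proof
  fix p :: "('n, 'k) mpoly"
  have "(\<Sum>a\<in>A. vf_scale (c a) (vf (monomial a) i)) p = (\<Sum>a\<in>A. poly_scale (c a) (monomial a)) * partial i p"
    for A and c :: "_ \<Rightarrow> 'k"
    by (induction A rule: infinite_finite_induct)
      (auto simp: vf_def pointwise_scale_def poly_scale_mult_left distrib_right)
  then show "vf f i p = (\<Sum>a\<in>Poly_Mapping.keys f. vf_scale (Poly_Mapping.lookup f a) (vf (monomial a) i)) p"
    using poly_mapping_sum_single[of f] by (simp add: vf_def single_eq_scale_monomial)
qed

lemma lie_plus_iff:
  fixes D :: "('n::finite, 'k::field) vfield"
  shows "D \<in> lie_plus \<longleftrightarrow> D \<in> derivations \<and> (\<forall>i. Poly_Mapping.lookup (D (var i)) 0 = 0)"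
proof
  let ?S = "{D :: ('n, 'k) vfield. D \<in> derivations \<and> (\<forall>i. Poly_Mapping.lookup (D (var i)) 0 = 0)}"
  have S: "vfield.subspace ?S"
    using subspace_derivations
    by (auto simp: vfield.subspace_def lookup_add pointwise_scale_def lookup_poly_scale)
  have "vf (monomial a) i \<in> ?S" if "total_degree a \<noteq> 0" for a i
    using that[unfolded total_degree_eq_0_iff]
    by (simp add: vf_in_derivations) (simp add: vf_def lookup_mult_0 monomial_def lookup_single)
  then have "vf_graded d \<subseteq> ?S" if "d \<ge> 0" for d
    unfolding vf_graded_def using that by (intro vfield.span_minimal S) auto
  then have "lie_plus \<subseteq> ?S"
    unfolding lie_plus_def by (intro vfield.span_minimal S) auto
  then show "D \<in> lie_plus \<Longrightarrow> D \<in> derivations \<and> (\<forall>i. Poly_Mapping.lookup (D (var i)) 0 = 0)"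
    by auto
next
  assume D: "D \<in> derivations \<and> (\<forall>i. Poly_Mapping.lookup (D (var i)) 0 = 0)"
  have mono: "vf (monomial a) i \<in> lie_plus" if "total_degree a \<noteq> 0" for a :: "'n \<Rightarrow>\<^sub>0 nat" and i
  proof -
    have "vf (monomial a) i \<in> vf_graded (int (total_degree a) - 1)"
      unfolding vf_graded_def by (intro vfield.span_base) auto
    then show ?thesis
      unfolding lie_plus_def using that by (intro vfield.span_base) auto
  qed
  have sub: "vfield.subspace (lie_plus :: ('n, 'k) vfield set)"
    unfolding lie_plus_def by (rule vfield.subspace_span)
  have "vf (D (var i)) i \<in> lie_plus" for i
    unfolding vf_sum_monomials[of "D (var i)"]
  proof (intro vfield.subspace_sum sub vfield.subspace_scale mono)
    fix a assume "a \<in> Poly_Mapping.keys (D (var i))"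
    then show "total_degree a \<noteq> 0" using D by (auto simp: total_degree_eq_0_iff in_keys_iff)
  qed
  then have "(\<Sum>i\<in>UNIV. vf (D (var i)) i) \<in> lie_plus"
    by (intro vfield.subspace_sum sub)
  moreover have "D = (\<Sum>i\<in>UNIV. vf (D (var i)) i)"
    using D by (intro derivation_eq_sum_vf) blast
  ultimately show "D \<in> lie_plus" by (rule back_subst[OF _ sym])
qed

lemma lie_algebra_lie_plus:
  "lie_algebra vf_scale (lie_plus :: ('n::finite, 'k::field) vfield set) vf_bracket"
proof -
  have zero: "Poly_Mapping.lookup (D p) 0 = 0" if D: "D \<in> lie_plus" for D :: "('n, 'k) vfield" and p
  proof -
    have "(\<Sum>i\<in>A. vf (D (var i)) i) p = (\<Sum>i\<in>A. vf (D (var i)) i p)" for A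
      by (induction A rule: infinite_finite_induct) auto
    moreover have "D = (\<Sum>i\<in>UNIV. vf (D (var i)) i)"
      using D by (intro derivation_eq_sum_vf) (simp add: lie_plus_iff)
    ultimately have "D p = (\<Sum>i\<in>UNIV. vf (D (var i)) i p)"
      by (rule trans[OF fun_cong, rotated])
    moreover have "Poly_Mapping.lookup (\<Sum>i\<in>UNIV. vf (D (var i)) i p) 0 = 0"
      using D by (simp add: lookup_sum vf_def lookup_mult_0 lie_plus_iff)
    ultimately show ?thesis by (rule ssubst)
  qed
  interpret W: lie_algebra vf_scale "derivations :: ('n, 'k) vfield set" vf_bracket
    by (rule lie_algebra_derivations)
  have le: "D \<in> derivations" if "D \<in> lie_plus" for D :: "('n, 'k) vfield"
    using that by (simp add: lie_plus_iff)
  show ?thesis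
  proof (unfold_locales, goal_cases)
    case 1 show ?case unfolding lie_plus_def by (rule vfield.subspace_span)
  next
    case (2 x y)
    have "vf_bracket x y \<in> derivations" by (intro W.bracket_closed le 2)
    moreover have "Poly_Mapping.lookup (vf_bracket x y p) 0 = 0" for p
      by (simp add: vf_bracket_def lookup_minus zero 2)
    ultimately show ?case by (simp add: lie_plus_iff)
  qed (use le in \<open>auto simp: W.bracket_add_left W.bracket_add_right W.bracket_scale_left
      W.bracket_scale_right W.bracket_self W.jacobi\<close>)
qed

lemma comp_fun_commute_partial:
  fixes k :: "'n::finite \<Rightarrow>\<^sub>0 nat"
  shows "comp_fun_commute (\<lambda>i. partial i ^^ Poly_Mapping.lookup k i :: ('n, 'k::field) mpoly \<Rightarrow> _)"
proof
  fix i j :: 'n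
  have "partial i \<circ> partial j = partial j \<circ> (partial i :: ('n, 'k) mpoly \<Rightarrow> _)"
    by (auto simp: partial_commute)
  then have 1: "partial i \<circ> (partial j ^^ n) = (partial j ^^ n) \<circ> (partial i :: ('n, 'k) mpoly \<Rightarrow> _)" for n
    by (induction n) (auto simp: fun_eq_iff)
  have "(partial i ^^ m) \<circ> (partial j ^^ n) = (partial j ^^ n) \<circ> (partial i ^^ m :: ('n, 'k) mpoly \<Rightarrow> _)" for m n
    using 1[of n] by (induction m) (auto simp: fun_eq_iff)
  then show "(partial j ^^ Poly_Mapping.lookup k j) \<circ> (partial i ^^ Poly_Mapping.lookup k i) =
      (partial i ^^ Poly_Mapping.lookup k i) \<circ> (partial j ^^ Poly_Mapping.lookup k j :: ('n, 'k) mpoly \<Rightarrow> _)"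
    by metis
qed

lemma lookup_partial_power:
  fixes p :: "('n, 'k::field) mpoly"
  shows "Poly_Mapping.lookup ((partial i ^^ n) p) a =
     of_nat (pochhammer (Poly_Mapping.lookup a i + 1) n) * Poly_Mapping.lookup p (a + Poly_Mapping.single i n)"
proof (induction n arbitrary: a)
  case (Suc n)
  have "a + Poly_Mapping.single i 1 + Poly_Mapping.single i n = a + Poly_Mapping.single i (Suc n)"
    by (simp add: add.assoc flip: single_add)
  moreover have "of_nat (Poly_Mapping.lookup a i + 1) * of_nat (pochhammer (Poly_Mapping.lookup a i + 2) n) =
      (of_nat (pochhammer (Poly_Mapping.lookup a i + 1) (Suc n)) :: 'k)"
    unfolding of_nat_mult[symmetric] pochhammer_rec by simp
  ultimately show ?case
    by (simp add: lookup_partial Suc lookup_add mult.assoc[symmetric] del: of_nat_Suc of_nat_add)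
qed simp

lemma lookup_multi_partial:
  fixes p :: "('n::finite, 'k::field) mpoly"
  shows "Poly_Mapping.lookup (multi_partial k p) a =
     of_nat (\<Prod>i\<in>UNIV. pochhammer (Poly_Mapping.lookup a i + 1) (Poly_Mapping.lookup k i)) *
     Poly_Mapping.lookup p (a + k)"
proof -
  interpret comp_fun_commute "\<lambda>i. partial i ^^ Poly_Mapping.lookup k i :: ('n, 'k) mpoly \<Rightarrow> _"
    by (rule comp_fun_commute_partial)
  have "Poly_Mapping.lookup (Finite_Set.fold (\<lambda>i. partial i ^^ Poly_Mapping.lookup k i) p A) a =
     of_nat (\<Prod>i\<in>A. pochhammer (Poly_Mapping.lookup a i + 1) (Poly_Mapping.lookup k i)) *
     Poly_Mapping.lookup p (a + (\<Sum>i\<in>A. Poly_Mapping.single i (Poly_Mapping.lookup k i)))" if "finite A" for A a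
    using that
  proof (induction A arbitrary: a)
    case (insert j A)
    have "pochhammer (Poly_Mapping.lookup (a + Poly_Mapping.single j n) i + 1) m =
        pochhammer (Poly_Mapping.lookup a i + 1) m" if "i \<in> A" for i n m
      using insert.hyps that by (auto simp: lookup_add lookup_single when_def)
    with insert show ?case
      by (simp add: lookup_partial_power ac_simps)
  qed simp
  moreover have "(\<Sum>i\<in>UNIV. Poly_Mapping.single i (Poly_Mapping.lookup k i)) = k"
    by (auto simp: poly_mapping_eq_iff fun_eq_iff lookup_sum lookup_single when_def)
  ultimately show ?thesis by (simp add: multi_partial_def)
qed

lemma finite_multi_partial_nonzero:
  "finite {k. k \<noteq> 0 \<and> multi_partial k (p :: ('n::finite, 'k::field) mpoly) \<noteq> 0}"
proof (rule finite_subset)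
  show "{k. k \<noteq> 0 \<and> multi_partial k p \<noteq> 0} \<subseteq>
    (\<Union>b\<in>Poly_Mapping.keys p. {k. \<exists>a. b = a + k})"
  proof
    fix k assume "k \<in> {k. k \<noteq> 0 \<and> multi_partial k p \<noteq> 0}"
    then obtain a where "Poly_Mapping.lookup (multi_partial k p) a \<noteq> 0"
      by (metis (mono_tags, lifting) lookup_zero mem_Collect_eq poly_mapping_eqI)
    then have "a + k \<in> Poly_Mapping.keys p"
      by (auto simp: lookup_multi_partial in_keys_iff)
    then show "k \<in> (\<Union>b\<in>Poly_Mapping.keys p. {k. \<exists>a. b = a + k})" by blast
  qed
  have "finite {k. \<exists>a. b = a + k}" for b :: "'n \<Rightarrow>\<^sub>0 nat"
  proof -
    have "Poly_Mapping.lookup k i \<le> total_degree b" if "b = a + k" for a k i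
      using member_le_sum[of i UNIV "Poly_Mapping.lookup k"] that
      by (simp add: total_degree_def lookup_add sum.distrib)
    then have "Poly_Mapping.lookup ` {k. \<exists>a. b = a + k} \<subseteq>
        {f. \<forall>x. (x \<in> UNIV \<longrightarrow> f x \<in> {..total_degree b}) \<and> (x \<notin> UNIV \<longrightarrow> f x = 0)}"
      by blast
    moreover have "finite {f :: 'n \<Rightarrow> nat. \<forall>x. (x \<in> UNIV \<longrightarrow> f x \<in> {..total_degree b}) \<and> (x \<notin> UNIV \<longrightarrow> f x = 0)}"
      by (rule finite_set_of_finite_funs) auto
    ultimately have "finite (Poly_Mapping.lookup ` {k. \<exists>a. b = a + k})"
      by (rule finite_subset)
    moreover have "inj_on Poly_Mapping.lookup {k. \<exists>a. b = a + k}"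
      by (rule inj_onI) (rule poly_mapping_eqI, rule fun_cong)
    ultimately show ?thesis by (rule finite_imageD)
  qed
  then show "finite (\<Union>b\<in>Poly_Mapping.keys p. {k. \<exists>a. b = a + k})" by auto
qed

lemma lookup_tensor:
  assumes "vector_space scaleW"
  shows "Poly_Mapping.lookup (tensor scaleW s w) a = scaleW (Poly_Mapping.lookup s a) w"
proof -
  interpret vector_space scaleW by (fact assms)
  show ?thesis by (auto simp: tensor_def map.rep_eq when_def)
qed

lemma tensor_bilinear:
  assumes "vector_space scaleW"
  shows "Vector_Spaces.linear poly_scale (coeff_scale scaleW) (\<lambda>s. tensor scaleW s w)"
    and "Vector_Spaces.linear scaleW (coeff_scale scaleW) (\<lambda>w. tensor scaleW s w)"
proof -
  interpret vector_space scaleW by (fact assms)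
  note [simp] = lookup_tensor[OF assms] lookup_coeff_scale[OF assms]
  show "Vector_Spaces.linear poly_scale (coeff_scale scaleW) (\<lambda>s. tensor scaleW s w)"
    "Vector_Spaces.linear scaleW (coeff_scale scaleW) (\<lambda>w. tensor scaleW s w)"
    using assms vector_space_coeff_scale[OF assms] poly.vector_space_axioms
    by (auto simp: Vector_Spaces.linear_iff poly_mapping_eq_iff fun_eq_iff lookup_add lookup_poly_scale
        scale_left_distrib scale_right_distrib mult.commute)
qed

lemma tensor_monomial:
  assumes "vector_space scaleW"
  shows "tensor scaleW (monomial a) w = Poly_Mapping.single a w"
proof -
  interpret vector_space scaleW by (fact assms)
  show ?thesis
    by (auto simp: poly_mapping_eq_iff fun_eq_iff lookup_tensor[OF assms] monomial_def lookup_single when_def)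
qed

lemma sum_keys_linear:
  fixes F :: "'a \<Rightarrow> 'w::ab_group_add \<Rightarrow> 'u::ab_group_add"
  assumes sW: "vector_space scaleW" and F: "\<And>a. Vector_Spaces.linear scaleW scaleU (F a)" and sU: "vector_space scaleU"
  shows "Vector_Spaces.linear (coeff_scale scaleW) scaleU
    (\<lambda>m. \<Sum>a\<in>Poly_Mapping.keys m. F a (Poly_Mapping.lookup m a))"
proof -
  interpret W: vector_space scaleW by (fact sW)
  interpret U: vector_space scaleU by (fact sU)
  interpret F: Vector_Spaces.linear scaleW scaleU "F a" for a by (rule F)
  have "(\<Sum>a\<in>Poly_Mapping.keys (coeff_scale scaleW c m). F a (Poly_Mapping.lookup (coeff_scale scaleW c m) a)) =
     scaleU c (\<Sum>a\<in>Poly_Mapping.keys m. F a (Poly_Mapping.lookup m a))" for c m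
    unfolding U.scale_sum_right lookup_coeff_scale[OF sW] F.scale
    by (rule sum.mono_neutral_left) (auto simp: in_keys_iff lookup_coeff_scale[OF sW] F.scale[symmetric] F.zero)
  moreover have "(\<Sum>a\<in>Poly_Mapping.keys (p + q). F a (Poly_Mapping.lookup (p + q) a)) =
     (\<Sum>a\<in>Poly_Mapping.keys p. F a (Poly_Mapping.lookup p a)) + (\<Sum>a\<in>Poly_Mapping.keys q. F a (Poly_Mapping.lookup q a))" for p q
    by (rule setsum_keys_plus_distrib) (auto simp: F.add F.zero)
  ultimately show ?thesis
    using vector_space_coeff_scale[OF sW] sU by (simp add: Vector_Spaces.linear_iff)
qed

lemma sum_keys_tensor:
  fixes scaleW :: "'k::field \<Rightarrow> 'w::ab_group_add \<Rightarrow> 'w" and scaleU :: "'k \<Rightarrow> 'u::ab_group_add \<Rightarrow> 'u"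
    and \<beta> :: "('n, 'k) mpoly \<Rightarrow> 'w \<Rightarrow> 'u" and s :: "('n, 'k) mpoly" and w :: 'w
  assumes sW: "vector_space scaleW" and B1: "\<And>w. Vector_Spaces.linear poly_scale scaleU (\<lambda>s. \<beta> s w)"
    and B2: "\<And>s. Vector_Spaces.linear scaleW scaleU (\<beta> s)"
  shows "(\<Sum>a\<in>Poly_Mapping.keys (tensor scaleW s w). \<beta> (monomial a) (Poly_Mapping.lookup (tensor scaleW s w) a)) = \<beta> s w"
proof -
  interpret W: vector_space scaleW by (fact sW)
  interpret B1: Vector_Spaces.linear poly_scale scaleU "\<lambda>s. \<beta> s v" for v by (rule B1)
  interpret B2: Vector_Spaces.linear scaleW scaleU "\<beta> t" for t by (rule B2)
  have "(\<Sum>a\<in>Poly_Mapping.keys (tensor scaleW s w). \<beta> (monomial a) (Poly_Mapping.lookup (tensor scaleW s w) a)) =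
     (\<Sum>a\<in>Poly_Mapping.keys s. \<beta> (monomial a) (Poly_Mapping.lookup (tensor scaleW s w) a))"
    by (rule sum.mono_neutral_left) (auto simp: in_keys_iff lookup_tensor[OF sW] B2.zero)
  also have "\<dots> = (\<Sum>a\<in>Poly_Mapping.keys s. \<beta> (Poly_Mapping.single a (Poly_Mapping.lookup s a)) w)"
    by (simp add: lookup_tensor[OF sW] B2.scale single_eq_scale_monomial B1.scale)
  also have "\<dots> = \<beta> s w"
    using B1.sum[of "\<lambda>a. Poly_Mapping.single a (Poly_Mapping.lookup s a)" "Poly_Mapping.keys s"]
      poly_mapping_sum_single[of s] by metis
  finally show ?thesis .
qed

theorem tensor_product_universal:
  fixes scaleW :: "'k::field \<Rightarrow> 'w::ab_group_add \<Rightarrow> 'w" and scaleU :: "'k \<Rightarrow> 'u::ab_group_add \<Rightarrow> 'u"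
    and \<beta> :: "('n, 'k) mpoly \<Rightarrow> 'w \<Rightarrow> 'u"
  assumes sW: "vector_space scaleW" and sU: "vector_space scaleU"
    and B1: "\<And>w. Vector_Spaces.linear poly_scale scaleU (\<lambda>s. \<beta> s w)"
    and B2: "\<And>s. Vector_Spaces.linear scaleW scaleU (\<beta> s)"
  shows "\<exists>!h :: (('n \<Rightarrow>\<^sub>0 nat) \<Rightarrow>\<^sub>0 'w) \<Rightarrow> 'u. Vector_Spaces.linear (coeff_scale scaleW) scaleU h \<and> (\<forall>s w. h (tensor scaleW s w) = \<beta> s w)"
proof (rule ex_ex1I)
  show "\<exists>h. Vector_Spaces.linear (coeff_scale scaleW) scaleU h \<and> (\<forall>s w. h (tensor scaleW s w) = \<beta> s w)"
    by (rule exI[of _ "\<lambda>m. \<Sum>a\<in>Poly_Mapping.keys m. \<beta> (monomial a) (Poly_Mapping.lookup m a)"])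
      (intro conjI allI sum_keys_tensor[OF sW B1 B2] sum_keys_linear[OF sW B2 sU])
next
  fix h h'
  assume h: "Vector_Spaces.linear (coeff_scale scaleW) scaleU h \<and> (\<forall>s w. h (tensor scaleW s w) = \<beta> s w)"
    and h': "Vector_Spaces.linear (coeff_scale scaleW) scaleU h' \<and> (\<forall>s w. h' (tensor scaleW s w) = \<beta> s w)"
  have "h m = h' m" for m
  proof (rule additive_eqI[where F = h and G = h'])
    show "h (x + y) = h x + h y" "h' (x + y) = h' x + h' y" for x y
      using h h' by (simp_all add: Vector_Spaces.linear_iff)
    show "h (Poly_Mapping.single a w) = h' (Poly_Mapping.single a w)" for a w
      unfolding tensor_monomial[OF sW, symmetric] using h h' by simp
  qed
  then show "h = h'" by auto
qed

context
  fixes scaleW :: "'k::field_char_0 \<Rightarrow> 'w::ab_group_add \<Rightarrow> 'w"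
    and act :: "('n::finite, 'k) vfield \<Rightarrow> 'w \<Rightarrow> 'w"
  assumes W: "lie_module vf_scale lie_plus vf_bracket scaleW act"
begin

interpretation W: lie_module vf_scale lie_plus vf_bracket scaleW act
  by (fact W)

lemma vf_monomial_in_lie_plus:
  fixes k :: "'n \<Rightarrow>\<^sub>0 nat"
  assumes "k \<noteq> 0"
  shows "(vf (monomial k) i :: ('n, 'k) vfield) \<in> lie_plus"
  unfolding lie_plus_iff using assms
  by (auto simp: vf_in_derivations) (simp add: vf_def lookup_mult_0 monomial_def lookup_single)

lemma tensor_act_pure_bilinear:
  assumes D: "D \<in> derivations"
  shows "Vector_Spaces.linear poly_scale (coeff_scale scaleW) (\<lambda>s. tensor_act_pure scaleW act D s w)"
    and "Vector_Spaces.linear scaleW (coeff_scale scaleW) (tensor_act_pure scaleW act D s)"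
proof -
  note W_vs = W.M.vector_space_axioms
  interpret T: vector_space "coeff_scale scaleW :: 'k \<Rightarrow> (('n \<Rightarrow>\<^sub>0 nat) \<Rightarrow>\<^sub>0 'w) \<Rightarrow> _"
    by (rule vector_space_coeff_scale[OF W_vs])
  interpret L: Vector_Spaces.linear poly_scale "coeff_scale scaleW" "\<lambda>s :: ('n, 'k) mpoly. tensor scaleW s w" for w
    by (rule tensor_bilinear[OF W_vs])
  interpret R: Vector_Spaces.linear scaleW "coeff_scale scaleW" "tensor scaleW (s :: ('n, 'k) mpoly)" for s
    by (rule tensor_bilinear[OF W_vs])
  have A: "act (vf (monomial k) i) (v + w) = act (vf (monomial k) i) v + act (vf (monomial k) i) w"
    "act (vf (monomial k) i) (scaleW c w) = scaleW c (act (vf (monomial k) i) w)" if "k \<noteq> 0" for k i v w c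
    using W.act_linear[OF vf_monomial_in_lie_plus[OF that, of i]] by (auto simp: Vector_Spaces.linear_iff)
  show "Vector_Spaces.linear poly_scale (coeff_scale scaleW) (\<lambda>s. tensor_act_pure scaleW act D s w)"
    using T.vector_space_axioms poly.vector_space_axioms
    by (auto simp: Vector_Spaces.linear_iff tensor_act_pure_def derivationsD[OF D] distrib_left distrib_right
        poly_scale_mult_left poly_scale_mult_right L.add L.scale T.scale_right_distrib T.scale_sum_right sum.distrib ac_simps)
  show "Vector_Spaces.linear scaleW (coeff_scale scaleW) (tensor_act_pure scaleW act D s)"
    using T.vector_space_axioms W_vs
    by (auto simp: Vector_Spaces.linear_iff tensor_act_pure_def A
        R.add R.scale T.scale_right_distrib T.scale_sum_right sum.distrib ac_simps)
qed

theorem tensor_act_linear: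
  assumes "D \<in> derivations"
  shows "Vector_Spaces.linear (coeff_scale scaleW) (coeff_scale scaleW) (tensor_act scaleW act D)"
  unfolding tensor_act_def[abs_def]
  by (intro sum_keys_linear W.M.vector_space_axioms tensor_act_pure_bilinear vector_space_coeff_scale assms)

theorem tensor_act_tensor:
  assumes "D \<in> derivations"
  shows "tensor_act scaleW act D (tensor scaleW s w) = tensor_act_pure scaleW act D s w"
  unfolding tensor_act_def
  by (rule sum_keys_tensor[OF W.M.vector_space_axioms tensor_act_pure_bilinear[OF assms]])

theorem tensor_act_vf:
  "tensor_act scaleW act (vf f i) (tensor scaleW s w) =
     tensor scaleW (f * partial i s) w +
     (\<Sum>k | k \<noteq> 0 \<and> multi_partial k f \<noteq> 0.
        tensor scaleW (poly_scale (1 / of_nat (multi_fact k)) (multi_partial k f) * s) (act (vf (monomial k) i) w))"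
proof -
  have 0: "multi_partial k 0 = (0 :: ('n, 'k) mpoly)" for k
    by (simp add: poly_mapping_eq_iff fun_eq_iff lookup_multi_partial)
  have v: "vf f i (var j) = (if j = i then f else 0)" for j
    by (auto simp: vf_def partial_var)
  let ?S = "\<lambda>j. \<Sum>k | k \<noteq> 0 \<and> multi_partial k (vf f i (var j)) \<noteq> 0.
      tensor scaleW (poly_scale (1 / of_nat (multi_fact k)) (multi_partial k (vf f i (var j))) * s) (act (vf (monomial k) j) w)"
  have "(\<Sum>j\<in>UNIV. ?S j) = (\<Sum>j\<in>UNIV. if j = i then ?S i else 0)"
    by (rule sum.cong) (auto simp: v 0)
  then have "(\<Sum>j\<in>UNIV. ?S j) = ?S i" by simp
  then show ?thesis
    by (simp add: tensor_act_tensor[OF vf_in_derivations] tensor_act_pure_def v) (simp add: vf_def)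
qed

end

end

theory Submission
  imports Defs
begin

text \<open>
  Evaluation at the origin is an \<open>\<L>\<^sub>+\<close>-linear map \<open>A \<otimes> W \<rightarrow> W\<close>, so restricting a cochain to \<open>\<L>\<^sub>+\<close> and
  evaluating its values there is a surjective chain map, and it is enough that its kernel \<open>K\<close> is acyclic.
  Contraction with the Euler field taken \<open>A\<close>-linearly, \<open>(h \<omega>)(v\<^sub>2, \<dots>) = \<Sum>\<^sub>i x\<^sub>i \<omega>(\<partial>\<^sub>i, v\<^sub>2, \<dots>)\<close>, preserves \<open>K\<close>,
  hence so does \<open>L = d h + h d\<close>, which commutes with \<open>d\<close>.  On a list of fields \<open>x\<^sup>\<alpha> \<partial>\<^sub>l\<close>, of which \<open>p\<close> are
  translations, \<open>L \<omega>\<close> is \<open>(E + p) \<omega>\<close>, where \<open>E\<close> multiplies \<open>x\<^sup>a \<otimes> w\<close> by \<open>|a|\<close>, plus values of \<open>\<omega>\<close> on lists of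
  smaller total degree.  The scalar \<open>|a| + p\<close> vanishes only where elements of \<open>K\<close> do, so \<open>L\<close> can be inverted on
  \<open>K\<close> degree by degree.  A cocycle \<open>L \<eta>\<close> then satisfies \<open>L (d \<eta>) = 0\<close>, so \<open>d \<eta> = 0\<close> and \<open>L \<eta> = d (h \<eta>)\<close>.
\<close>

section \<open>Isomorphisms of quotient spaces\<close>

text \<open>If the Euler field were inserted as an ordinary argument, L would be the Lie derivative
  along it; its weights subtract the degrees of the arguments and involve the action on W, so they
  may vanish inside K as well. Pulling the coefficients out of the cochain leaves only the
  nonnegative integers |a| + p. Cochains are arbitrary multilinear maps, in effect infinite families
  of values on lists of basis fields. An inverse of L is therefore an infinite series, and it makes
  sense because on each list of arguments only finitely many of its terms are nonzero. The scalar
  |a| + p depends on the arguments through p, so dividing by it is not composition with one linear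
  map. The costs are arranged so that p is the same, namely \<open>N mod q\<close>, on all lists of
  basis fields of cost \<open>N\<close>. Each correction step then composes with a single diagonal
  operator, and this plainly preserves multilinearity and alternation. That
  \<open>tensor_act\<close> is a Lie algebra action is not taken for granted either; it is proved by
  comparing Taylor coefficients at the origin.\<close>

lemma elt_set_plus_iff: "x \<in> z +o B \<longleftrightarrow> x - z \<in> B" for z :: "'a::ab_group_add"
  by (auto simp: elt_set_plus_def) (metis add_diff_cancel_left' diff_add_cancel add.commute)

text \<open>All conditions concern representatives, so that cosets need not be handled again; by
  linearity of \<open>f\<close>, \<open>inj\<close> says that the induced map has trivial
  kernel.\<close>

lemma quotients_isomorphicI:
  assumes f: "Vector_Spaces.linear s\<^sub>1 s\<^sub>2 f"
    and Z1: "module.subspace s\<^sub>1 Z\<^sub>1" and B1: "module.subspace s\<^sub>1 B\<^sub>1" and B2: "module.subspace s\<^sub>2 B\<^sub>2"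
    and img: "\<And>z. z \<in> Z\<^sub>1 \<Longrightarrow> f z \<in> Z\<^sub>2"
    and inj: "\<And>z. z \<in> Z\<^sub>1 \<Longrightarrow> f z \<in> B\<^sub>2 \<Longrightarrow> z \<in> B\<^sub>1"
    and bound: "\<And>b. b \<in> B\<^sub>1 \<Longrightarrow> f b \<in> B\<^sub>2"
    and surj: "\<And>y. y \<in> Z\<^sub>2 \<Longrightarrow> \<exists>z\<in>Z\<^sub>1. y - f z \<in> B\<^sub>2"
  shows "quotients_isomorphic s\<^sub>1 Z\<^sub>1 B\<^sub>1 s\<^sub>2 Z\<^sub>2 B\<^sub>2"
proof -
  interpret f: Vector_Spaces.linear s\<^sub>1 s\<^sub>2 f by (rule f)
  have coset_add: "(x +o B) + (y +o B) = (x + y) +o B" if "module.subspace s B" "vector_space s"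
    for s and B :: "'x::ab_group_add set" and x y
  proof -
    interpret vector_space s by (rule that)
    have "\<exists>a\<in>B. \<exists>b\<in>B. c = a + b" if "c \<in> B" for c
      using subspace_0[OF \<open>subspace B\<close>] that by (metis add.right_neutral)
    moreover have "a + b \<in> B" if "a \<in> B" "b \<in> B" for a b using \<open>subspace B\<close> that by (rule subspace_add)
    ultimately have "B + B = B" by (auto simp: set_plus_def)
    then show ?thesis by (simp add: set_plus_rearrange)
  qed
  have coset_scl: "coset_scale s B c (x +o B) = s c x +o B" if B: "module.subspace s B" and "vector_space s"
    for s :: "'y::field \<Rightarrow> 'x::ab_group_add \<Rightarrow> 'x" and B and c x
  proof -
    interpret vector_space s by (rule that)
    show ?thesis
    proof (intro equalityI subsetI)
      fix y assume "y \<in> coset_scale s B c (x +o B)"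
      then obtain b b' where "b \<in> B" "b' \<in> B" "y = s c (x + b) + b'"
        by (auto simp: coset_scale_def set_plus_def elt_set_plus_def)
      then show "y \<in> s c x +o B"
        using subspace_add[OF B subspace_scale[OF B, of b c], of b'] by (simp add: elt_set_plus_iff scale_right_distrib)
    next
      fix y assume "y \<in> s c x +o B"
      then have "y = s c (x + 0) + (y - s c x)" "y - s c x \<in> B" by (auto simp: elt_set_plus_iff)
      then show "y \<in> coset_scale s B c (x +o B)"
        unfolding coset_scale_def set_plus_def elt_set_plus_def using subspace_0[OF B] by blast
    qed
  qed
  \<comment> \<open>The image under \<open>f\<close> of a coset of \<open>B\<^sub>1\<close> can be
    smaller than a coset of \<open>B\<^sub>2\<close>; adding \<open>B\<^sub>2\<close> completes it
    without a choice of representatives.\<close>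
  define \<phi> where "\<phi> X = f ` X + B\<^sub>2" for X
  have \<phi>: "\<phi> (z +o B\<^sub>1) = f z +o B\<^sub>2" for z
  proof (intro equalityI subsetI)
    fix y assume "y \<in> \<phi> (z +o B\<^sub>1)"
    then obtain b b' where "b \<in> B\<^sub>1" "b' \<in> B\<^sub>2" "y = f (z + b) + b'"
      by (auto simp: \<phi>_def set_plus_def elt_set_plus_def)
    then show "y \<in> f z +o B\<^sub>2"
      using f.vs2.subspace_add[OF B2 bound, of b b'] by (simp add: elt_set_plus_iff f.add)
  next
    fix y assume "y \<in> f z +o B\<^sub>2"
    then have "y = f (z + 0) + (y - f z)" "y - f z \<in> B\<^sub>2" by (auto simp: elt_set_plus_iff)
    then show "y \<in> \<phi> (z +o B\<^sub>1)"
      unfolding \<phi>_def set_plus_def elt_set_plus_def using f.vs1.subspace_0[OF B1] by blast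
  qed
  note add1 = coset_add[OF B1 f.vs1.vector_space_axioms] and add2 = coset_add[OF B2 f.vs2.vector_space_axioms]
  note scl1 = coset_scl[OF B1 f.vs1.vector_space_axioms] and scl2 = coset_scl[OF B2 f.vs2.vector_space_axioms]
  have eq: "x +o B = y +o B \<longleftrightarrow> x - y \<in> B" if B: "module.subspace s B" and "vector_space s"
    for s and B :: "'x::ab_group_add set" and x y
  proof -
    interpret vector_space s by (rule that)
    show ?thesis
    proof
      assume "x +o B = y +o B"
      moreover have "x \<in> x +o B" using subspace_0[OF B] by (simp add: elt_set_plus_iff)
      ultimately show "x - y \<in> B" by (simp add: elt_set_plus_iff)
    next
      assume d: "x - y \<in> B"
      have "z - x \<in> B \<longleftrightarrow> z - y \<in> B" for z
        using subspace_add[OF B _ d, of "z - x"] subspace_diff[OF B _ d, of "z - y"] by auto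
      then show "x +o B = y +o B" by (auto simp: elt_set_plus_iff)
    qed
  qed
  note eq1 = eq[OF B1 f.vs1.vector_space_axioms] and eq2 = eq[OF B2 f.vs2.vector_space_axioms]
  have "bij_betw \<phi> (quotient_space Z\<^sub>1 B\<^sub>1) (quotient_space Z\<^sub>2 B\<^sub>2)"
  proof (rule bij_betw_imageI)
    show "inj_on \<phi> (quotient_space Z\<^sub>1 B\<^sub>1)"
      by (auto simp: inj_on_def quotient_space_def \<phi> eq1 eq2 simp flip: f.diff
          intro!: inj f.vs1.subspace_diff[OF Z1])
    show "\<phi> ` quotient_space Z\<^sub>1 B\<^sub>1 = quotient_space Z\<^sub>2 B\<^sub>2"
    proof (intro equalityI subsetI)
      fix Y assume "Y \<in> quotient_space Z\<^sub>2 B\<^sub>2"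
      then obtain y where y: "y \<in> Z\<^sub>2" "Y = y +o B\<^sub>2" by (auto simp: quotient_space_def)
      obtain z where "z \<in> Z\<^sub>1" "y - f z \<in> B\<^sub>2" using surj[OF y(1)] by blast
      then show "Y \<in> \<phi> ` quotient_space Z\<^sub>1 B\<^sub>1"
        using y by (auto simp: quotient_space_def image_image \<phi> eq2 intro!: image_eqI[of _ _ z])
    qed (auto simp: quotient_space_def \<phi> img)
  qed
  then show ?thesis
    unfolding quotients_isomorphic_def
    by (intro exI[of _ \<phi>]) (auto simp: quotient_space_def \<phi> add1 add2 scl1 scl2 f.add f.scale)
qed

section \<open>Recursive form of the Chevalley--Eilenberg calculus\<close>

definition contract :: "'g \<Rightarrow> ('g list \<Rightarrow> 'm) \<Rightarrow> 'g list \<Rightarrow> 'm" where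
  "contract x \<omega> = (\<lambda>xs. \<omega> (x # xs))"

lemma contract_apply [simp]: "contract x \<omega> xs = \<omega> (x # xs)"
  by (simp add: contract_def)

text \<open>The recursion encodes the rule that contraction with y after theta_x is theta_x after
  contraction with y, minus contraction with [x, y]. Peeling off the first argument avoids index
  sums and a degree parameter; the value 0 for an argument outside \<open>g\<close> matches the
  convention for cochains.\<close>

fun lie_derivative :: "'g set \<Rightarrow> ('g \<Rightarrow> 'g \<Rightarrow> 'g) \<Rightarrow> ('g \<Rightarrow> 'm \<Rightarrow> 'm) \<Rightarrow> 'g \<Rightarrow> ('g list \<Rightarrow> 'm) \<Rightarrow> 'g list \<Rightarrow> 'm::ab_group_add" where
  "lie_derivative g bracket act x \<omega> [] = act x (\<omega> [])"
| "lie_derivative g bracket act x \<omega> (y # ys) =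
     (if y \<in> g then lie_derivative g bracket act x (contract y \<omega>) ys - \<omega> (bracket x y # ys) else 0)"

text \<open>Cartan's formula \<open>\<iota>\<^sub>x d = \<theta>\<^sub>x - d \<iota>\<^sub>x\<close> taken as the definition of \<open>d\<close>, in all degrees at once.\<close>

fun cartan_differential :: "'g set \<Rightarrow> ('g \<Rightarrow> 'g \<Rightarrow> 'g) \<Rightarrow> ('g \<Rightarrow> 'm \<Rightarrow> 'm) \<Rightarrow> ('g list \<Rightarrow> 'm) \<Rightarrow> 'g list \<Rightarrow> 'm::ab_group_add" where
  "cartan_differential g bracket act \<omega> [] = 0"
| "cartan_differential g bracket act \<omega> (x # xs) =
     (if x \<in> g then lie_derivative g bracket act x \<omega> xs - cartan_differential g bracket act (contract x \<omega>) xs else 0)"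

lemma tuples_0 [simp]: "xs \<in> tuples g 0 \<longleftrightarrow> xs = []"
  by (auto simp: tuples_def)

lemma Nil_tuples_Suc [simp]: "[] \<notin> tuples g (Suc k)"
  by (auto simp: tuples_def)

lemma Cons_tuples_Suc [simp]: "x # xs \<in> tuples g (Suc k) \<longleftrightarrow> x \<in> g \<and> xs \<in> tuples g k"
  by (auto simp: tuples_def)

lemma omit_0_Cons [simp]: "omit 0 (x # xs) = xs"
  and omit_Suc_Cons [simp]: "omit (Suc i) (x # xs) = x # omit i xs"
  by (auto simp: omit_def)

lemma cochainD:
  assumes "\<omega> \<in> cochains scale g scaleM k"
  shows "xs \<notin> tuples g k \<Longrightarrow> \<omega> xs = 0"
    and "\<lbrakk>xs \<in> tuples g k; i < k; x \<in> g; y \<in> g\<rbrakk> \<Longrightarrow> \<omega> (xs[i := x + y]) = \<omega> (xs[i := x]) + \<omega> (xs[i := y])"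
    and "\<lbrakk>xs \<in> tuples g k; i < k; x \<in> g\<rbrakk> \<Longrightarrow> \<omega> (xs[i := scale c x]) = scaleM c (\<omega> (xs[i := x]))"
    and "\<lbrakk>xs \<in> tuples g k; j < k; i < j; xs ! i = xs ! j\<rbrakk> \<Longrightarrow> \<omega> xs = 0"
  using assms unfolding cochains_def by blast+

lemma cochainI:
  assumes "\<And>xs. xs \<notin> tuples g k \<Longrightarrow> \<omega> xs = 0"
    and "\<And>xs i x y. \<lbrakk>xs \<in> tuples g k; i < k; x \<in> g; y \<in> g\<rbrakk> \<Longrightarrow> \<omega> (xs[i := x + y]) = \<omega> (xs[i := x]) + \<omega> (xs[i := y])"
    and "\<And>xs i c x. \<lbrakk>xs \<in> tuples g k; i < k; x \<in> g\<rbrakk> \<Longrightarrow> \<omega> (xs[i := scale c x]) = scaleM c (\<omega> (xs[i := x]))"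
    and "\<And>xs i j. \<lbrakk>xs \<in> tuples g k; j < k; i < j; xs ! i = xs ! j\<rbrakk> \<Longrightarrow> \<omega> xs = 0"
  shows "\<omega> \<in> cochains scale g scaleM k"
  using assms unfolding cochains_def by blast

lemma cochains_0_iff: "\<omega> \<in> cochains scale g scaleM 0 \<longleftrightarrow> (\<forall>x xs. \<omega> (x # xs) = 0)"
  by (auto simp: cochains_def) (metis neq_Nil_conv)

text \<open>The bracket does not enter the notion of a cochain, so \<open>\<rho>\<close> need only
  be linear on \<open>g\<close>. This serves \<open>evaluate\<close>, with \<open>\<rho>\<close> the
  inclusion, and also the lift in \<open>evaluate_surj\<close>, with \<open>\<rho>\<close> the
  projection to \<open>lie_plus\<close>.\<close>

lemma cochains_compose:
  assumes c: "c \<in> cochains scale' g' scaleM' k"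
    and \<rho>: "\<And>x. x \<in> g \<Longrightarrow> \<rho> x \<in> g'" "\<And>x y. x \<in> g \<Longrightarrow> y \<in> g \<Longrightarrow> \<rho> (x + y) = \<rho> x + \<rho> y"
      "\<And>a x. x \<in> g \<Longrightarrow> \<rho> (scale a x) = scale' a (\<rho> x)"
    and g: "\<And>x y. x \<in> g \<Longrightarrow> y \<in> g \<Longrightarrow> x + y \<in> g" "\<And>a x. x \<in> g \<Longrightarrow> scale a x \<in> g"
    and F: "\<And>u v. F (u + v) = F u + F v" "\<And>a u. F (scaleM' a u) = scaleM a (F u)" "F 0 = 0"
  shows "(\<lambda>xs. if set xs \<subseteq> g then F (c (map \<rho> xs)) else 0) \<in> cochains scale g scaleM k"
proof (rule cochainI)
  have t: "map \<rho> xs \<in> tuples g' k" if "xs \<in> tuples g k" for xs using that \<rho>(1) by (auto simp: tuples_def)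
  have s: "set (xs[i := x]) \<subseteq> g" if "xs \<in> tuples g k" "x \<in> g" for xs i x
    using that set_update_subset_insert[of xs i x] by (auto simp: tuples_def)
  show "(if set xs \<subseteq> g then F (c (map \<rho> xs)) else 0) = 0" if "xs \<notin> tuples g k" for xs
  proof (cases "set xs \<subseteq> g")
    case True
    with that have "map \<rho> xs \<notin> tuples g' k" by (auto simp: tuples_def)
    then show ?thesis by (simp add: cochainD(1)[OF c] F)
  qed simp
  fix xs i assume xs: "xs \<in> tuples g k"
  show "(if set xs \<subseteq> g then F (c (map \<rho> xs)) else 0) = 0" if "j < k" "i < j" "xs ! i = xs ! j" for j
  proof -
    have "c (map \<rho> xs) = 0"
      by (rule cochainD(4)[OF c t[OF xs] that(1,2)]) (use that xs in \<open>auto simp: tuples_def\<close>)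
    then show ?thesis by (simp add: F)
  qed
  assume i: "i < k"
  fix x assume x: "x \<in> g"
  show "(if set (xs[i := x + y]) \<subseteq> g then F (c (map \<rho> (xs[i := x + y]))) else 0) =
        (if set (xs[i := x]) \<subseteq> g then F (c (map \<rho> (xs[i := x]))) else 0) +
        (if set (xs[i := y]) \<subseteq> g then F (c (map \<rho> (xs[i := y]))) else 0)" if y: "y \<in> g" for y
    using xs x y i by (simp add: s g map_update \<rho> cochainD(2)[OF c t[OF xs]] F)
  show "(if set (xs[i := scale a x]) \<subseteq> g then F (c (map \<rho> (xs[i := scale a x]))) else 0) =
        scaleM a (if set (xs[i := x]) \<subseteq> g then F (c (map \<rho> (xs[i := x]))) else 0)" for a
    using xs x i by (simp add: s g map_update \<rho> cochainD(3)[OF c t[OF xs]] F)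
qed

section \<open>Cartan calculus: contraction, Lie derivative, differential\<close>

context lie_module
begin

abbreviation "C \<equiv> cochains scale g scaleM"
abbreviation "\<theta> \<equiv> lie_derivative g bracket act"
abbreviation "\<d> \<equiv> cartan_differential g bracket act"

lemma g_closed: "x \<in> g \<Longrightarrow> y \<in> g \<Longrightarrow> x + y \<in> g" "x \<in> g \<Longrightarrow> scale c x \<in> g" "0 \<in> g"
  using subspace_carrier by (auto simp: subspace_def)

lemma act_M:
  assumes "x \<in> g"
  shows "act x (m + m') = act x m + act x m'" "act x (scaleM c m) = scaleM c (act x m)" "act x 0 = 0"
    "act x (m - m') = act x m - act x m'" "act x (- m) = - act x m"
proof -
  interpret Vector_Spaces.linear scaleM scaleM "act x" by (rule act_linear[OF assms])
  show "act x (m + m') = act x m + act x m'" "act x (scaleM c m) = scaleM c (act x m)" "act x 0 = 0"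
    "act x (m - m') = act x m - act x m'" "act x (- m) = - act x m"
    by (rule add scale zero diff neg)+
qed

lemma cochains_zero: "(\<lambda>xs. 0) \<in> C k"
  by (auto simp: cochains_def)

lemma cochains_add:
  assumes "\<omega> \<in> C k" "\<eta> \<in> C k"
  shows "(\<lambda>xs. \<omega> xs + \<eta> xs) \<in> C k"
proof (rule cochainI)
  fix xs i j assume "xs \<in> tuples g k" "j < k" "i < j" "xs ! i = xs ! j"
  then show "\<omega> xs + \<eta> xs = 0" using assms[THEN cochainD(4)] by simp
qed (simp_all add: assms[THEN cochainD(1)] assms[THEN cochainD(2)] assms[THEN cochainD(3)] M.scale_right_distrib)

lemma cochains_scale:
  assumes "\<omega> \<in> C k"
  shows "(\<lambda>xs. scaleM c (\<omega> xs)) \<in> C k"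
proof (rule cochainI)
  fix xs i j assume "xs \<in> tuples g k" "j < k" "i < j" "xs ! i = xs ! j"
  then show "scaleM c (\<omega> xs) = 0" using assms[THEN cochainD(4)] by simp
qed (simp_all add: assms[THEN cochainD(1)] assms[THEN cochainD(2)] assms[THEN cochainD(3)] M.scale_right_distrib
    mult.commute)

lemma cochains_diff: "\<omega> \<in> C k \<Longrightarrow> \<eta> \<in> C k \<Longrightarrow> (\<lambda>xs. \<omega> xs - \<eta> xs) \<in> C k"
  using cochains_add[of \<omega> k "\<lambda>xs. scaleM (-1) (\<eta> xs)"] cochains_scale[of \<eta> k "-1"] by simp

text \<open>Contraction changes the degree, so inductions over argument lists are run for cochains
  of unspecified degree.\<close>

definition cochain where
  "cochain \<omega> \<longleftrightarrow> (\<exists>k. \<omega> \<in> C k)"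

lemma cochain_of: "\<omega> \<in> C k \<Longrightarrow> cochain \<omega>"
  by (auto simp: cochain_def)

lemma contract_C0: "\<omega> \<in> C 0 \<Longrightarrow> contract x \<omega> = (\<lambda>xs. 0)"
  by (auto simp: cochains_0_iff)

lemma contract_in_cochains:
  assumes \<omega>: "\<omega> \<in> C (Suc k)" and x: "x \<in> g"
  shows "contract x \<omega> \<in> C k"
proof (intro cochainI)
  fix xs i y z assume "xs \<in> tuples g k" "i < k" "y \<in> g" "z \<in> g"
  then show "contract x \<omega> (xs[i := y + z]) = contract x \<omega> (xs[i := y]) + contract x \<omega> (xs[i := z])"
    using cochainD(2)[OF \<omega>, of "x # xs" "Suc i" y z] x by simp
next
  fix xs i c y assume "xs \<in> tuples g k" "i < k" "y \<in> g"
  then show "contract x \<omega> (xs[i := scale c y]) = scaleM c (contract x \<omega> (xs[i := y]))"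
    using cochainD(3)[OF \<omega>, of "x # xs" "Suc i" y c] x by simp
next
  fix xs i j assume "xs \<in> tuples g k" "j < k" "i < j" "xs ! i = xs ! j"
  then show "contract x \<omega> xs = 0"
    using cochainD(4)[OF \<omega>, of "x # xs" "Suc j" "Suc i"] x by simp
qed (auto simp: cochainD(1)[OF \<omega>])

lemma cochain_contract:
  assumes "cochain \<omega>" "x \<in> g"
  shows "cochain (contract x \<omega>)"
proof -
  obtain k where k: "\<omega> \<in> C k" using assms by (auto simp: cochain_def)
  show ?thesis
  proof (cases k)
    case 0
    with k show ?thesis using cochain_of[OF cochains_zero] by (simp add: contract_C0)
  next
    case (Suc k')
    with k have "\<omega> \<in> C (Suc k')" by simp
    from contract_in_cochains[OF this assms(2)] show ?thesis by (rule cochain_of)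
  qed
qed

text \<open>Treating the first argument is enough: a later one becomes the first after contraction
  with those before it.\<close>

lemma cochain_Cons:
  assumes "cochain \<omega>"
  shows cochain_outside: "x \<notin> g \<Longrightarrow> \<omega> (x # xs) = 0"
    and cochain_Cons_add: "x \<in> g \<Longrightarrow> y \<in> g \<Longrightarrow> \<omega> ((x + y) # xs) = \<omega> (x # xs) + \<omega> (y # xs)"
    and cochain_Cons_scale: "x \<in> g \<Longrightarrow> \<omega> (scale c x # xs) = scaleM c (\<omega> (x # xs))"
    and cochain_alt: "\<omega> (x # x # xs) = 0"
proof -
  obtain k where \<omega>: "\<omega> \<in> C k" using assms by (auto simp: cochain_def)
  show "\<omega> (x # xs) = 0" if "x \<notin> g"
    by (rule cochainD(1)[OF \<omega>]) (use that in \<open>auto simp: tuples_def\<close>)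
  show "\<omega> ((x + y) # xs) = \<omega> (x # xs) + \<omega> (y # xs)" if "x \<in> g" "y \<in> g"
  proof (cases "x # xs \<in> tuples g k")
    case True
    then show ?thesis using cochainD(2)[OF \<omega>, of "x # xs" 0 x y] that by (auto simp: tuples_def)
  next
    case False
    with that have "(x + y) # xs \<notin> tuples g k" "y # xs \<notin> tuples g k" by (auto simp: tuples_def)
    with False show ?thesis by (simp add: cochainD(1)[OF \<omega>])
  qed
  show "\<omega> (scale c x # xs) = scaleM c (\<omega> (x # xs))" if "x \<in> g"
  proof (cases "x # xs \<in> tuples g k")
    case True
    then show ?thesis using cochainD(3)[OF \<omega>, of "x # xs" 0 x c] that by (auto simp: tuples_def)
  next
    case False
    with that have "scale c x # xs \<notin> tuples g k" by (auto simp: tuples_def)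
    with False show ?thesis by (simp add: cochainD(1)[OF \<omega>])
  qed
  show "\<omega> (x # x # xs) = 0"
    by (cases "x # x # xs \<in> tuples g k")
      (use cochainD(1)[OF \<omega>] cochainD(4)[OF \<omega>, of "x # x # xs" 1 0] in \<open>auto simp: tuples_def\<close>)
qed

lemma cochain_Cons_zero: "cochain \<omega> \<Longrightarrow> \<omega> (0 # xs) = 0"
  using cochain_Cons_scale[of \<omega> 0 0 xs] g_closed by simp

lemma cochain_Cons_neg: "cochain \<omega> \<Longrightarrow> x \<in> g \<Longrightarrow> \<omega> ((- x) # xs) = - \<omega> (x # xs)"
  using cochain_Cons_scale[of \<omega> x "-1" xs] by simp

lemma cochain_swap:
  assumes \<omega>: "cochain \<omega>"
  shows "\<omega> (x # y # xs) = - \<omega> (y # x # xs)"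
proof (cases "x \<in> g \<and> y \<in> g")
  case True
  then have eq: "\<omega> ((x + y) # (x + y) # xs) = (\<omega> (x # x # xs) + \<omega> (x # y # xs)) + (\<omega> (y # x # xs) + \<omega> (y # y # xs))"
    using cochain_Cons_add[OF \<omega>, of x y] cochain_Cons_add[OF cochain_contract[OF \<omega>], of x x y]
      cochain_Cons_add[OF cochain_contract[OF \<omega>], of y x y] by (simp add: g_closed)
  have "\<omega> (x # y # xs) + \<omega> (y # x # xs) = 0" using trans[OF eq[symmetric] cochain_alt[OF \<omega>]] by (simp add: cochain_alt[OF \<omega>])
  then show ?thesis by (simp add: eq_neg_iff_add_eq_0)
next
  case False
  have "\<omega> (u # v # xs) = 0" if "u \<notin> g \<or> v \<notin> g" for u v
    using that cochain_outside[OF \<omega>] cochain_outside[OF cochain_contract[OF \<omega>], of u v xs] by (cases "u \<in> g") auto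
  with False show ?thesis by auto
qed

text \<open>Conditions on later arguments are inherited from the contractions, and general
  alternation follows from the case of the first two arguments by polarisation.\<close>

lemma cochain_SucI:
  assumes 0: "\<omega> [] = 0" and out: "\<And>x xs. x \<notin> g \<Longrightarrow> \<omega> (x # xs) = 0"
    and con: "\<And>x. x \<in> g \<Longrightarrow> contract x \<omega> \<in> C k"
    and add: "\<And>x y xs. \<lbrakk>x \<in> g; y \<in> g; xs \<in> tuples g k\<rbrakk> \<Longrightarrow> \<omega> ((x + y) # xs) = \<omega> (x # xs) + \<omega> (y # xs)"
    and scl: "\<And>c x xs. \<lbrakk>x \<in> g; xs \<in> tuples g k\<rbrakk> \<Longrightarrow> \<omega> (scale c x # xs) = scaleM c (\<omega> (x # xs))"
    and alt: "\<And>x xs. \<lbrakk>x \<in> g; x # xs \<in> tuples g k\<rbrakk> \<Longrightarrow> \<omega> (x # x # xs) = 0"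
  shows "\<omega> \<in> C (Suc k)"
proof (intro cochainI)
  fix xs assume "xs \<notin> tuples g (Suc k)"
  then show "\<omega> xs = 0"
  proof (cases xs)
    case (Cons x ys)
    with \<open>xs \<notin> tuples g (Suc k)\<close> show ?thesis
      using out[of x ys] cochainD(1)[OF con, of x ys] by (cases "x \<in> g") auto
  qed (simp add: 0)
next
  fix xs i x y assume "xs \<in> tuples g (Suc k)" "i < Suc k" "x \<in> g" "y \<in> g"
  then show "\<omega> (xs[i := x + y]) = \<omega> (xs[i := x]) + \<omega> (xs[i := y])"
    using add cochainD(2)[OF con] by (cases xs; cases i) auto
next
  fix xs i c x assume "xs \<in> tuples g (Suc k)" "i < Suc k" "x \<in> g"
  then show "\<omega> (xs[i := scale c x]) = scaleM c (\<omega> (xs[i := x]))"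
    using scl cochainD(3)[OF con] by (cases xs; cases i) auto
next
  fix xs i j assume xs: "xs \<in> tuples g (Suc k)" and ij: "j < Suc k" "i < j" "xs ! i = xs ! j"
  obtain x ys where x: "xs = x # ys" "x \<in> g" "ys \<in> tuples g k" using xs by (cases xs) auto
  show "\<omega> xs = 0"
  proof (cases i)
    case (Suc i')
    then show ?thesis
      using cochainD(4)[OF con[OF x(2)] x(3), of "j - 1" i'] ij x by (cases j) auto
  next
    case 0
    obtain y zs where y: "ys = y # zs" using x ij by (cases ys) (auto simp: tuples_def)
    obtain k' where k': "k = Suc k'" using x y by (cases k) auto
    have yg: "y \<in> g" and zs: "zs \<in> tuples g k'" using x y k' by auto
    show ?thesis
    proof (cases "j = 1")
      case True
      then show ?thesis using 0 ij x y alt by auto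
    next
      case False
      then obtain j' where j: "j = Suc (Suc j')" using ij by (metis One_nat_def less_nat_zero_code not0_implies_Suc)
      have c: "cochain (contract u \<omega>)" if "u \<in> g" for u using con[OF that] by (rule cochain_of)
      have xy: "x + y \<in> g" using x yg by (simp add: g_closed)
      \<comment> \<open>Here \<open>x\<close> occurs first and again inside \<open>zs\<close>.
        Polarising the vanishing on equal neighbours exchanges \<open>x\<close> and \<open>y\<close>
        up to sign; with \<open>y\<close> in front the value is zero because the contraction with
        \<open>y\<close> alternates.\<close>
      have "\<omega> ((x + y) # (x + y) # zs) = 0" using alt[OF xy] xy zs k' by simp
      moreover have "\<omega> ((x + y) # (x + y) # zs) = \<omega> (x # x # zs) + \<omega> (x # y # zs) + (\<omega> (y # x # zs) + \<omega> (y # y # zs))"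
        using add[of x y "(x + y) # zs"] cochain_Cons_add[OF c[OF x(2)] x(2) yg]
          cochain_Cons_add[OF c[OF yg] x(2) yg] x(2) yg xy zs k' by simp
      moreover have "\<omega> (x # x # zs) = 0" "\<omega> (y # y # zs) = 0" using alt x(2) yg zs k' by auto
      moreover have "\<omega> (y # x # zs) = 0"
        using cochainD(4)[OF con[OF yg], of "x # zs" "Suc j'" 0] ij x y zs j k' 0 by simp
      ultimately show ?thesis using x y by simp
    qed
  qed
qed

lemma contract_add: "cochain \<omega> \<Longrightarrow> x \<in> g \<Longrightarrow> y \<in> g \<Longrightarrow> contract (x + y) \<omega> = (\<lambda>xs. contract x \<omega> xs + contract y \<omega> xs)"
  by (auto simp: cochain_Cons_add)

lemma contract_scale: "cochain \<omega> \<Longrightarrow> x \<in> g \<Longrightarrow> contract (scale c x) \<omega> = (\<lambda>xs. scaleM c (contract x \<omega> xs))"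
  by (auto simp: cochain_Cons_scale)

lemma lie_derivative_add: "x \<in> g \<Longrightarrow> \<theta> x (\<lambda>xs. \<omega> xs + \<eta> xs) ys = \<theta> x \<omega> ys + \<theta> x \<eta> ys"
  by (induction ys arbitrary: \<omega> \<eta>) (auto simp: act_M contract_def)

lemma lie_derivative_diff: "x \<in> g \<Longrightarrow> \<theta> x (\<lambda>xs. \<omega> xs - \<eta> xs) ys = \<theta> x \<omega> ys - \<theta> x \<eta> ys"
  by (induction ys arbitrary: \<omega> \<eta>) (auto simp: act_M contract_def)

lemma lie_derivative_scale: "x \<in> g \<Longrightarrow> \<theta> x (\<lambda>xs. scaleM c (\<omega> xs)) ys = scaleM c (\<theta> x \<omega> ys)"
  by (induction ys arbitrary: \<omega>) (auto simp: act_M contract_def M.scale_right_diff_distrib)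

lemma lie_derivative_zero: "x \<in> g \<Longrightarrow> \<theta> x (\<lambda>xs. 0) = (\<lambda>xs. 0)"
  using lie_derivative_diff[of x "\<lambda>xs. 0" "\<lambda>xs. 0"] by auto

lemma cartan_differential_add: "\<d> (\<lambda>xs. \<omega> xs + \<eta> xs) ys = \<d> \<omega> ys + \<d> \<eta> ys"
  by (induction ys arbitrary: \<omega> \<eta>) (auto simp: lie_derivative_add contract_def)

lemma cartan_differential_diff: "\<d> (\<lambda>xs. \<omega> xs - \<eta> xs) ys = \<d> \<omega> ys - \<d> \<eta> ys"
  by (induction ys arbitrary: \<omega> \<eta>) (auto simp: lie_derivative_diff contract_def)

lemma cartan_differential_scale: "\<d> (\<lambda>xs. scaleM c (\<omega> xs)) ys = scaleM c (\<d> \<omega> ys)"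
  by (induction ys arbitrary: \<omega>) (auto simp: lie_derivative_scale contract_def M.scale_right_diff_distrib)

lemma cartan_differential_zero: "\<d> (\<lambda>xs. 0) = (\<lambda>xs. 0)"
  using cartan_differential_diff[of "\<lambda>xs. 0" "\<lambda>xs. 0"] by auto

lemma contract_lie_derivative:
  "y \<in> g \<Longrightarrow> contract y (\<theta> x \<omega>) = (\<lambda>xs. \<theta> x (contract y \<omega>) xs - contract (bracket x y) \<omega> xs)"
  by auto

lemma contract_cartan_differential:
  "x \<in> g \<Longrightarrow> contract x (\<d> \<omega>) = (\<lambda>xs. \<theta> x \<omega> xs - \<d> (contract x \<omega>) xs)"
  by auto

lemma lie_derivative_add_left:
  "\<lbrakk>cochain \<omega>; x \<in> g; y \<in> g\<rbrakk> \<Longrightarrow> \<theta> (x + y) \<omega> ys = \<theta> x \<omega> ys + \<theta> y \<omega> ys"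
  by (induction ys arbitrary: \<omega>)
    (auto simp: act_add cochain_contract bracket_add_left cochain_Cons_add bracket_closed)

lemma lie_derivative_scale_left:
  "\<lbrakk>cochain \<omega>; x \<in> g\<rbrakk> \<Longrightarrow> \<theta> (scale c x) \<omega> ys = scaleM c (\<theta> x \<omega> ys)"
  by (induction ys arbitrary: \<omega>)
    (auto simp: act_scale cochain_contract bracket_scale_left cochain_Cons_scale bracket_closed M.scale_right_diff_distrib)

lemma lie_derivative_in_cochains: "\<omega> \<in> C k \<Longrightarrow> x \<in> g \<Longrightarrow> \<theta> x \<omega> \<in> C k"
proof (induction k arbitrary: \<omega>)
  case 0
  then show ?case by (auto simp: cochains_0_iff contract_C0 lie_derivative_zero fun_eq_iff)
next
  case (Suc k)
  have c: "cochain \<omega>" using Suc.prems(1) by (rule cochain_of)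
  note x = \<open>x \<in> g\<close>
  show ?case
  proof (rule cochain_SucI)
    show "\<theta> x \<omega> [] = 0" using cochainD(1)[OF Suc.prems(1), of "[]"] x by (simp add: act_M)
  next
    fix y assume y: "y \<in> g"
    show "contract y (\<theta> x \<omega>) \<in> C k"
      unfolding contract_lie_derivative[OF y]
      by (intro cochains_diff Suc contract_in_cochains bracket_closed x y)
  next
    fix y z xs assume y: "y \<in> g" and z: "z \<in> g"
    then show "\<theta> x \<omega> ((y + z) # xs) = \<theta> x \<omega> (y # xs) + \<theta> x \<omega> (z # xs)"
      using x by (simp add: g_closed contract_add[OF c] lie_derivative_add bracket_add_right
          cochain_Cons_add[OF c] bracket_closed del: contract_apply)
  next
    fix a y xs assume y: "y \<in> g"
    then show "\<theta> x \<omega> (scale a y # xs) = scaleM a (\<theta> x \<omega> (y # xs))"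
      using x by (simp add: g_closed contract_scale[OF c] lie_derivative_scale bracket_scale_right
          cochain_Cons_scale[OF c] bracket_closed M.scale_right_diff_distrib del: contract_apply)
  next
    fix y xs assume y: "y \<in> g"
    have "contract y (contract y \<omega>) = (\<lambda>xs. 0)" by (auto simp: cochain_alt[OF c])
    then show "\<theta> x \<omega> (y # y # xs) = 0"
      using x y cochain_swap[OF c, of y "bracket x y" xs] by (simp add: lie_derivative_zero)
  qed auto
qed

text \<open>On the empty list this is the module axiom; for each further argument the doubly
  bracketed terms match by the Jacobi identity.\<close>

lemma lie_derivative_bracket:
  "\<lbrakk>cochain \<omega>; x \<in> g; y \<in> g\<rbrakk> \<Longrightarrow> \<theta> (bracket x y) \<omega> zs = \<theta> x (\<theta> y \<omega>) zs - \<theta> y (\<theta> x \<omega>) zs"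
proof (induction zs arbitrary: \<omega>)
  case Nil
  then show ?case by (simp add: act_bracket)
next
  case (Cons z zs)
  show ?case
  proof (cases "z \<in> g")
    case z: True
    note [simp] = Cons.prems(2,3) z bracket_closed
    have "bracket z (bracket x y) = - bracket (bracket x y) z"
      "bracket y (bracket z x) = - bracket y (bracket x z)"
    proof -
      have anti: "bracket u v = - bracket v u" if uv: "u \<in> g" "v \<in> g" for u v
      proof -
        have "bracket (u + v) (u + v) = bracket u u + bracket u v + (bracket v u + bracket v v)"
          using uv by (simp add: bracket_add_left bracket_add_right g_closed ac_simps)
        from trans[OF this[symmetric] bracket_self] uv show ?thesis by (simp add: g_closed bracket_self eq_neg_iff_add_eq_0)
      qed
      show "bracket z (bracket x y) = - bracket (bracket x y) z" by (rule anti) simp_all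
      have "bracket y (bracket z x) = bracket y (scale (-1) (bracket x z))" using anti[of z x] by simp
      also have "\<dots> = - bracket y (bracket x z)" by (subst bracket_scale_right) simp_all
      finally show "bracket y (bracket z x) = - bracket y (bracket x z)" .
    qed
    then have "bracket x (bracket y z) = bracket (bracket x y) z + bracket y (bracket x z)"
      using jacobi[of x y z] by (simp add: algebra_simps)
    then have J: "\<omega> (bracket x (bracket y z) # zs) = \<omega> (bracket (bracket x y) z # zs) + \<omega> (bracket y (bracket x z) # zs)"
      by (simp add: cochain_Cons_add[OF Cons.prems(1)])
    show ?thesis
      using Cons.IH[OF cochain_contract[OF Cons.prems(1) z]]
      by (simp add: contract_lie_derivative lie_derivative_diff J del: contract_apply)
  qed simp
qed

text \<open>After contraction with the first argument \<open>y\<close>, the induction hypothesis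
  covers the part on \<open>contract y \<omega>\<close>. What remains is the commutator of
  \<open>\<theta> x\<close> and \<open>\<theta> y\<close> against
  \<open>\<theta> (bracket x y)\<close>.\<close>

lemma lie_derivative_cartan_differential:
  "\<lbrakk>cochain \<omega>; x \<in> g\<rbrakk> \<Longrightarrow> \<theta> x (\<d> \<omega>) ys = \<d> (\<theta> x \<omega>) ys"
proof (induction ys arbitrary: \<omega>)
  case Nil
  then show ?case by (simp add: act_M)
next
  case (Cons y ys)
  show ?case
  proof (cases "y \<in> g")
    case y: True
    note [simp] = Cons.prems(2) y bracket_closed
    show ?thesis
      using Cons.IH[OF cochain_contract[OF Cons.prems(1) y]] lie_derivative_bracket[OF Cons.prems(1), of x y ys]
      by (simp add: contract_lie_derivative contract_cartan_differential lie_derivative_diff cartan_differential_diff del: contract_apply)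
  qed simp
qed

lemma cartan_differential_in_cochains: "\<omega> \<in> C k \<Longrightarrow> \<d> \<omega> \<in> C (Suc k)"
proof (induction k arbitrary: \<omega>)
  case (0 \<omega>)
  note \<omega> = "0"
  have c: "cochain \<omega>" using \<omega> by (rule cochain_of)
  show ?case
  proof (rule cochain_SucI)
    fix x assume "x \<in> g"
    then show "contract x (\<d> \<omega>) \<in> C 0"
      using lie_derivative_in_cochains[OF \<omega>, of x] contract_cartan_differential[of x \<omega>]
      by (simp add: contract_C0[OF \<omega>] cartan_differential_zero)
  qed (auto simp: contract_C0[OF \<omega>] cartan_differential_zero act_add act_scale g_closed)
next
  case (Suc k)
  note \<omega> = Suc.prems
  have c: "cochain \<omega>" using \<omega> by (rule cochain_of)
  show ?case
  proof (rule cochain_SucI)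
    fix x assume x: "x \<in> g"
    show "contract x (\<d> \<omega>) \<in> C (Suc k)"
      unfolding contract_cartan_differential[OF x]
      by (intro cochains_diff Suc contract_in_cochains lie_derivative_in_cochains x)
  next
    fix x y xs assume "x \<in> g" "y \<in> g"
    then show "\<d> \<omega> ((x + y) # xs) = \<d> \<omega> (x # xs) + \<d> \<omega> (y # xs)"
      by (simp add: g_closed contract_add[OF c] lie_derivative_add_left[OF c] cartan_differential_add del: contract_apply)
  next
    fix a x xs assume "x \<in> g"
    then show "\<d> \<omega> (scale a x # xs) = scaleM a (\<d> \<omega> (x # xs))"
      by (simp add: g_closed contract_scale[OF c] lie_derivative_scale_left[OF c] cartan_differential_scale
          M.scale_right_diff_distrib del: contract_apply)
  next
    fix x xs assume x: "x \<in> g"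
    have "contract x (contract x \<omega>) = (\<lambda>xs. 0)" by (auto simp: cochain_alt[OF c])
    then show "\<d> \<omega> (x # x # xs) = 0"
      using x by (simp add: cartan_differential_zero bracket_self cochain_Cons_zero[OF c])
  qed auto
qed

lemma cochain_cartan_differential: "cochain \<omega> \<Longrightarrow> cochain (\<d> \<omega>)"
  unfolding cochain_def using cartan_differential_in_cochains by blast

text \<open>Cartan's formula, applied twice, turns the contraction of the square with
  \<open>y\<close> into the commutator of \<open>\<theta> y\<close> with \<open>\<d>\<close>, which
  is zero, plus the square on the contracted cochain.\<close>

lemma cartan_differential_squared: "cochain \<omega> \<Longrightarrow> \<d> (\<d> \<omega>) ys = 0"
proof (induction ys arbitrary: \<omega>)
  case (Cons y ys)
  show ?case
  proof (cases "y \<in> g")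
    case y: True
    then have "\<d> (\<d> \<omega>) (y # ys) = \<theta> y (\<d> \<omega>) ys - (\<d> (\<theta> y \<omega>) ys - \<d> (\<d> (contract y \<omega>)) ys)"
      by (simp only: cartan_differential.simps if_True contract_cartan_differential cartan_differential_diff)
    then show ?thesis
      by (simp only: Cons.IH[OF cochain_contract[OF Cons.prems y]] lie_derivative_cartan_differential[OF Cons.prems y]) simp
  qed simp
qed simp

section \<open>Agreement with the alternating sum formula\<close>

lemma lie_derivative_eq_sum:
  "\<lbrakk>cochain \<omega>; x \<in> g; ys \<in> tuples g k\<rbrakk> \<Longrightarrow>
    \<theta> x \<omega> ys = act x (\<omega> ys) - (\<Sum>j<k. scaleM ((-1) ^ j) (\<omega> (bracket x (ys ! j) # omit j ys)))"
proof (induction ys arbitrary: \<omega> k)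
  case Nil
  then show ?case by (auto simp: tuples_def)
next
  case (Cons y ys)
  obtain k' where k: "k = Suc k'" using Cons.prems by (cases k) auto
  have y: "y \<in> g" and ys: "ys \<in> tuples g k'" using Cons.prems k by auto
  show ?case
    using Cons.IH[OF cochain_contract[OF Cons.prems(1) y] Cons.prems(2) ys] y
    \<comment> \<open>The induction hypothesis has \<open>y\<close> in front of the bracket;
      exchanging the two gives the sign required by the index shift.\<close>
    by (simp add: k contract_def sum.lessThan_Suc_shift cochain_swap[OF Cons.prems(1), of y] sum_negf del: sum.lessThan_Suc)
qed

lemma cartan_differential_eq_sum:
  "\<lbrakk>cochain \<omega>; xs \<in> tuples g n\<rbrakk> \<Longrightarrow> \<d> \<omega> xs =
    (\<Sum>i<n. scaleM ((-1) ^ i) (act (xs ! i) (\<omega> (omit i xs)))) +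
    (\<Sum>j<n. \<Sum>i<j. scaleM ((-1) ^ (i + j)) (\<omega> (bracket (xs ! i) (xs ! j) # omit i (omit j xs))))"
proof (induction xs arbitrary: \<omega> n)
  case Nil
  then show ?case by (auto simp: tuples_def)
next
  case (Cons x xs)
  obtain k where n: "n = Suc k" using Cons.prems by (cases n) auto
  have x: "x \<in> g" and xs: "xs \<in> tuples g k" using Cons.prems n by auto
  show ?case
    by (simp only: n cartan_differential.simps x if_True lie_derivative_eq_sum[OF Cons.prems(1) x xs]
        Cons.IH[OF cochain_contract[OF Cons.prems(1) x] xs])
      (simp add: sum.lessThan_Suc_shift cochain_swap[OF Cons.prems(1), of x] sum_negf sum.distrib sum_subtractf algebra_simps del: sum.lessThan_Suc)
qed

lemma ce_differential_eq_cartan_differential: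
  assumes \<omega>: "\<omega> \<in> C k"
  shows "ce_differential g bracket scaleM act k \<omega> = \<d> \<omega>"
proof
  fix xs
  show "ce_differential g bracket scaleM act k \<omega> xs = \<d> \<omega> xs"
    using cartan_differential_eq_sum[OF cochain_of[OF \<omega>], of xs "Suc k"]
      cochainD(1)[OF cartan_differential_in_cochains[OF \<omega>], of xs]
    unfolding ce_differential_def lessThan_Suc_atMost by auto
qed

section \<open>Operations on cochains; cocycles and coboundaries as subspaces\<close>

lemma cochains_postcompose:
  assumes \<omega>: "\<omega> \<in> C k" and F: "Vector_Spaces.linear scaleM scaleM F"
  shows "(\<lambda>xs. F (\<omega> xs)) \<in> C k"
proof -
  interpret F: Vector_Spaces.linear scaleM scaleM F by (rule F)
  show ?thesis
  proof (rule cochainI)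
    fix xs i j assume "xs \<in> tuples g k" "j < k" "i < j" "xs ! i = xs ! j"
    then show "F (\<omega> xs) = 0" using cochainD(4)[OF \<omega>] by (simp add: F.zero)
  qed (simp_all add: cochainD(1-3)[OF \<omega>] F.add F.scale F.zero)
qed

lemma cochains_sum: "(\<And>a. a \<in> A \<Longrightarrow> \<omega> a \<in> C k) \<Longrightarrow> (\<lambda>xs. \<Sum>a\<in>A. \<omega> a xs) \<in> C k"
  by (induction A rule: infinite_finite_induct) (auto simp: cochains_zero cochains_add)

text \<open>Meant for a series of cochains whose partial sums stabilise on every list, but at no
  common index. Each cochain axiom involves at most three lists, and for these one index
  works.\<close>

lemma cochains_eventually:
  assumes P: "\<And>M. P M \<in> C k" and ev: "\<And>xs. eventually (\<lambda>M. \<omega> xs = P M xs) sequentially"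
  shows "\<omega> \<in> C k"
proof (rule cochainI)
  fix xs assume "xs \<notin> tuples g k"
  then show "\<omega> xs = 0" using eventually_happens[OF ev[of xs]] cochainD(1)[OF P] by auto
next
  fix xs i x y assume "xs \<in> tuples g k" "i < k" "x \<in> g" "y \<in> g"
  then have "P M (xs[i := x + y]) = P M (xs[i := x]) + P M (xs[i := y])" for M by (rule cochainD(2)[OF P])
  moreover obtain M where "\<omega> (xs[i := x + y]) = P M (xs[i := x + y])" "\<omega> (xs[i := x]) = P M (xs[i := x])"
    "\<omega> (xs[i := y]) = P M (xs[i := y])"
    using eventually_happens[OF eventually_conj[OF ev eventually_conj[OF ev ev]]] by fastforce
  ultimately show "\<omega> (xs[i := x + y]) = \<omega> (xs[i := x]) + \<omega> (xs[i := y])" by simp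
next
  fix xs i c x assume "xs \<in> tuples g k" "i < k" "x \<in> g"
  then have "P M (xs[i := scale c x]) = scaleM c (P M (xs[i := x]))" for M by (rule cochainD(3)[OF P])
  moreover obtain M where "\<omega> (xs[i := scale c x]) = P M (xs[i := scale c x])" "\<omega> (xs[i := x]) = P M (xs[i := x])"
    using eventually_happens[OF eventually_conj[OF ev ev]] by fastforce
  ultimately show "\<omega> (xs[i := scale c x]) = scaleM c (\<omega> (xs[i := x]))" by simp
next
  fix xs i j assume "xs \<in> tuples g k" "j < k" "i < j" "xs ! i = xs ! j"
  then show "\<omega> xs = 0" using eventually_happens[OF ev[of xs]] cochainD(4)[OF P] by auto
qed

lemma cochain_Cons_sum:
  assumes \<omega>: "cochain \<omega>" and x: "\<And>a. a \<in> A \<Longrightarrow> x a \<in> g"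
  shows "\<omega> ((\<Sum>a\<in>A. x a) # xs) = (\<Sum>a\<in>A. \<omega> (x a # xs))"
  using x
proof (induction A rule: infinite_finite_induct)
  case (insert a A)
  then show ?case by (simp add: cochain_Cons_add[OF \<omega>] subspace_sum[OF subspace_carrier])
qed (simp_all add: cochain_Cons_zero[OF \<omega>])

lemma subspace_cochains: "module.subspace (pointwise_scale scaleM) (C k)"
proof -
  interpret P: vector_space "pointwise_scale scaleM :: _ \<Rightarrow> ('g list \<Rightarrow> 'm) \<Rightarrow> _"
    by (rule vector_space_pointwise_scale[OF M.vector_space_axioms])
  show ?thesis
    by (rule P.subspaceI)
      (simp_all add: cochains_zero cochains_add cochains_scale zero_fun_def plus_fun_def pointwise_scale_def)
qed

lemma linear_cartan_differential:
  "Vector_Spaces.linear (pointwise_scale scaleM) (pointwise_scale scaleM) \<d>"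
  by (simp add: Vector_Spaces.linear_iff vector_space_pointwise_scale[OF M.vector_space_axioms] fun_eq_iff
      plus_fun_def pointwise_scale_def cartan_differential_add cartan_differential_scale)

lemma cocycles_iff: "\<omega> \<in> cocycles scale g bracket scaleM act k \<longleftrightarrow> \<omega> \<in> C k \<and> \<d> \<omega> = 0"
  by (auto simp: cocycles_def ce_differential_eq_cartan_differential)

lemma coboundaries_Suc: "coboundaries scale g bracket scaleM act (Suc k) = \<d> ` C k"
  by (auto simp: ce_differential_eq_cartan_differential image_iff)

lemma subspace_cocycles: "module.subspace (pointwise_scale scaleM) (cocycles scale g bracket scaleM act k)"
proof -
  interpret D: Vector_Spaces.linear "pointwise_scale scaleM" "pointwise_scale scaleM" \<d>
    by (rule linear_cartan_differential)
  have "cocycles scale g bracket scaleM act k = C k \<inter> {\<omega>. \<d> \<omega> = 0}" by (auto simp: cocycles_iff)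
  then show ?thesis by (simp only: D.vs1.subspace_inter subspace_cochains D.subspace_kernel)
qed

lemma subspace_coboundaries: "module.subspace (pointwise_scale scaleM) (coboundaries scale g bracket scaleM act k)"
proof -
  interpret D: Vector_Spaces.linear "pointwise_scale scaleM" "pointwise_scale scaleM" \<d>
    by (rule linear_cartan_differential)
  show ?thesis
    by (cases k) (simp_all only: coboundaries_Suc coboundaries.simps(1) D.vs1.subspace_single_0
      D.subspace_image[OF subspace_cochains])
qed

end

section \<open>The tensor module\<close>

definition translation :: "'n \<Rightarrow> ('n, 'k::field) vfield" where
  "translation i = vf 1 i"

lemma translation_in_derivations: "translation i \<in> derivations"
  by (simp add: translation_def vf_in_derivations)

lemma translation_apply: "translation i p = partial i p"
  by (simp add: translation_def vf_def)

lemma multi_partial_add: "multi_partial k (p + q) = multi_partial k p + multi_partial k q"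
  by (simp add: poly_mapping_eq_iff fun_eq_iff lookup_multi_partial lookup_add algebra_simps)

lemma multi_partial_scale: "multi_partial k (poly_scale c p) = poly_scale c (multi_partial k p)"
  by (simp add: poly_mapping_eq_iff fun_eq_iff lookup_multi_partial lookup_poly_scale algebra_simps)

lemma multi_partial_partial:
  "multi_partial k (partial j p) = partial j (multi_partial k p :: ('n::finite, 'k::field) mpoly)"
proof -
  interpret comp_fun_commute "\<lambda>i. partial i ^^ Poly_Mapping.lookup k i :: ('n, 'k) mpoly \<Rightarrow> _"
    by (rule comp_fun_commute_partial)
  have pow: "(partial i ^^ n) (partial j q) = partial j ((partial i ^^ n) q)" for i n and q :: "('n, 'k) mpoly"
    by (induction n) (auto simp: partial_commute[of i j])
  have "Finite_Set.fold (\<lambda>i. partial i ^^ Poly_Mapping.lookup k i) (partial j p) A =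
      partial j (Finite_Set.fold (\<lambda>i. partial i ^^ Poly_Mapping.lookup k i) p A)" if "finite A" for A
    using that by induction (auto simp: pow)
  then show ?thesis by (simp add: multi_partial_def)
qed

text \<open>The factor \<open>multi_fact k\<close> cancels the weight \<open>1 / k!\<close> in the
  tensor action, so at the origin a field acts on W through its Taylor coefficients.\<close>

lemma multi_partial_0_coeff:
  "Poly_Mapping.lookup (multi_partial k p) 0 = of_nat (multi_fact k) * Poly_Mapping.lookup p k"
  by (simp add: lookup_multi_partial multi_fact_def pochhammer_fact)

lemma multi_partial_one: "k \<noteq> 0 \<Longrightarrow> multi_partial k 1 = 0"
proof -
  assume "k \<noteq> 0"
  then have "a + k \<noteq> 0" for a by (auto simp: poly_mapping_eq_iff fun_eq_iff lookup_add)
  then show ?thesis by (auto simp: poly_mapping_eq_iff fun_eq_iff lookup_multi_partial lookup_one)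
qed

lemma vf_bracket_translation_var:
  "D \<in> derivations \<Longrightarrow> vf_bracket (translation j) D (var i) = partial j (D (var i))"
  using derivation_one[of D] derivationsD(2)[of D 0 0]
  by (auto simp: vf_bracket_def translation_apply partial_var)

lemma sum_vfield_apply: "(\<Sum>i\<in>A. D i) p = (\<Sum>i\<in>A. D i p)" for D :: "'i \<Rightarrow> ('n, 'k::field) vfield"
  by (induction A rule: infinite_finite_induct) auto

lemma lie_plus_lookup_0:
  fixes D :: "('n::finite, 'k::field) vfield"
  assumes D: "D \<in> lie_plus"
  shows "Poly_Mapping.lookup (D p) 0 = 0"
proof -
  have "D p = (\<Sum>i\<in>UNIV. vf (D (var i)) i) p"
    using D by (intro fun_cong[OF derivation_eq_sum_vf]) (simp add: lie_plus_iff)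
  then show ?thesis
    using D by (simp add: sum_vfield_apply lookup_sum vf_def lookup_mult_0 lie_plus_iff)
qed

lemma lie_plus_subset_derivations: "D \<in> lie_plus \<Longrightarrow> D \<in> derivations"
  by (simp add: lie_plus_iff)

text \<open>A linear retraction onto \<open>lie_plus\<close> along the constant fields. It is not a
  Lie algebra homomorphism, so pulling cochains back along it gives lifts of cochains but no chain
  map in general.\<close>

definition lie_plus_projection :: "('n::finite, 'k::field) vfield \<Rightarrow> ('n, 'k) vfield" where
  "lie_plus_projection D = D - (\<Sum>i\<in>UNIV. vf_scale (Poly_Mapping.lookup (D (var i)) 0) (translation i))"

lemma lie_plus_projection_in:
  assumes D: "D \<in> derivations"
  shows "lie_plus_projection D \<in> (lie_plus :: ('n::finite, 'k::field) vfield set)"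
proof -
  have "lie_plus_projection D \<in> derivations"
    unfolding lie_plus_projection_def
    by (intro vfield.subspace_diff vfield.subspace_sum vfield.subspace_scale subspace_derivations translation_in_derivations D)
  moreover have "Poly_Mapping.lookup (if i = j then 1 else 0 :: ('n, 'k) mpoly) 0 = (if i = j then 1 else 0)" for i j :: 'n
    by simp
  ultimately show ?thesis
    by (simp add: lie_plus_iff lie_plus_projection_def sum_vfield_apply pointwise_scale_def translation_apply partial_var
        lookup_minus lookup_poly_scale lookup_sum if_distrib[where f = "(*) _"] cong: if_cong)
qed

lemma derivation_decompose:
  "D = lie_plus_projection D + (\<Sum>i\<in>UNIV. vf_scale (Poly_Mapping.lookup (D (var i)) 0) (translation i))"
  by (simp add: lie_plus_projection_def)

lemma derivations_induct_decompose:
  assumes D: "D \<in> derivations" and S: "vfield.subspace S" and "lie_plus \<subseteq> S" and "\<And>i. translation i \<in> S"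
  shows "(D :: ('n::finite, 'k::field) vfield) \<in> S"
  by (subst derivation_decompose)
    (use assms lie_plus_projection_in[OF D] in \<open>blast intro: vfield.subspace_add vfield.subspace_sum vfield.subspace_scale\<close>)

locale tensor_module = W: lie_module vf_scale lie_plus vf_bracket scaleW actW
  for scaleW :: "'k::field_char_0 \<Rightarrow> 'w::ab_group_add \<Rightarrow> 'w"
    and actW :: "('n::finite, 'k) vfield \<Rightarrow> 'w \<Rightarrow> 'w"
begin

abbreviation "T \<equiv> tensor_act scaleW actW"
abbreviation "scaleT \<equiv> coeff_scale scaleW :: 'k \<Rightarrow> (('n \<Rightarrow>\<^sub>0 nat) \<Rightarrow>\<^sub>0 'w) \<Rightarrow> _"

lemmas W_vs = W.M.vector_space_axioms
lemmas W_ax = W.lie_module_axioms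

sublocale TV: vector_space scaleT
  by (rule vector_space_coeff_scale[OF W_vs])

lemma tensor_add: "tensor scaleW (s + t) w = tensor scaleW s w + tensor scaleW t w"
  and tensor_scale: "tensor scaleW (poly_scale c s) w = scaleT c (tensor scaleW s w)"
  and tensor_diff: "tensor scaleW (s - t) w = tensor scaleW s w - tensor scaleW t w"
  and tensor_zero: "tensor scaleW 0 w = 0"
proof -
  interpret L: Vector_Spaces.linear poly_scale scaleT "\<lambda>s. tensor scaleW s w" by (rule tensor_bilinear[OF W_vs])
  show "tensor scaleW (s + t) w = tensor scaleW s w + tensor scaleW t w"
    "tensor scaleW (poly_scale c s) w = scaleT c (tensor scaleW s w)"
    "tensor scaleW (s - t) w = tensor scaleW s w - tensor scaleW t w"
    "tensor scaleW 0 w = 0"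
    using L.add L.scale L.diff by (simp_all add: poly_mapping_eq_iff fun_eq_iff lookup_tensor[OF W_vs])
qed

lemma T_linear:
  assumes "D \<in> derivations"
  shows "T D (m + m') = T D m + T D m'" "T D (m - m') = T D m - T D m'" "T D (scaleT c m) = scaleT c (T D m)" "T D 0 = 0"
    "T D (\<Sum>a\<in>A. f a) = (\<Sum>a\<in>A. T D (f a))"
proof -
  interpret L: Vector_Spaces.linear scaleT scaleT "T D" by (rule tensor_act_linear[OF W_ax assms])
  show "T D (m + m') = T D m + T D m'" "T D (m - m') = T D m - T D m'" "T D (scaleT c m) = scaleT c (T D m)" "T D 0 = 0"
    "T D (\<Sum>a\<in>A. f a) = (\<Sum>a\<in>A. T D (f a))"
    by (rule L.add L.diff L.scale L.zero L.sum)+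
qed

lemma tensor_additive_eqI:
  fixes F G :: "(('n \<Rightarrow>\<^sub>0 nat) \<Rightarrow>\<^sub>0 'w) \<Rightarrow> 'b::ab_group_add"
  assumes "\<And>x y. F (x + y) = F x + F y" "\<And>x y. G (x + y) = G x + G y"
    and "\<And>s w. F (tensor scaleW s w) = G (tensor scaleW s w)"
  shows "F m = G m"
  using assms(1,2) by (rule additive_eqI) (simp add: assms(3) flip: tensor_monomial[OF W_vs])

text \<open>The index set in the action depends on the field; a common finite set lets the actions
  of several fields be compared term by term.\<close>

lemma tensor_act_pure_on:
  fixes F :: "('n \<Rightarrow>\<^sub>0 nat) set"
  assumes "finite F" "\<And>i. {k. k \<noteq> 0 \<and> multi_partial k (D (var i)) \<noteq> 0} \<subseteq> F"
  shows "tensor_act_pure scaleW actW D s w = tensor scaleW (D s) w +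
     (\<Sum>i\<in>UNIV. \<Sum>k\<in>F - {0}.
        tensor scaleW (poly_scale (1 / of_nat (multi_fact k)) (multi_partial k (D (var i))) * s)
          (actW (vf (monomial k) i) w))"
  unfolding tensor_act_pure_def
  by (intro arg_cong2[where f="(+)"] refl sum.cong sum.mono_neutral_left)
    (use assms in \<open>auto simp: tensor_zero\<close>)

lemma finite_multi_partials:
  "finite (\<Union>i. {k. k \<noteq> 0 \<and> multi_partial k ((D :: ('n, 'k) vfield) (var i)) \<noteq> 0})"
  by (intro finite_UN_I finite_multi_partial_nonzero) simp

lemma T_add_left:
  assumes D: "D \<in> derivations" and E: "E \<in> derivations"
  shows "T (D + E) m = T D m + T E m"
proof (rule tensor_additive_eqI[where F = "T (D + E)"])
  fix s w
  have DE: "D + E \<in> derivations" using D E by (intro vfield.subspace_add subspace_derivations)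
  define F where "F = (\<Union>i. {k. k \<noteq> 0 \<and> multi_partial k (D (var i)) \<noteq> 0}) \<union>
    (\<Union>i. {k. k \<noteq> 0 \<and> multi_partial k (E (var i)) \<noteq> 0}) \<union> (\<Union>i. {k. k \<noteq> 0 \<and> multi_partial k ((D + E) (var i)) \<noteq> 0})"
  have F: "finite F" unfolding F_def by (intro finite_UnI finite_multi_partials)
  have pure: "X \<in> {D, E, D + E} \<Longrightarrow> tensor_act_pure scaleW actW X s w = tensor scaleW (X s) w +
     (\<Sum>i\<in>UNIV. \<Sum>k\<in>F - {0}.
        tensor scaleW (poly_scale (1 / of_nat (multi_fact k)) (multi_partial k (X (var i))) * s)
          (actW (vf (monomial k) i) w))" for X
    by (rule tensor_act_pure_on[OF F]) (auto simp: F_def)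
  show "T (D + E) (tensor scaleW s w) = T D (tensor scaleW s w) + T E (tensor scaleW s w)"
    by (simp add: tensor_act_tensor[OF W_ax] D E DE pure tensor_add multi_partial_add poly.scale_right_distrib
        distrib_right sum.distrib add.assoc add.commute add.left_commute)
qed (use D E in \<open>auto simp: T_linear vfield.subspace_add subspace_derivations\<close>)

lemma T_scale_left:
  assumes D: "D \<in> derivations"
  shows "T (vf_scale c D) m = scaleT c (T D m)"
proof (rule tensor_additive_eqI[where F = "T (vf_scale c D)"])
  fix s w
  have cD: "vf_scale c D \<in> derivations" using D by (intro vfield.subspace_scale subspace_derivations)
  define F where "F = (\<Union>i. {k. k \<noteq> 0 \<and> multi_partial k (D (var i)) \<noteq> 0}) \<union>
    (\<Union>i. {k. k \<noteq> 0 \<and> multi_partial k ((vf_scale c D) (var i)) \<noteq> 0})"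
  have F: "finite F" unfolding F_def by (intro finite_UnI finite_multi_partials)
  have pure: "X \<in> {D, vf_scale c D} \<Longrightarrow> tensor_act_pure scaleW actW X s w = tensor scaleW (X s) w +
     (\<Sum>i\<in>UNIV. \<Sum>k\<in>F - {0}.
        tensor scaleW (poly_scale (1 / of_nat (multi_fact k)) (multi_partial k (X (var i))) * s)
          (actW (vf (monomial k) i) w))" for X
    by (rule tensor_act_pure_on[OF F]) (auto simp: F_def)
  show "T (vf_scale c D) (tensor scaleW s w) = scaleT c (T D (tensor scaleW s w))"
    by (simp add: tensor_act_tensor[OF W_ax] D cD pure)
      (simp add: pointwise_scale_def tensor_scale multi_partial_scale TV.scale_right_distrib
        TV.scale_sum_right poly_scale_mult_left)
qed (use D in \<open>auto simp: T_linear vfield.subspace_scale subspace_derivations TV.scale_right_distrib\<close>)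

lemma T_translation: "T (translation j) (tensor scaleW s w) = tensor scaleW (partial j s) w"
proof -
  have "{k. k \<noteq> 0 \<and> multi_partial k (1 :: ('n, 'k) mpoly) \<noteq> 0} = {}" using multi_partial_one by blast
  then show ?thesis
    by (simp only: translation_def tensor_act_vf[OF W_ax] sum.empty mult_1 add_0_right)
qed

lemma lookup_T_translation:
  "Poly_Mapping.lookup (T (translation j) m) a =
     scaleW (of_nat (Poly_Mapping.lookup a j + 1)) (Poly_Mapping.lookup m (a + Poly_Mapping.single j 1))"
  by (rule tensor_additive_eqI[where m = m])
    (simp_all add: T_linear translation_in_derivations lookup_add W.M.scale_right_distrib
      T_translation lookup_tensor[OF W_vs] lookup_partial)

text \<open>Translations act by differentiation alone, so for them the bracket identity is the
  Leibniz rule together with the commutation of partial derivatives. The general identity is derived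
  from this case.\<close>

lemma T_bracket_translation:
  assumes D: "D \<in> derivations"
  shows "T (vf_bracket (translation j) D) m = T (translation j) (T D m) - T D (T (translation j) m)"
proof (rule tensor_additive_eqI[where m = m])
  fix s w
  let ?E = "vf_bracket (translation j) D"
  have E: "?E \<in> derivations" by (intro vf_bracket_in_derivations translation_in_derivations D)
  define F where "F = (\<Union>i. {k. k \<noteq> 0 \<and> multi_partial k (D (var i)) \<noteq> 0}) \<union>
    (\<Union>i. {k. k \<noteq> 0 \<and> multi_partial k (?E (var i)) \<noteq> 0})"
  have F: "finite F" unfolding F_def by (intro finite_UnI finite_multi_partials)
  have pure: "X \<in> {D, ?E} \<Longrightarrow> T X (tensor scaleW t w) = tensor scaleW (X t) w +
     (\<Sum>i\<in>UNIV. \<Sum>k\<in>F - {0}.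
        tensor scaleW (poly_scale (1 / of_nat (multi_fact k)) (multi_partial k (X (var i))) * t)
          (actW (vf (monomial k) i) w))" (is "_ \<Longrightarrow> ?P X t") for X t
  proof -
    assume "X \<in> {D, ?E}"
    then have "X \<in> derivations" "\<And>i. {k. k \<noteq> 0 \<and> multi_partial k (X (var i)) \<noteq> 0} \<subseteq> F"
      using D E by (auto simp: F_def)
    then show "?P X t" by (simp only: tensor_act_tensor[OF W_ax] tensor_act_pure_on[OF F])
  qed
  have Es: "?E s = partial j (D s) - D (partial j s)"
    by (simp add: vf_bracket_def translation_apply)
  show "T ?E (tensor scaleW s w) =
      T (translation j) (T D (tensor scaleW s w)) - T D (T (translation j) (tensor scaleW s w))"
    by (simp add: pure T_linear[OF translation_in_derivations] T_translation vf_bracket_translation_var[OF D])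
      (simp add: Es partial_mult partial_scale multi_partial_partial tensor_diff tensor_add sum.distrib
        sum_subtractf poly_scale_mult_left tensor_scale TV.scale_right_distrib)
next
  have E: "vf_bracket (translation j) D \<in> derivations" by (intro vf_bracket_in_derivations translation_in_derivations D)
  show "T (vf_bracket (translation j) D) (x + y) = T (vf_bracket (translation j) D) x + T (vf_bracket (translation j) D) y"
    for x y by (rule T_linear[OF E])
qed (use D in \<open>auto simp: T_linear translation_in_derivations\<close>)

lemma actW_sum:
  assumes "\<And>a. a \<in> A \<Longrightarrow> x a \<in> lie_plus"
  shows "actW (\<Sum>a\<in>A. x a) w = (\<Sum>a\<in>A. actW (x a) w)"
proof -
  have zero: "(0 :: ('n, 'k) vfield) \<in> lie_plus" using W.subspace_carrier by (rule W.subspace_0)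
  have "actW 0 w = 0" using W.act_scale[OF zero, of 0 w] by simp
  then show ?thesis using assms
    by (induction A rule: infinite_finite_induct)
      (auto simp: W.act_add W.subspace_sum[OF W.subspace_carrier])
qed

text \<open>All values of \<open>D\<close> vanish at the origin, and there the weighted derivatives
  of its components are their Taylor coefficients, so the sum reassembles \<open>D\<close> from
  monomial fields. This is the linearity over \<open>lie_plus\<close> of evaluation at the
  origin.\<close>

lemma lookup_T_lie_plus:
  assumes D: "D \<in> lie_plus"
  shows "Poly_Mapping.lookup (T D m) 0 = actW D (Poly_Mapping.lookup m 0)"
proof (rule tensor_additive_eqI[where m = m])
  fix s w
  note D' = lie_plus_subset_derivations[OF D]
  interpret A: Vector_Spaces.linear scaleW scaleW "actW D" by (rule W.act_linear[OF D])
  \<comment> \<open>Including the exponents of the components lets the sum over derivatives and the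
    Taylor sum run over the same set.\<close>
  define F where "F = (\<Union>i. {k. k \<noteq> 0 \<and> multi_partial k (D (var i)) \<noteq> 0}) \<union> (\<Union>i. Poly_Mapping.keys (D (var i)))"
  have F: "finite F" unfolding F_def by (intro finite_UnI finite_multi_partials finite_UN_I) auto
  have pure: "T D (tensor scaleW s w) = tensor scaleW (D s) w +
     (\<Sum>i\<in>UNIV. \<Sum>k\<in>F - {0}.
        tensor scaleW (poly_scale (1 / of_nat (multi_fact k)) (multi_partial k (D (var i))) * s)
          (actW (vf (monomial k) i) w))"
  proof -
    have "{k. k \<noteq> 0 \<and> multi_partial k (D (var i)) \<noteq> 0} \<subseteq> F" for i by (auto simp: F_def)
    then show ?thesis by (simp only: tensor_act_tensor[OF W_ax D'] tensor_act_pure_on[OF F])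
  qed
  have fact: "multi_fact k \<noteq> 0" for k :: "'n \<Rightarrow>\<^sub>0 nat" by (simp add: multi_fact_def)
  have key: "a \<noteq> 0" if "a \<in> Poly_Mapping.keys (D (var i))" for a i
    using that D by (auto simp: in_keys_iff lie_plus_iff)
  note mono = vf_monomial_in_lie_plus[OF W_ax]
  have vf_in: "vf (D (var i)) i \<in> lie_plus" for i
    unfolding vf_sum_monomials[of "D (var i)"]
    by (intro vfield.subspace_sum vfield.subspace_scale W.subspace_carrier mono key)
  have "actW D w = actW (\<Sum>i\<in>UNIV. vf (D (var i)) i) w"
    by (rule arg_cong[OF derivation_eq_sum_vf[OF D']])
  also have "\<dots> = (\<Sum>i\<in>UNIV. actW (vf (D (var i)) i) w)"
    by (rule actW_sum[OF vf_in])
  also have "\<dots> = (\<Sum>i\<in>UNIV. \<Sum>k\<in>Poly_Mapping.keys (D (var i)).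
      scaleW (Poly_Mapping.lookup (D (var i)) k) (actW (vf (monomial k) i) w))"
    by (subst vf_sum_monomials, subst actW_sum)
      (auto intro!: sum.cong vfield.subspace_scale W.subspace_carrier mono key W.act_scale)
  also have "\<dots> = (\<Sum>i\<in>UNIV. \<Sum>k\<in>F - {0}.
      scaleW (Poly_Mapping.lookup (D (var i)) k) (actW (vf (monomial k) i) w))"
    using F key by (intro sum.cong refl sum.mono_neutral_left) (auto simp: F_def in_keys_iff)
  finally have act: "actW D w = \<dots>" .
  show "Poly_Mapping.lookup (T D (tensor scaleW s w)) 0 = actW D (Poly_Mapping.lookup (tensor scaleW s w) 0)"
    by (simp add: pure lookup_add lookup_sum lookup_tensor[OF W_vs] lie_plus_lookup_0[OF D] A.scale act
        lookup_mult_0 lookup_poly_scale multi_partial_0_coeff fact W.M.scale_sum_right mult.commute)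
next
  interpret A: Vector_Spaces.linear scaleW scaleW "actW D" by (rule W.act_linear[OF D])
  show "actW D (Poly_Mapping.lookup (x + y) 0) = actW D (Poly_Mapping.lookup x 0) + actW D (Poly_Mapping.lookup y 0)" for x y
    by (simp add: lookup_add A.add)
qed (simp add: T_linear lie_plus_subset_derivations[OF D] lookup_add)

text \<open>
  The bracket identity for the tensor module: its defect vanishes at the origin, and translating the defect
  only produces further defects, so all its Taylor coefficients vanish.
\<close>

definition bracket_defect where
  "bracket_defect D E m = T (vf_bracket D E) m - T D (T E m) + T E (T D m)"

lemma vf_bracket_add:
  assumes "X \<in> derivations" "Y \<in> derivations" "E \<in> derivations"
  shows "vf_bracket (X + Y) E = vf_bracket X E + vf_bracket Y E" "vf_bracket (vf_scale c X) E = vf_scale c (vf_bracket X E)"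
    "vf_bracket X E = vf_scale (-1) (vf_bracket E X)"
  using assms by (auto simp: vf_bracket_def fun_eq_iff derivationsD pointwise_scale_def poly.scale_right_diff_distrib)

lemma T_neg_left: "D \<in> derivations \<Longrightarrow> T (- D) m = - T D m"
  using T_scale_left[of D "-1" m] by simp

lemma bracket_defect_anti:
  "D \<in> derivations \<Longrightarrow> E \<in> derivations \<Longrightarrow> bracket_defect E D m = - bracket_defect D E m"
  by (subst bracket_defect_def, subst vf_bracket_add(3)[of E E D])
    (simp_all add: T_neg_left vf_bracket_in_derivations bracket_defect_def)

lemma bracket_defect_translation: "D \<in> derivations \<Longrightarrow> bracket_defect (translation j) D m = 0"
  by (simp add: bracket_defect_def T_bracket_translation)

lemma subspace_bracket_defect:
  assumes E: "E \<in> derivations"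
  shows "vfield.subspace {D \<in> derivations. Poly_Mapping.lookup (bracket_defect D E m) a = 0}"
proof (rule vfield.subspaceI)
  have 0: "(0 :: ('n, 'k) vfield) \<in> derivations" using subspace_derivations by (rule vfield.subspace_0)
  have "T 0 x = 0" for x using T_scale_left[OF 0, of 0 x] by simp
  moreover have "vf_bracket 0 E = 0" using derivationsD(2)[OF E, of 0 0] by (auto simp: vf_bracket_def fun_eq_iff)
  ultimately show "0 \<in> {D \<in> derivations. Poly_Mapping.lookup (bracket_defect D E m) a = 0}"
    using 0 E by (simp add: bracket_defect_def T_linear)
next
  fix X Y assume "X \<in> {D \<in> derivations. Poly_Mapping.lookup (bracket_defect D E m) a = 0}"
    "Y \<in> {D \<in> derivations. Poly_Mapping.lookup (bracket_defect D E m) a = 0}"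
  moreover have "bracket_defect (X + Y) E m = bracket_defect X E m + bracket_defect Y E m"
    if "X \<in> derivations" "Y \<in> derivations"
    using that E by (simp add: bracket_defect_def vf_bracket_add(1,2) T_add_left vf_bracket_in_derivations T_linear)
  ultimately show "X + Y \<in> {D \<in> derivations. Poly_Mapping.lookup (bracket_defect D E m) a = 0}"
    by (auto simp: lookup_add intro!: vfield.subspace_add subspace_derivations)
next
  fix c X assume "X \<in> {D \<in> derivations. Poly_Mapping.lookup (bracket_defect D E m) a = 0}"
  moreover have "bracket_defect (vf_scale c X) E m = scaleT c (bracket_defect X E m)" if "X \<in> derivations"
    using that E by (simp add: bracket_defect_def vf_bracket_add(1,2) T_scale_left vf_bracket_in_derivations T_linear
        TV.scale_right_distrib TV.scale_right_diff_distrib)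
  ultimately show "vf_scale c X \<in> {D \<in> derivations. Poly_Mapping.lookup (bracket_defect D E m) a = 0}"
    by (auto simp: lookup_coeff_scale[OF W_vs] intro!: vfield.subspace_scale subspace_derivations)
qed

text \<open>If both fields lie in \<open>lie_plus\<close>, the defect at the origin is that of the
  module W, hence zero; if one is a translation, the defect is zero anyway. Splitting first one
  field and then, by antisymmetry, the other reduces everything to these cases.\<close>

lemma bracket_defect_0:
  assumes D: "D \<in> derivations" and E: "E \<in> derivations"
  shows "Poly_Mapping.lookup (bracket_defect D E m) 0 = 0"
proof -
  have 1: "Poly_Mapping.lookup (bracket_defect X Y m) 0 = 0" if X: "X \<in> lie_plus" and Y: "Y \<in> lie_plus" for X Y
    using that by (simp add: bracket_defect_def lookup_add lookup_minus lookup_T_lie_plus W.bracket_closed W.act_bracket)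
  have 2: "Poly_Mapping.lookup (bracket_defect X Y m) 0 = 0" if X: "X \<in> derivations" and Y: "Y \<in> lie_plus" for X Y
  proof -
    have "lie_plus \<subseteq> {D \<in> derivations. Poly_Mapping.lookup (bracket_defect D Y m) 0 = 0}"
      using 1 Y by (auto simp: lie_plus_subset_derivations)
    from derivations_induct_decompose[OF X subspace_bracket_defect[OF lie_plus_subset_derivations[OF Y]] this]
    show ?thesis using Y by (simp add: translation_in_derivations lie_plus_subset_derivations bracket_defect_translation)
  qed
  have "lie_plus \<subseteq> {E \<in> derivations. Poly_Mapping.lookup (bracket_defect E D m) 0 = 0}"
    using 2 D by (auto simp: lie_plus_subset_derivations bracket_defect_anti[OF D])
  from derivations_induct_decompose[OF E subspace_bracket_defect[OF D] this]
  have "Poly_Mapping.lookup (bracket_defect E D m) 0 = 0"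
    using D by (simp add: translation_in_derivations bracket_defect_translation)
  then show ?thesis using bracket_defect_anti[OF D E] by simp
qed

lemma T_translation_bracket_defect:
  assumes D: "D \<in> derivations" and E: "E \<in> derivations"
  shows "T (translation j) (bracket_defect D E m) =
    bracket_defect (vf_bracket (translation j) D) E m + bracket_defect D (vf_bracket (translation j) E) m +
    bracket_defect D E (T (translation j) m)"
proof -
  let ?t = "translation j :: ('n, 'k) vfield"
  note t = translation_in_derivations[of j]
  note br = vf_bracket_in_derivations
  have comm: "T ?t (T X x) = T (vf_bracket ?t X) x + T X (T ?t x)" if "X \<in> derivations" for X x
    using T_bracket_translation[OF that, of j x] by simp
  have "vf_bracket ?t (vf_bracket D E) = vf_bracket (vf_bracket ?t D) E + vf_bracket D (vf_bracket ?t E)"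
    using D E t by (auto simp: vf_bracket_def fun_eq_iff derivation_diff[OF t] derivation_diff)
  then show ?thesis
    using D E by (simp add: bracket_defect_def T_linear t comm br T_add_left)
qed

lemma bracket_defect_zero:
  assumes "D \<in> derivations" "E \<in> derivations"
  shows "bracket_defect D E m = 0"
proof -
  have "Poly_Mapping.lookup (bracket_defect D E m) a = 0" for a
    using assms
  \<comment> \<open>A translation alters both fields and the tensor, so all three are kept
    arbitrary.\<close>
  proof (induction "total_degree a" arbitrary: a D E m)
    case 0
    then have "a = 0" using total_degree_eq_0_iff[of a] by simp
    then show ?case using 0 by (simp add: bracket_defect_0)
  next
    case (Suc n)
    then obtain i where i: "Poly_Mapping.lookup a i \<noteq> 0"
      unfolding total_degree_def by (metis nat.distinct(1) sum.neutral)
    define b where "b = a - Poly_Mapping.single i 1"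
    have a: "a = b + Poly_Mapping.single i 1"
      using i by (auto simp: b_def poly_mapping_eq_iff fun_eq_iff lookup_add lookup_minus lookup_single when_def)
    have "total_degree a = total_degree b + 1"
      by (simp add: total_degree_def a lookup_add sum.distrib lookup_single when_def)
    then have "n = total_degree b" using Suc by simp
    then have "Poly_Mapping.lookup (T (translation i) (bracket_defect D E m)) b = 0"
      using Suc.prems by (simp add: T_translation_bracket_defect lookup_add Suc.hyps(1)
          vf_bracket_in_derivations translation_in_derivations)
    \<comment> \<open>The coefficient at \<open>a\<close> appears here with the factor
      \<open>lookup b i + 1\<close>, which is invertible in characteristic zero.\<close>
    then show ?case by (simp add: lookup_T_translation a del: of_nat_Suc of_nat_add)
  qed
  then show ?thesis by (simp add: poly_mapping_eq_iff fun_eq_iff)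
qed

sublocale V: lie_module vf_scale "derivations :: ('n, 'k) vfield set" vf_bracket scaleT T
proof (intro lie_module.intro lie_algebra_derivations TV.vector_space_axioms lie_module_axioms.intro)
  show "T (vf_bracket D E) m = T D (T E m) - T E (T D m)" if "D \<in> derivations" "E \<in> derivations" for D E m
    using bracket_defect_zero[OF that, of m] by (simp add: bracket_defect_def algebra_simps)
qed (simp_all add: T_add_left T_scale_left tensor_act_linear[OF W_ax])

section \<open>The module structure over the polynomial ring\<close>

definition poly_times :: "('n, 'k) mpoly \<Rightarrow> (('n \<Rightarrow>\<^sub>0 nat) \<Rightarrow>\<^sub>0 'w) \<Rightarrow> (('n \<Rightarrow>\<^sub>0 nat) \<Rightarrow>\<^sub>0 'w)" where
  "poly_times f m = (\<Sum>a\<in>Poly_Mapping.keys m. tensor scaleW (f * monomial a) (Poly_Mapping.lookup m a))"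

lemma linear_poly_times_tensor: "Vector_Spaces.linear poly_scale scaleT (\<lambda>s. tensor scaleW (f * s) w)"
  by (simp add: Vector_Spaces.linear_iff poly.vector_space_axioms TV.vector_space_axioms distrib_left tensor_add
      poly_scale_mult_right tensor_scale)

lemma poly_times_linear: "Vector_Spaces.linear scaleT scaleT (poly_times f)"
  unfolding poly_times_def[abs_def]
  by (intro sum_keys_linear W_vs tensor_bilinear TV.vector_space_axioms)

lemma poly_times_add: "poly_times f (m + m') = poly_times f m + poly_times f m'"
  and poly_times_diff: "poly_times f (m - m') = poly_times f m - poly_times f m'"
  and poly_times_zero: "poly_times f 0 = 0"
proof -
  interpret Vector_Spaces.linear scaleT scaleT "poly_times f" by (rule poly_times_linear)
  show "poly_times f (m + m') = poly_times f m + poly_times f m'"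
    "poly_times f (m - m') = poly_times f m - poly_times f m'" "poly_times f 0 = 0"
    by (rule add diff zero)+
qed

lemma poly_times_tensor: "poly_times f (tensor scaleW s w) = tensor scaleW (f * s) w"
  unfolding poly_times_def
  by (rule sum_keys_tensor[OF W_vs linear_poly_times_tensor tensor_bilinear(2)[OF W_vs]])

lemma poly_times_one: "poly_times 1 m = m"
  by (rule tensor_additive_eqI[where F = "poly_times 1"]) (simp_all add: poly_times_add poly_times_tensor)

lemma lookup_poly_times_0: "Poly_Mapping.lookup (poly_times f m) 0 = scaleW (Poly_Mapping.lookup f 0) (Poly_Mapping.lookup m 0)"
  by (rule tensor_additive_eqI[where m = m])
    (simp_all add: poly_times_add lookup_add poly_times_tensor lookup_tensor[OF W_vs] lookup_mult_0 W.M.scale_right_distrib)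

text \<open>This is the compatibility required of an AV-module. In the tensor action only the
  summand with \<open>D s\<close> differentiates \<open>s\<close>; all others are A-linear in
  \<open>s\<close>.\<close>

lemma T_poly_times:
  assumes D: "D \<in> derivations"
  shows "T D (poly_times f m) = poly_times f (T D m) + poly_times (D f) m"
proof (rule tensor_additive_eqI[where m = m])
  fix s w
  show "T D (poly_times f (tensor scaleW s w)) = poly_times f (T D (tensor scaleW s w)) + poly_times (D f) (tensor scaleW s w)"
  proof -
    interpret Vector_Spaces.linear scaleT scaleT "poly_times f" by (rule poly_times_linear)
    show ?thesis
      by (simp add: poly_times_tensor tensor_act_tensor[OF W_ax D] tensor_act_pure_def add sum derivationsD[OF D]
          tensor_add ac_simps)
  qed
qed (simp_all add: poly_times_add T_linear[OF D])

end

section \<open>The contracting homotopy\<close>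

definition basis_field :: "('n \<Rightarrow>\<^sub>0 nat) \<times> 'n \<Rightarrow> ('n, 'k::field) vfield" where
  "basis_field = (\<lambda>(\<alpha>, l). vf (monomial \<alpha>) l)"

text \<open>
  Costs are such that bracketing with a translation lowers them, and that for lists of length below \<open>q\<close>
  the total cost modulo \<open>q\<close> is the number of translations in the list.
\<close>

definition field_cost :: "nat \<Rightarrow> ('n::finite \<Rightarrow>\<^sub>0 nat) \<times> 'n \<Rightarrow> nat" where
  "field_cost q = (\<lambda>(\<alpha>, l). if \<alpha> = 0 then 1 else q * total_degree \<alpha>)"

definition list_cost :: "nat \<Rightarrow> (('n::finite \<Rightarrow>\<^sub>0 nat) \<times> 'n) list \<Rightarrow> nat" where
  "list_cost q ps = sum_list (map (field_cost q) ps)"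

definition translation_count :: "(('n::finite \<Rightarrow>\<^sub>0 nat) \<times> 'n) list \<Rightarrow> nat" where
  "translation_count ps = length (filter (\<lambda>p. fst p = 0) ps)"

lemma list_cost_simps [simp]: "list_cost q [] = 0" "list_cost q (p # ps) = field_cost q p + list_cost q ps"
  by (auto simp: list_cost_def)

lemma translation_count_simps [simp]: "translation_count [] = 0"
  "translation_count (p # ps) = (if fst p = 0 then 1 else 0) + translation_count ps"
  by (auto simp: translation_count_def)

lemma list_cost_mod: "length ps < q \<Longrightarrow> list_cost q ps mod q = translation_count ps"
proof -
  have "\<exists>m. list_cost q ps = translation_count ps + q * m"
  proof (induction ps)
    case (Cons p ps)
    then obtain m where "list_cost q ps = translation_count ps + q * m" by blast
    then show ?case
      by (cases "fst p = 0")
        (auto simp: field_cost_def split_beta intro: exI[of _ m] exI[of _ "total_degree (fst p) + m"] simp: algebra_simps)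
  qed simp
  then obtain m where m: "list_cost q ps = translation_count ps + q * m" by blast
  assume "length ps < q"
  moreover have "translation_count ps \<le> length ps" by (simp add: translation_count_def)
  ultimately show ?thesis by (simp add: m)
qed

lemma basis_field_in_derivations: "basis_field p \<in> derivations"
  by (simp add: basis_field_def vf_in_derivations split_beta)

lemma translation_eq_basis_field: "translation l = basis_field (0, l)"
  by (simp add: translation_def basis_field_def monomial_0)

lemma basis_field_apply_var: "basis_field (\<alpha>, l) (var i) = (if i = l then monomial \<alpha> else 0)"
  by (simp add: basis_field_def vf_def partial_var)

lemma bracket_basis_field_translation:
  "vf_bracket (basis_field (\<alpha>, l)) (translation i) =
    vf_scale (- of_nat (Poly_Mapping.lookup \<alpha> i)) (basis_field (\<alpha> - Poly_Mapping.single i 1, l))"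
  by (simp add: fun_eq_iff vf_bracket_def basis_field_def vf_def translation_apply pointwise_scale_def
      partial_mult partial_monomial partial_commute[of i l] poly_scale_mult_left)

lemma total_degree_minus_single:
  assumes "Poly_Mapping.lookup \<alpha> i \<noteq> 0"
  shows "total_degree (\<alpha>::'n::finite \<Rightarrow>\<^sub>0 nat) = Suc (total_degree (\<alpha> - Poly_Mapping.single i 1))"
proof -
  define b where "b = \<alpha> - Poly_Mapping.single i 1"
  have "\<alpha> = b + Poly_Mapping.single i 1"
    using assms by (auto simp: b_def poly_mapping_eq_iff fun_eq_iff lookup_add lookup_minus lookup_single when_def)
  then have "total_degree \<alpha> = total_degree (b + Poly_Mapping.single i 1)" by simp
  also have "\<dots> = Suc (total_degree b)"
    by (simp add: total_degree_def lookup_add sum.distrib lookup_single when_def)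
  finally show ?thesis by (simp add: b_def)
qed

text \<open>For a linear field the cost falls from \<open>q\<close> to 1, hence the condition
  \<open>q > 1\<close>; in higher degree it falls by \<open>q\<close>.\<close>

lemma field_cost_minus_single:
  assumes "q > 1" "Poly_Mapping.lookup \<alpha> i \<noteq> 0"
  shows "field_cost q (\<alpha> - Poly_Mapping.single i 1, l) < field_cost q (\<alpha>, l)"
proof -
  have "\<alpha> \<noteq> 0" using assms by auto
  then show ?thesis using assms total_degree_minus_single[of \<alpha> i]
    by (auto simp: field_cost_def)
qed

lemma field_cost_translation: "q > 1 \<Longrightarrow> \<alpha> \<noteq> 0 \<Longrightarrow> field_cost q (0, l) < field_cost q (\<alpha>, l)"
  using total_degree_eq_0_iff[of \<alpha>] by (auto simp: field_cost_def intro: less_le_trans)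

lemma derivation_eq_sum_basis_field:
  fixes D :: "('n::finite, 'k::field) vfield"
  assumes "D \<in> derivations"
  shows "D = (\<Sum>p\<in>(SIGMA i:UNIV. Poly_Mapping.keys (D (var i))).
    vf_scale (Poly_Mapping.lookup (D (var (fst p))) (snd p)) (basis_field (snd p, fst p)))"
proof -
  have "D = (\<Sum>i\<in>UNIV. vf (D (var i)) i)" by (rule derivation_eq_sum_vf[OF assms])
  also have "\<dots> = (\<Sum>i\<in>UNIV. \<Sum>a\<in>Poly_Mapping.keys (D (var i)). vf_scale (Poly_Mapping.lookup (D (var i)) a) (basis_field (a, i)))"
    by (rule sum.cong[OF refl], subst vf_sum_monomials) (simp add: basis_field_def)
  also have "\<dots> = (\<Sum>p\<in>(SIGMA i:UNIV. Poly_Mapping.keys (D (var i))).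
    vf_scale (Poly_Mapping.lookup (D (var (fst p))) (snd p)) (basis_field (snd p, fst p)))"
    by (subst sum.Sigma) (simp_all add: split_beta)
  finally show ?thesis .
qed

lemma lie_plus_projection_add: "lie_plus_projection (D + E) = lie_plus_projection D + lie_plus_projection E"
  by (simp add: lie_plus_projection_def lookup_add vfield.scale_left_distrib sum.distrib)

lemma lie_plus_projection_scale: "lie_plus_projection (vf_scale c D) = vf_scale c (lie_plus_projection D)"
proof -
  have "Poly_Mapping.lookup (vf_scale c D (var i)) 0 = c * Poly_Mapping.lookup (D (var i)) 0" for i
    by (simp add: pointwise_scale_def lookup_poly_scale)
  then show ?thesis
    by (simp add: lie_plus_projection_def vfield.scale_right_diff_distrib vfield.scale_sum_right)
qed

section \<open>Evaluation at the origin, the homotopy and the operator L\<close>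

context tensor_module
begin

definition evaluate :: "(('n, 'k) vfield list \<Rightarrow> (('n \<Rightarrow>\<^sub>0 nat) \<Rightarrow>\<^sub>0 'w)) \<Rightarrow> ('n, 'k) vfield list \<Rightarrow> 'w" where
  "evaluate \<omega> xs = (if set xs \<subseteq> lie_plus then Poly_Mapping.lookup (\<omega> xs) 0 else 0)"

definition homotopy :: "(('n, 'k) vfield list \<Rightarrow> (('n \<Rightarrow>\<^sub>0 nat) \<Rightarrow>\<^sub>0 'w)) \<Rightarrow> ('n, 'k) vfield list \<Rightarrow> (('n \<Rightarrow>\<^sub>0 nat) \<Rightarrow>\<^sub>0 'w)" where
  "homotopy \<omega> xs = (\<Sum>i\<in>UNIV. poly_times (var i) (\<omega> (translation i # xs)))"

definition laplacian :: "(('n, 'k) vfield list \<Rightarrow> (('n \<Rightarrow>\<^sub>0 nat) \<Rightarrow>\<^sub>0 'w)) \<Rightarrow> ('n, 'k) vfield list \<Rightarrow> (('n \<Rightarrow>\<^sub>0 nat) \<Rightarrow>\<^sub>0 'w)" where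
  "laplacian \<omega> xs = V.\<d> (homotopy \<omega>) xs + homotopy (V.\<d> \<omega>) xs"

lemma evaluate_in_cochains:
  assumes \<omega>: "\<omega> \<in> V.C k"
  shows "evaluate \<omega> \<in> W.C k"
proof -
  have "(\<lambda>xs. if set xs \<subseteq> lie_plus then (\<lambda>m. Poly_Mapping.lookup m 0) (\<omega> (map (\<lambda>x. x) xs)) else 0) \<in> W.C k"
    by (rule cochains_compose[OF \<omega>])
      (auto simp: lie_plus_subset_derivations W.g_closed lookup_add lookup_coeff_scale[OF W_vs])
  then show ?thesis unfolding evaluate_def[abs_def] by (simp only: list.map_ident)
qed

lemma evaluate_diff: "evaluate (\<lambda>xs. \<omega> xs - \<eta> xs) = (\<lambda>xs. evaluate \<omega> xs - evaluate \<eta> xs)"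
  by (auto simp: evaluate_def lookup_minus)

lemma evaluate_Cons: "y \<in> lie_plus \<Longrightarrow> evaluate \<omega> (y # ys) = evaluate (contract y \<omega>) ys"
  by (simp add: evaluate_def)

lemma contract_evaluate: "y \<in> lie_plus \<Longrightarrow> contract y (evaluate \<omega>) = evaluate (contract y \<omega>)"
  by (simp add: fun_eq_iff evaluate_Cons)

text \<open>Restriction respects brackets and contractions of fields in \<open>lie_plus\<close>, so
  the content lies in the empty list, where it is \<open>lookup_T_lie_plus\<close>.\<close>

lemma evaluate_lie_derivative:
  "x \<in> lie_plus \<Longrightarrow> evaluate (V.\<theta> x \<omega>) xs = W.\<theta> x (evaluate \<omega>) xs"
proof (induction xs arbitrary: \<omega>)
  case (Cons y xs)
  show ?case
  proof (cases "y \<in> lie_plus")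
    case y: True
    note [simp] = W.bracket_closed[OF Cons.prems y] lie_plus_subset_derivations[OF y] y
    show ?thesis
      by (simp only: evaluate_Cons y V.contract_lie_derivative lie_plus_subset_derivations evaluate_diff Cons
          W.bracket_closed lie_derivative.simps if_True contract_evaluate)
  qed (simp add: evaluate_def)
qed (simp add: evaluate_def lookup_T_lie_plus)

lemma evaluate_differential: "evaluate (V.\<d> \<omega>) = W.\<d> (evaluate \<omega>)"
proof
  fix xs show "evaluate (V.\<d> \<omega>) xs = W.\<d> (evaluate \<omega>) xs"
  proof (induction xs arbitrary: \<omega>)
    case (Cons y xs)
    show ?case
    proof (cases "y \<in> lie_plus")
      case y: True
      then show ?thesis
        by (simp only: evaluate_Cons V.contract_cartan_differential lie_plus_subset_derivations evaluate_diff Cons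
            evaluate_lie_derivative cartan_differential.simps if_True contract_evaluate)
    qed (simp add: evaluate_def)
  qed (simp add: evaluate_def)
qed

lemma evaluate_surj:
  assumes c: "c \<in> W.C k"
  shows "\<exists>\<omega>\<in>V.C k. evaluate \<omega> = c"
proof
  \<comment> \<open>The lift projects the arguments to \<open>lie_plus\<close> and places the value
    of \<open>c\<close> as a constant coefficient.\<close>
  let ?\<omega> = "\<lambda>xs. if set xs \<subseteq> derivations then Poly_Mapping.single 0 (c (map lie_plus_projection xs)) else 0"
  have scl: "Poly_Mapping.single 0 (scaleW a w) = scaleT a (Poly_Mapping.single 0 w)" for a w
    by (simp add: poly_mapping_eq_iff fun_eq_iff lookup_coeff_scale[OF W_vs] lookup_single when_def)
  show "?\<omega> \<in> V.C k"
    by (rule cochains_compose[OF c lie_plus_projection_in lie_plus_projection_add lie_plus_projection_scale V.g_closed(1,2)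
        single_add scl single_zero])
  have proj: "lie_plus_projection x = x" if "x \<in> lie_plus" for x :: "('n, 'k) vfield"
    using that by (simp add: lie_plus_projection_def lie_plus_iff)
  show "evaluate ?\<omega> = c"
  proof
    fix xs
    show "evaluate ?\<omega> xs = c xs"
    proof (cases "set xs \<subseteq> lie_plus")
      case True
      then have "map lie_plus_projection xs = xs" by (auto intro: map_idI proj)
      moreover have "set xs \<subseteq> derivations" using True lie_plus_subset_derivations by blast
      ultimately show ?thesis using True by (simp add: evaluate_def)
    next
      case False
      then have "xs \<notin> tuples lie_plus k" by (auto simp: tuples_def)
      then show ?thesis using False cochainD(1)[OF c] by (simp add: evaluate_def)
    qed
  qed
qed

lemma homotopy_in_cochains: "\<omega> \<in> V.C (Suc k) \<Longrightarrow> homotopy \<omega> \<in> V.C k"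
  unfolding homotopy_def[abs_def]
  using V.cochains_sum[of UNIV "\<lambda>i xs. poly_times (var i) (contract (translation i) \<omega> xs)" k]
  by (simp add: V.cochains_postcompose[OF V.contract_in_cochains poly_times_linear] translation_in_derivations
      del: contract_apply) simp

lemma homotopy_C0: "\<omega> \<in> V.C 0 \<Longrightarrow> homotopy \<omega> = (\<lambda>xs. 0)"
  by (auto simp: homotopy_def cochains_0_iff poly_times_zero)

lemma homotopy_add: "homotopy (\<lambda>xs. \<omega> xs + \<eta> xs) = (\<lambda>xs. homotopy \<omega> xs + homotopy \<eta> xs)"
  by (simp add: homotopy_def fun_eq_iff poly_times_add sum.distrib)

lemma homotopy_diff: "homotopy (\<lambda>xs. \<omega> xs - \<eta> xs) = (\<lambda>xs. homotopy \<omega> xs - homotopy \<eta> xs)"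
  by (simp add: homotopy_def fun_eq_iff poly_times_diff sum_subtractf)

text \<open>The factors \<open>var i\<close> vanish at the origin. Hence the homotopy sends every
  cochain into the kernel, and the primitives it yields lie there automatically.\<close>

lemma evaluate_homotopy: "evaluate (homotopy \<omega>) = (\<lambda>xs. 0)"
proof -
  have "Poly_Mapping.lookup (var i :: ('n, 'k) mpoly) 0 = 0" for i
    by (auto simp: var_def monomial_def lookup_single when_def poly_mapping_eq_iff fun_eq_iff)
  then show ?thesis by (simp add: evaluate_def homotopy_def fun_eq_iff lookup_sum lookup_poly_times_0)
qed

lemma laplacian_in_cochains:
  assumes \<omega>: "\<omega> \<in> V.C k"
  shows "laplacian \<omega> \<in> V.C k"
proof -
  have "V.\<d> (homotopy \<omega>) \<in> V.C k"
  proof (cases k)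
    case 0
    with \<omega> show ?thesis by (simp add: homotopy_C0 V.cartan_differential_zero V.cochains_zero)
  next
    case (Suc k')
    with \<omega> show ?thesis by (simp add: homotopy_in_cochains V.cartan_differential_in_cochains)
  qed
  then show ?thesis
    unfolding laplacian_def[abs_def]
    by (intro V.cochains_add homotopy_in_cochains V.cartan_differential_in_cochains \<omega>)
qed

lemma evaluate_laplacian: "evaluate (laplacian \<omega>) = (\<lambda>xs. 0)"
proof -
  have "evaluate (V.\<d> (homotopy \<omega>)) = (\<lambda>xs. 0)"
    by (simp add: evaluate_differential evaluate_homotopy W.cartan_differential_zero)
  moreover have "evaluate (laplacian \<omega>) xs = evaluate (V.\<d> (homotopy \<omega>)) xs + evaluate (homotopy (V.\<d> \<omega>)) xs" for xs
    by (simp add: evaluate_def laplacian_def lookup_add)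
  ultimately show ?thesis by (simp add: evaluate_homotopy fun_eq_iff)
qed

lemma laplacian_add: "laplacian (\<lambda>xs. \<omega> xs + \<eta> xs) xs = laplacian \<omega> xs + laplacian \<eta> xs"
proof -
  have "V.\<d> (\<lambda>xs. \<omega> xs + \<eta> xs) = (\<lambda>xs. V.\<d> \<omega> xs + V.\<d> \<eta> xs)" by (simp add: fun_eq_iff V.cartan_differential_add)
  then show ?thesis by (simp add: laplacian_def homotopy_add V.cartan_differential_add)
qed

lemma laplacian_diff: "laplacian (\<lambda>xs. \<omega> xs - \<eta> xs) xs = laplacian \<omega> xs - laplacian \<eta> xs"
proof -
  have "V.\<d> (\<lambda>xs. \<omega> xs - \<eta> xs) = (\<lambda>xs. V.\<d> \<omega> xs - V.\<d> \<eta> xs)" by (simp add: fun_eq_iff V.cartan_differential_diff)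
  then show ?thesis by (simp add: laplacian_def homotopy_diff V.cartan_differential_diff)
qed

text \<open>As the differential squares to zero, both sides reduce to d h d.\<close>

lemma laplacian_differential:
  assumes \<omega>: "\<omega> \<in> V.C k"
  shows "laplacian (V.\<d> \<omega>) = V.\<d> (laplacian \<omega>)"
proof -
  have 0: "V.\<d> (V.\<d> \<omega>) = (\<lambda>xs. 0)"
    by (rule ext) (rule V.cartan_differential_squared[OF V.cochain_of[OF \<omega>]])
  have 1: "V.\<d> (V.\<d> (homotopy \<omega>)) = (\<lambda>xs. 0)"
  proof (cases k)
    case 0
    with \<omega> show ?thesis by (simp add: homotopy_C0 V.cartan_differential_zero)
  next
    case (Suc k')
    with \<omega> have "homotopy \<omega> \<in> V.C k'" by (simp add: homotopy_in_cochains)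
    from V.cartan_differential_squared[OF V.cochain_of[OF this]] show ?thesis by (rule ext)
  qed
  have "homotopy (\<lambda>xs. 0) = (\<lambda>xs. 0)" by (simp add: homotopy_def fun_eq_iff poly_times_zero)
  then show ?thesis
    by (simp add: fun_eq_iff laplacian_def[abs_def] 0 1 V.cartan_differential_add)
qed

section \<open>Recursion for L and its leading term on basis fields\<close>

lemma laplacian_Nil: "laplacian \<omega> [] = (\<Sum>i\<in>UNIV. poly_times (var i) (T (translation i) (\<omega> [])))"
  by (simp add: laplacian_def homotopy_def translation_in_derivations)

lemma lie_derivative_poly_times:
  assumes y: "y \<in> derivations"
  shows "set ys \<subseteq> derivations \<Longrightarrow> V.\<theta> y (\<lambda>xs. poly_times f (\<phi> xs)) ys = poly_times f (V.\<theta> y \<phi> ys) + poly_times (y f) (\<phi> ys)"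
  by (induction ys arbitrary: \<phi>) (simp_all add: T_poly_times[OF y] poly_times_diff contract_def)

lemma lie_derivative_sum: "x \<in> derivations \<Longrightarrow> V.\<theta> x (\<lambda>xs. \<Sum>a\<in>A. \<phi> a xs) ys = (\<Sum>a\<in>A. V.\<theta> x (\<phi> a) ys)"
  by (induction A rule: infinite_finite_induct) (simp_all add: V.lie_derivative_zero V.lie_derivative_add)

text \<open>Contraction with y anticommutes with h, so Cartan's formula gives that contraction with
  y after L is L after contraction with y, plus the commutator of theta_y with h. In that commutator
  the derivatives of the cochain cancel: one sum comes from commuting theta_y with contraction by
  translations, the other from the Leibniz rule on the factors \<open>var i\<close>.\<close>

lemma laplacian_Cons:
  assumes \<omega>: "V.cochain \<omega>" and y: "y \<in> derivations" and ys: "set ys \<subseteq> derivations"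
  shows "laplacian \<omega> (y # ys) = laplacian (contract y \<omega>) ys +
    (\<Sum>i\<in>UNIV. poly_times (var i) (\<omega> (vf_bracket y (translation i) # ys))) +
    (\<Sum>i\<in>UNIV. poly_times (y (var i)) (\<omega> (translation i # ys)))"
proof -
  note t = translation_in_derivations
  have neg: "poly_times f (- m) = - poly_times f m" for f m
    using poly_times_diff[of f 0 m] by (simp add: poly_times_zero)
  \<comment> \<open>The difference with 0 stands for a negation, so that the rule for differences
    applies under the differential.\<close>
  have "contract y (homotopy \<omega>) = (\<lambda>xs. 0 - homotopy (contract y \<omega>) xs)"
  proof
    fix xs
    have "\<omega> (translation i # y # xs) = - \<omega> (y # translation i # xs)" for i by (rule V.cochain_swap[OF \<omega>])
    then show "contract y (homotopy \<omega>) xs = 0 - homotopy (contract y \<omega>) xs"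
      by (simp add: homotopy_def neg sum_negf)
  qed
  then have "V.\<d> (contract y (homotopy \<omega>)) ys = - V.\<d> (homotopy (contract y \<omega>)) ys"
    by (simp only: V.cartan_differential_diff V.cartan_differential_zero) simp
  then have 1: "V.\<d> (homotopy \<omega>) (y # ys) = V.\<theta> y (homotopy \<omega>) ys + V.\<d> (homotopy (contract y \<omega>)) ys"
    using y by simp
  have "V.\<theta> y (homotopy \<omega>) ys = (\<Sum>i\<in>UNIV. V.\<theta> y (\<lambda>xs. poly_times (var i) (contract (translation i) \<omega> xs)) ys)"
    unfolding homotopy_def[abs_def] by (subst lie_derivative_sum[OF y]) simp
  also have "\<dots> = (\<Sum>i\<in>UNIV. poly_times (var i) (V.\<theta> y (contract (translation i) \<omega>) ys)) +
     (\<Sum>i\<in>UNIV. poly_times (y (var i)) (\<omega> (translation i # ys)))"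
    by (simp only: lie_derivative_poly_times[OF y ys] sum.distrib contract_apply contract_def)
  finally have 2: "V.\<theta> y (homotopy \<omega>) ys = \<dots>" .
  \<comment> \<open>The homotopy puts the translation in front of \<open>y\<close>; exchanging them
    makes Cartan's formula for \<open>y\<close> applicable.\<close>
  have swap: "V.\<d> \<omega> (translation i # y # ys) = V.\<d> (contract y \<omega>) (translation i # ys) -
      (V.\<theta> y (contract (translation i) \<omega>) ys - \<omega> (vf_bracket y (translation i) # ys))" for i
  proof -
    have "V.\<d> \<omega> (translation i # y # ys) = - V.\<d> \<omega> (y # translation i # ys)"
      by (rule V.cochain_swap[OF V.cochain_cartan_differential[OF \<omega>]])
    also have "V.\<d> \<omega> (y # translation i # ys) = V.\<theta> y \<omega> (translation i # ys) - V.\<d> (contract y \<omega>) (translation i # ys)"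
      by (simp only: cartan_differential.simps(2)[of _ _ _ \<omega> y] y if_True)
    also have "V.\<theta> y \<omega> (translation i # ys) = V.\<theta> y (contract (translation i) \<omega>) ys - \<omega> (vf_bracket y (translation i) # ys)"
      by (simp only: lie_derivative.simps(2) t if_True)
    finally show ?thesis by (simp only: minus_diff_eq)
  qed
  have 3: "homotopy (V.\<d> \<omega>) (y # ys) = homotopy (V.\<d> (contract y \<omega>)) ys -
     ((\<Sum>i\<in>UNIV. poly_times (var i) (V.\<theta> y (contract (translation i) \<omega>) ys)) -
      (\<Sum>i\<in>UNIV. poly_times (var i) (\<omega> (vf_bracket y (translation i) # ys))))"
    by (simp only: homotopy_def swap poly_times_diff sum_subtractf)
  show ?thesis by (simp only: laplacian_def 1 2 3) simp
qed

definition coeff_times :: "(('n \<Rightarrow>\<^sub>0 nat) \<Rightarrow> 'k) \<Rightarrow> (('n \<Rightarrow>\<^sub>0 nat) \<Rightarrow>\<^sub>0 'w) \<Rightarrow> (('n \<Rightarrow>\<^sub>0 nat) \<Rightarrow>\<^sub>0 'w)" where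
  "coeff_times c m = (\<Sum>a\<in>Poly_Mapping.keys m. Poly_Mapping.single a (scaleW (c a) (Poly_Mapping.lookup m a)))"

lemma lookup_coeff_times: "Poly_Mapping.lookup (coeff_times c m) a = scaleW (c a) (Poly_Mapping.lookup m a)"
  by (auto simp: coeff_times_def lookup_sum lookup_single when_def in_keys_iff sum.delta' cong: if_cong)

lemma linear_coeff_times: "Vector_Spaces.linear scaleT scaleT (coeff_times c)"
  by (simp add: Vector_Spaces.linear_iff TV.vector_space_axioms poly_mapping_eq_iff fun_eq_iff lookup_coeff_times
      lookup_add lookup_coeff_scale[OF W_vs] W.M.scale_right_distrib mult.commute)

lemma lookup_euler:
  "Poly_Mapping.lookup (\<Sum>i\<in>UNIV. poly_times (var i) (T (translation i) m)) a =
    scaleW (of_nat (total_degree a)) (Poly_Mapping.lookup m a)"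
proof (rule additive_eqI[where m = m])
  fix b w
  have "var i * partial i (monomial b) = (poly_scale (of_nat (Poly_Mapping.lookup b i)) (monomial b) :: ('n, 'k) mpoly)" for i
  proof (cases "Poly_Mapping.lookup b i = 0")
    case False
    then have "Poly_Mapping.single i 1 + (b - Poly_Mapping.single i 1) = b"
      by (auto simp: poly_mapping_eq_iff fun_eq_iff lookup_add lookup_minus lookup_single when_def)
    then show ?thesis by (simp add: partial_monomial poly_scale_mult_right var_def monomial_mult)
  qed (simp add: partial_monomial)
  then have "poly_times (var i) (T (translation i) (Poly_Mapping.single b w)) =
      scaleT (of_nat (Poly_Mapping.lookup b i)) (Poly_Mapping.single b w)" for i
    by (simp only: tensor_monomial[OF W_vs, symmetric] T_translation poly_times_tensor tensor_scale)
  then have "(\<Sum>i\<in>UNIV. poly_times (var i) (T (translation i) (Poly_Mapping.single b w))) =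
      scaleT (of_nat (total_degree b)) (Poly_Mapping.single b w)"
    by (simp add: total_degree_def TV.scale_sum_left)
  then show "Poly_Mapping.lookup (\<Sum>i\<in>UNIV. poly_times (var i) (T (translation i) (Poly_Mapping.single b w))) a =
      scaleW (of_nat (total_degree a)) (Poly_Mapping.lookup (Poly_Mapping.single b w) a)"
    by (simp add: lookup_coeff_scale[OF W_vs] lookup_single when_def)
qed (simp_all add: T_linear translation_in_derivations poly_times_add sum.distrib lookup_add W.M.scale_right_distrib)

text \<open>A descending filtration of the cochains by cost. Basis fields suffice as test arguments,
  since they determine a cochain by multilinearity.\<close>

definition vanishes_below :: "nat \<Rightarrow> nat \<Rightarrow> nat \<Rightarrow> (('n, 'k) vfield list \<Rightarrow> (('n \<Rightarrow>\<^sub>0 nat) \<Rightarrow>\<^sub>0 'w)) \<Rightarrow> bool" where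
  "vanishes_below q k N \<omega> \<longleftrightarrow> (\<forall>ps. length ps = k \<longrightarrow> list_cost q ps < N \<longrightarrow> \<omega> (map basis_field ps) = 0)"

lemma vanishes_below_contract:
  "vanishes_below q (Suc k) (field_cost q p + N) \<omega> \<Longrightarrow> vanishes_below q k N (contract (basis_field p) \<omega>)"
  unfolding vanishes_below_def by (auto dest: spec[of _ "p # _"])

text \<open>In \<open>laplacian_Cons\<close> the bracket with a translation is cheaper than the
  field itself, so that sum vanishes. The other sum replaces the field by a translation: this is
  again cheaper unless the field was one, and then it reproduces the value and adds 1 to the scalar.
  The empty list contributes the Euler operator.\<close>

lemma laplacian_leading_term:
  assumes q: "q > 1"
  shows "\<lbrakk>V.cochain \<omega>; vanishes_below q (length ps) (list_cost q ps) \<omega>\<rbrakk> \<Longrightarrow>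
    Poly_Mapping.lookup (laplacian \<omega> (map basis_field ps)) a =
    scaleW (of_nat (translation_count ps + total_degree a)) (Poly_Mapping.lookup (\<omega> (map basis_field ps)) a)"
proof (induction ps arbitrary: \<omega>)
  case Nil
  then show ?case by (simp only: list.map laplacian_Nil lookup_euler) simp
next
  case (Cons p ps)
  obtain \<alpha> l where p: "p = (\<alpha>, l)" by (cases p)
  note \<omega> = Cons.prems(1) and bd = basis_field_in_derivations
  let ?b = "map basis_field ps :: ('n, 'k) vfield list"
  have lower: "\<omega> (basis_field p' # ?b) = 0" if "field_cost q p' < field_cost q p" for p'
    using Cons.prems(2) that unfolding vanishes_below_def by (auto dest!: spec[of _ "p' # ps"])
  have IH: "Poly_Mapping.lookup (laplacian (contract (basis_field p) \<omega>) ?b) a =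
    scaleW (of_nat (translation_count ps + total_degree a)) (Poly_Mapping.lookup (contract (basis_field p) \<omega> ?b) a)"
    using Cons.prems(2) by (intro Cons.IH V.cochain_contract \<omega> bd vanishes_below_contract) simp
  have 1: "\<omega> (vf_bracket (basis_field p) (translation i) # ?b) = 0" for i
  proof (cases "Poly_Mapping.lookup \<alpha> i = 0")
    case False
    then show ?thesis
      using field_cost_minus_single[OF q False]
      by (simp add: p bracket_basis_field_translation V.cochain_Cons_scale[OF \<omega>] V.cochain_Cons_neg[OF \<omega>] bd lower V.g_closed)
  qed (simp add: p bracket_basis_field_translation V.cochain_Cons_zero[OF \<omega>])
  have "(\<Sum>i\<in>UNIV. poly_times (basis_field p (var i)) (\<omega> (translation i # ?b))) =
      (\<Sum>i\<in>UNIV. if i = l then poly_times (monomial \<alpha>) (\<omega> (translation l # ?b)) else 0)"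
  proof (rule sum.cong[OF refl])
    have "poly_times 0 m = 0" for m by (simp add: poly_times_def tensor_zero)
    then show "poly_times (basis_field p (var i)) (\<omega> (translation i # ?b)) =
        (if i = l then poly_times (monomial \<alpha>) (\<omega> (translation l # ?b)) else 0)" for i
      by (simp add: p basis_field_apply_var)
  qed
  also have "\<dots> = poly_times (monomial \<alpha>) (\<omega> (translation l # ?b))" by simp
  also have "\<dots> = (if \<alpha> = 0 then \<omega> (basis_field p # ?b) else 0)"
    using lower[of "(0, l)"] field_cost_translation[OF q, of \<alpha> l]
    by (simp add: p translation_eq_basis_field monomial_0 poly_times_one poly_times_zero)
  finally have 2: "(\<Sum>i\<in>UNIV. poly_times (basis_field p (var i)) (\<omega> (translation i # ?b))) = \<dots>" .
  have "set ?b \<subseteq> derivations" using bd by auto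
  from laplacian_Cons[OF \<omega> bd this, of p]
  have "laplacian \<omega> (map basis_field (p # ps)) =
      laplacian (contract (basis_field p) \<omega>) ?b + (if \<alpha> = 0 then \<omega> (basis_field p # ?b) else 0)"
    by (simp add: 1 2 poly_times_zero)
  then show ?case
    by (simp add: lookup_add IH) (simp add: p W.M.scale_left_distrib add.commute add.left_commute)
qed

text \<open>Each argument is a finite combination of basis fields, so a list involves only finitely
  many basis lists. The bound depends on the list but not on the cochain, which is what makes the
  correction series finite on each list.\<close>

lemma vanishing_bound:
  "xs \<in> tuples derivations k \<Longrightarrow> \<exists>N. \<forall>\<omega>\<in>V.C k. vanishes_below q k N \<omega> \<longrightarrow> \<omega> xs = 0"
proof (induction xs arbitrary: k)
  case Nil
  then have "k = 0" by (cases k) auto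
  \<comment> \<open>The empty list has cost 0, so the bound must be positive.\<close>
  then show ?case by (intro exI[of _ 1]) (auto simp: vanishes_below_def)
next
  case (Cons y ys)
  obtain k' where k: "k = Suc k'" using Cons.prems by (cases k) auto
  have y: "y \<in> derivations" and "ys \<in> tuples derivations k'" using Cons.prems k by auto
  then obtain N where N: "\<And>\<omega>. \<omega> \<in> V.C k' \<Longrightarrow> vanishes_below q k' N \<omega> \<Longrightarrow> \<omega> ys = 0"
    using Cons.IH by blast
  define S where "S = (SIGMA i:UNIV. Poly_Mapping.keys (y (var i)))"
  let ?p = "\<lambda>s :: 'n \<times> ('n \<Rightarrow>\<^sub>0 nat). (snd s, fst s)"
  have S: "finite S" by (auto simp: S_def)
  show ?case
  proof (intro exI ballI impI)
    \<comment> \<open>The sum of the costs is used as a common upper bound for all of them.\<close>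
    fix \<omega> assume \<omega>: "\<omega> \<in> V.C k" and van: "vanishes_below q k ((\<Sum>s\<in>S. field_cost q (?p s)) + N) \<omega>"
    note c = V.cochain_of[OF \<omega>]
    have "\<omega> (basis_field (?p s) # ys) = 0" if s: "s \<in> S" for s
    proof -
      have "field_cost q (?p s) \<le> (\<Sum>s\<in>S. field_cost q (?p s))" by (rule member_le_sum[OF s _ S]) simp
      then have "vanishes_below q (Suc k') (field_cost q (?p s) + N) \<omega>"
        using van by (auto simp: vanishes_below_def k)
      then have "contract (basis_field (?p s)) \<omega> ys = 0"
        using \<omega> by (intro N V.contract_in_cochains vanishes_below_contract basis_field_in_derivations) (simp_all add: k)
      then show ?thesis by simp
    qed
    moreover have "\<omega> (y # ys) = (\<Sum>s\<in>S. scaleT (Poly_Mapping.lookup (y (var (fst s))) (snd s)) (\<omega> (basis_field (?p s) # ys)))"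
      by (subst derivation_eq_sum_basis_field[OF y])
        (simp add: V.cochain_Cons_sum[OF c] V.cochain_Cons_scale[OF c] V.g_closed basis_field_in_derivations S_def)
    ultimately show "\<omega> (y # ys) = 0" by simp
  qed
qed

lemma eq_zero_if_vanishes:
  assumes \<omega>: "\<omega> \<in> V.C k" and "\<And>N. vanishes_below q k N \<omega>"
  shows "\<omega> = (\<lambda>xs. 0)"
proof
  fix xs show "\<omega> xs = 0"
    using vanishing_bound[of xs k q] cochainD(1)[OF \<omega>, of xs] assms by blast
qed

section \<open>Invertibility of L on the kernel of evaluation\<close>

definition kernel_cochains where
  "kernel_cochains k = {\<omega> \<in> V.C k. evaluate \<omega> = (\<lambda>xs. 0)}"

text \<open>Without translations all arguments lie in \<open>lie_plus\<close>, so evaluation sees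
  exactly this coefficient. This settles the only case in which the leading scalar is zero.\<close>

lemma lookup_kernel_0:
  assumes "\<omega> \<in> kernel_cochains k" "translation_count ps = 0"
  shows "Poly_Mapping.lookup (\<omega> (map basis_field ps)) 0 = 0"
proof -
  have "p \<in> set ps \<Longrightarrow> fst p \<noteq> 0" for p
    using assms(2) by (auto simp: translation_count_def filter_empty_conv)
  then have "set (map basis_field ps) \<subseteq> (lie_plus :: ('n, 'k) vfield set)"
    by (auto simp: basis_field_def split_beta intro!: vf_monomial_in_lie_plus[OF W_ax])
  moreover have "evaluate \<omega> (map basis_field ps) = 0" using assms(1) by (simp add: kernel_cochains_def)
  ultimately show ?thesis by (simp add: evaluate_def)
qed

lemma vanishes_below_laplacian:
  assumes "q > 1" "\<omega> \<in> V.C k" "vanishes_below q k N \<omega>"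
  shows "vanishes_below q k N (laplacian \<omega>)"
  unfolding vanishes_below_def
proof (intro allI impI)
  fix ps :: "(('n \<Rightarrow>\<^sub>0 nat) \<times> 'n) list" assume ps: "length ps = k" "list_cost q ps < N"
  then have "vanishes_below q (length ps) (list_cost q ps) \<omega>" using assms(3) by (simp add: vanishes_below_def)
  moreover have "\<omega> (map basis_field ps) = 0" using assms(3) ps by (simp add: vanishes_below_def)
  ultimately show "laplacian \<omega> (map basis_field ps) = 0"
    using V.cochain_of[OF assms(2)]
    by (simp add: poly_mapping_eq_iff fun_eq_iff laplacian_leading_term[OF assms(1)])
qed

lemma laplacian_inj:
  assumes \<omega>: "\<omega> \<in> kernel_cochains k" and zero: "laplacian \<omega> = (\<lambda>xs. 0)"
  shows "\<omega> = (\<lambda>xs. 0)"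
proof (rule eq_zero_if_vanishes)
  show "\<omega> \<in> V.C k" using \<omega> by (simp add: kernel_cochains_def)
  then have c: "V.cochain \<omega>" by (rule V.cochain_of)
  \<comment> \<open>Any \<open>q > 1\<close> would do: injectivity uses only leading terms, not the
    residues of costs.\<close>
  show "vanishes_below 2 k N \<omega>" for N
  proof (induction N)
    case (Suc N)
    show ?case
      unfolding vanishes_below_def
    proof (intro allI impI)
      fix ps :: "(('n \<Rightarrow>\<^sub>0 nat) \<times> 'n) list" assume ps: "length ps = k" "list_cost 2 ps < Suc N"
      then have "vanishes_below 2 (length ps) (list_cost 2 ps) \<omega>" using Suc by (simp add: vanishes_below_def)
      then have "scaleW (of_nat (translation_count ps + total_degree a)) (Poly_Mapping.lookup (\<omega> (map basis_field ps)) a) = 0" for a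
        using laplacian_leading_term[of 2 \<omega> ps a] c zero by simp
      then have "Poly_Mapping.lookup (\<omega> (map basis_field ps)) a = 0" for a
        using lookup_kernel_0[OF \<omega>, of ps] by (cases "translation_count ps + total_degree a = 0")
          (auto simp: total_degree_eq_0_iff simp del: of_nat_add)
      then show "\<omega> (map basis_field ps) = 0" by (simp add: poly_mapping_eq_iff fun_eq_iff)
    qed
  qed (simp add: vanishes_below_def)
qed

text \<open>The entry at a constant coefficient with \<open>p = 0\<close> is \<open>1 / 0 = 0\<close>, which is harmless on \<open>kernel_cochains\<close>.\<close>

definition invert_degree :: "nat \<Rightarrow> (('n, 'k) vfield list \<Rightarrow> (('n \<Rightarrow>\<^sub>0 nat) \<Rightarrow>\<^sub>0 'w)) \<Rightarrow> ('n, 'k) vfield list \<Rightarrow> (('n \<Rightarrow>\<^sub>0 nat) \<Rightarrow>\<^sub>0 'w)" where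
  "invert_degree p \<omega> xs = coeff_times (\<lambda>a. 1 / of_nat (p + total_degree a)) (\<omega> xs)"

lemma invert_degree_in_kernel: "\<omega> \<in> kernel_cochains k \<Longrightarrow> invert_degree p \<omega> \<in> kernel_cochains k"
proof -
  assume \<omega>: "\<omega> \<in> kernel_cochains k"
  have "invert_degree p \<omega> \<in> V.C k"
    using \<omega> unfolding invert_degree_def[abs_def] kernel_cochains_def
    by (auto intro: V.cochains_postcompose linear_coeff_times)
  moreover have "evaluate (invert_degree p \<omega>) xs = scaleW (1 / of_nat (p + total_degree (0 :: 'n \<Rightarrow>\<^sub>0 nat))) (evaluate \<omega> xs)" for xs
    by (simp add: evaluate_def invert_degree_def lookup_coeff_times)
  ultimately show ?thesis using \<omega> by (simp add: kernel_cochains_def fun_eq_iff)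
qed

lemma vanishes_below_invert_degree: "vanishes_below q k N \<omega> \<Longrightarrow> vanishes_below q k N (invert_degree p \<omega>)"
  by (simp add: vanishes_below_def invert_degree_def poly_mapping_eq_iff fun_eq_iff lookup_coeff_times)

lemma laplacian_in_kernel: "\<omega> \<in> kernel_cochains k \<Longrightarrow> laplacian \<omega> \<in> kernel_cochains k"
  by (simp add: kernel_cochains_def laplacian_in_cochains evaluate_laplacian)

lemma kernel_diff: "\<omega> \<in> kernel_cochains k \<Longrightarrow> \<eta> \<in> kernel_cochains k \<Longrightarrow> (\<lambda>xs. \<omega> xs - \<eta> xs) \<in> kernel_cochains k"
  by (simp add: kernel_cochains_def V.cochains_diff evaluate_diff)

text \<open>At cost exactly \<open>N\<close> the translation count is \<open>N mod q\<close>, so one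
  diagonal operator inverts the leading scalar on all such lists; at smaller cost both terms vanish.
  The choice \<open>q = k + 2\<close> keeps the translation count, at most \<open>k\<close>, below
  \<open>q\<close> and gives \<open>q > 1\<close> even for \<open>k = 0\<close>.\<close>

lemma laplacian_approximation:
  assumes q: "q = k + 2" and \<eta>: "\<eta> \<in> kernel_cochains k" and van: "vanishes_below q k N \<eta>"
  shows "vanishes_below q k (Suc N) (\<lambda>xs. \<eta> xs - laplacian (invert_degree (N mod q) \<eta>) xs)"
  unfolding vanishes_below_def
proof (intro allI impI)
  let ?\<zeta> = "invert_degree (N mod q) \<eta>"
  fix ps :: "(('n \<Rightarrow>\<^sub>0 nat) \<times> 'n) list" assume ps: "length ps = k" "list_cost q ps < Suc N"
  have \<zeta>: "?\<zeta> \<in> V.C k" using invert_degree_in_kernel[OF \<eta>] by (simp add: kernel_cochains_def)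
  have van': "vanishes_below q k N ?\<zeta>" by (rule vanishes_below_invert_degree[OF van])
  then have "vanishes_below q (length ps) (list_cost q ps) ?\<zeta>" using ps by (simp add: vanishes_below_def)
  then have lead: "Poly_Mapping.lookup (laplacian ?\<zeta> (map basis_field ps)) a =
    scaleW (of_nat (translation_count ps + total_degree a)) (Poly_Mapping.lookup (?\<zeta> (map basis_field ps)) a)" for a
    using laplacian_leading_term[of q ?\<zeta> ps a] V.cochain_of[OF \<zeta>] q by simp
  show "\<eta> (map basis_field ps) - laplacian ?\<zeta> (map basis_field ps) = 0"
  proof (cases "list_cost q ps < N")
    case True
    then have "\<eta> (map basis_field ps) = 0" "?\<zeta> (map basis_field ps) = 0"
      using van van' ps by (simp_all add: vanishes_below_def)
    then show ?thesis by (simp add: poly_mapping_eq_iff fun_eq_iff lead lookup_minus)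
  next
    case False
    then have "list_cost q ps = N" using ps by simp
    then have N: "N mod q = translation_count ps" using list_cost_mod[of ps q] ps q by simp
    have "Poly_Mapping.lookup (laplacian ?\<zeta> (map basis_field ps)) a =
        scaleW (of_nat (translation_count ps + total_degree a))
          (scaleW (1 / of_nat (translation_count ps + total_degree a)) (Poly_Mapping.lookup (\<eta> (map basis_field ps)) a))" for a
      by (simp only: N lead[unfolded N] invert_degree_def lookup_coeff_times)
    moreover have "Poly_Mapping.lookup (\<eta> (map basis_field ps)) a = 0" if "translation_count ps + total_degree a = 0" for a
      using lookup_kernel_0[OF \<eta>, of ps] that by (simp add: total_degree_eq_0_iff)
    ultimately have "Poly_Mapping.lookup (laplacian ?\<zeta> (map basis_field ps)) a = Poly_Mapping.lookup (\<eta> (map basis_field ps)) a" for a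
      by (cases "translation_count ps + total_degree a = 0") (simp_all del: of_nat_add)
    then show ?thesis by (simp add: poly_mapping_eq_iff fun_eq_iff lookup_minus)
  qed
qed

lemma laplacian_surj:
  assumes \<eta>: "\<eta> \<in> kernel_cochains k"
  shows "\<exists>\<sigma>\<in>kernel_cochains k. laplacian \<sigma> = \<eta>"
proof -
  define q where "q = k + 2"
  \<comment> \<open>\<open>H r\<close> is the remainder after \<open>r\<close> corrections and lies
    in filtration step \<open>r\<close>; \<open>s r\<close> is the next correction and
    \<open>P\<close> collects the partial sums.\<close>
  define H where "H = rec_nat \<eta> (\<lambda>r \<zeta> xs. \<zeta> xs - laplacian (invert_degree (r mod q) \<zeta>) xs)"
  have H0: "H 0 = \<eta>" and HS: "H (Suc r) = (\<lambda>xs. H r xs - laplacian (invert_degree (r mod q) (H r)) xs)" for r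
    by (simp_all add: H_def)
  define s where "s r = invert_degree (r mod q) (H r)" for r
  define P where "P N xs = (\<Sum>r<N. s r xs)" for N xs
  have HK: "H r \<in> kernel_cochains k" for r
    by (induction r) (simp_all add: H0 HS \<eta> kernel_diff laplacian_in_kernel invert_degree_in_kernel)
  have HF: "vanishes_below q k r (H r)" for r
  proof (induction r)
    case (Suc r)
    then show ?case unfolding HS by (intro laplacian_approximation HK) (simp_all add: q_def)
  qed (simp add: vanishes_below_def)
  have sK: "s r \<in> kernel_cochains k" for r by (simp add: s_def invert_degree_in_kernel HK)
  have sF: "vanishes_below q k r (s r)" for r by (simp add: s_def vanishes_below_invert_degree HF)
  have PC: "P N \<in> V.C k" for N
    unfolding P_def[abs_def] using sK by (intro V.cochains_sum) (simp add: kernel_cochains_def)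
  have HP: "H N xs = \<eta> xs - laplacian (P N) xs" for N xs
  proof (induction N)
    case 0
    have "laplacian (\<lambda>xs. 0) xs = 0" using laplacian_diff[of "\<lambda>xs. 0" "\<lambda>xs. 0" xs] by simp
    then show ?case by (simp add: H0 P_def[abs_def])
  next
    case (Suc N)
    have "laplacian (P (Suc N)) xs = laplacian (P N) xs + laplacian (s N) xs"
      unfolding laplacian_add[symmetric] by (simp add: P_def[abs_def])
    then show ?case using Suc by (simp add: HS s_def)
  qed
  have bound: "\<exists>N. \<forall>r\<ge>N. s r xs = 0" for xs
  proof (cases "xs \<in> tuples derivations k")
    case True
    obtain N where N: "\<And>\<omega>. \<omega> \<in> V.C k \<Longrightarrow> vanishes_below q k N \<omega> \<Longrightarrow> \<omega> xs = 0"
      using vanishing_bound[OF True] by blast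
    have "s r xs = 0" if "N \<le> r" for r
      using sK[of r] sF[of r] that by (intro N) (auto simp: kernel_cochains_def vanishes_below_def)
    then show ?thesis by blast
  next
    case False
    then show ?thesis using sK cochainD(1) by (fastforce simp: kernel_cochains_def)
  qed
  \<comment> \<open>By \<open>bound\<close> the support is finite on each list, so this is the full
    series even where infinitely many corrections are nonzero as cochains.\<close>
  define \<sigma> where "\<sigma> xs = (\<Sum>r | s r xs \<noteq> 0. s r xs)" for xs
  have ev: "eventually (\<lambda>M. \<sigma> xs = P M xs) sequentially" for xs
  proof -
    obtain N where N: "\<forall>r\<ge>N. s r xs = 0" using bound by blast
    have "\<sigma> xs = P M xs" if "N \<le> M" for M
    proof -
      have "s r xs \<noteq> 0 \<Longrightarrow> r < M" for r using N that by (meson le_trans not_le)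
      then show ?thesis unfolding \<sigma>_def P_def by (intro sum.mono_neutral_left) auto
    qed
    then show ?thesis by (auto simp: eventually_sequentially)
  qed
  have \<sigma>C: "\<sigma> \<in> V.C k" using PC ev by (rule V.cochains_eventually)
  have "evaluate \<sigma> xs = 0" for xs
  proof -
    obtain M where M: "\<sigma> xs = P M xs" using eventually_happens[OF ev] by auto
    have "evaluate (s r) xs = 0" for r using sK[of r] by (simp add: kernel_cochains_def)
    then have "set xs \<subseteq> lie_plus \<Longrightarrow> Poly_Mapping.lookup (s r xs) 0 = 0" for r by (metis evaluate_def)
    then show ?thesis by (simp add: evaluate_def M P_def lookup_sum)
  qed
  then have \<sigma>K: "\<sigma> \<in> kernel_cochains k" using \<sigma>C by (simp add: kernel_cochains_def fun_eq_iff)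
  have "vanishes_below q k N (\<lambda>xs. \<sigma> xs - P N xs)" for N
    unfolding vanishes_below_def
  proof (intro allI impI)
    fix ps :: "(('n \<Rightarrow>\<^sub>0 nat) \<times> 'n) list" assume ps: "length ps = k" "list_cost q ps < N"
    then have "s r (map basis_field ps) = 0" if "N \<le> r" for r
      using sF[of r] that by (simp add: vanishes_below_def)
    then have "\<sigma> (map basis_field ps) = P N (map basis_field ps)"
      unfolding \<sigma>_def P_def by (intro sum.mono_neutral_left) (auto simp: not_less[symmetric])
    then show "\<sigma> (map basis_field ps) - P N (map basis_field ps) = 0" by simp
  qed
  then have van: "vanishes_below q k N (laplacian (\<lambda>xs. \<sigma> xs - P N xs))" for N
    by (intro vanishes_below_laplacian V.cochains_diff \<sigma>C PC) (simp_all add: q_def)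
  \<comment> \<open>The remainder and L of the tail of the series both vanish below
    \<open>N\<close>. As \<open>N\<close> is arbitrary, the error is zero.\<close>
  have eq: "\<eta> xs - laplacian \<sigma> xs = H N xs - laplacian (\<lambda>xs. \<sigma> xs - P N xs) xs" for N xs
    by (simp add: HP laplacian_diff)
  have "vanishes_below q k N (\<lambda>xs. \<eta> xs - laplacian \<sigma> xs)" for N
    using HF[of N] van[of N] by (simp only: vanishes_below_def eq[of _ N]) simp
  then have "(\<lambda>xs. \<eta> xs - laplacian \<sigma> xs) = (\<lambda>xs. 0)"
    using \<eta> \<sigma>C by (intro eq_zero_if_vanishes V.cochains_diff laplacian_in_cochains) (simp_all add: kernel_cochains_def)
  then have "laplacian \<sigma> = \<eta>" by (simp add: fun_eq_iff)
  with \<sigma>K show ?thesis by blast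
qed

lemma kernel_cocycle_eq:
  assumes \<omega>: "\<omega> \<in> kernel_cochains k" and closed: "V.\<d> \<omega> = (\<lambda>xs. 0)"
  obtains \<eta> where "\<eta> \<in> V.C k" "\<omega> = V.\<d> (homotopy \<eta>)"
proof -
  obtain \<eta> where \<eta>: "\<eta> \<in> kernel_cochains k" "laplacian \<eta> = \<omega>" using laplacian_surj[OF \<omega>] by blast
  have \<eta>C: "\<eta> \<in> V.C k" using \<eta> by (simp add: kernel_cochains_def)
  have "V.\<d> \<eta> \<in> kernel_cochains (Suc k)"
    using \<eta> by (simp add: kernel_cochains_def V.cartan_differential_in_cochains evaluate_differential
        W.cartan_differential_zero)
  moreover have "laplacian (V.\<d> \<eta>) = (\<lambda>xs. 0)" by (simp add: laplacian_differential[OF \<eta>C] \<eta> closed)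
  ultimately have "V.\<d> \<eta> = (\<lambda>xs. 0)" by (rule laplacian_inj)
  moreover have "homotopy (\<lambda>xs. 0) = (\<lambda>xs. 0)" by (simp add: homotopy_def fun_eq_iff poly_times_zero)
  ultimately have "\<omega> = V.\<d> (homotopy \<eta>)"
    using \<eta>(2) by (simp add: laplacian_def[abs_def])
  with \<eta>C show thesis by (rule that)
qed

lemma kernel_cocycle_0:
  assumes "\<omega> \<in> kernel_cochains 0" "V.\<d> \<omega> = (\<lambda>xs. 0)"
  shows "\<omega> = (\<lambda>xs. 0)"
proof -
  obtain \<eta> where "\<eta> \<in> V.C 0" "\<omega> = V.\<d> (homotopy \<eta>)" using assms by (rule kernel_cocycle_eq)
  then show ?thesis by (simp only: homotopy_C0 V.cartan_differential_zero)
qed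

lemma kernel_cocycle_Suc:
  assumes "\<omega> \<in> kernel_cochains (Suc k)" "V.\<d> \<omega> = (\<lambda>xs. 0)"
  shows "\<exists>\<zeta>\<in>kernel_cochains k. \<omega> = V.\<d> \<zeta>"
proof -
  obtain \<eta> where \<eta>: "\<eta> \<in> V.C (Suc k)" "\<omega> = V.\<d> (homotopy \<eta>)" using assms by (rule kernel_cocycle_eq)
  then have "homotopy \<eta> \<in> kernel_cochains k" by (simp add: kernel_cochains_def homotopy_in_cochains evaluate_homotopy)
  with \<eta> show ?thesis by blast
qed

section \<open>Passage to cohomology\<close>

lemma evaluate_zero: "evaluate (\<lambda>xs. 0) = (\<lambda>xs. 0)"
  by (simp add: evaluate_def fun_eq_iff)

lemma linear_evaluate: "Vector_Spaces.linear (pointwise_scale scaleT) (pointwise_scale scaleW) evaluate"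
  by (simp add: Vector_Spaces.linear_iff vector_space_pointwise_scale TV.vector_space_axioms W_vs
      fun_eq_iff evaluate_def pointwise_scale_def lookup_add lookup_coeff_scale[OF W_vs])

text \<open>The long exact sequence argument for a surjective chain map with acyclic kernel, carried
  out on cochains.\<close>

theorem cohomology_isomorphic_evaluate:
  "cohomology_isomorphic vf_scale derivations vf_bracket scaleT T vf_scale lie_plus vf_bracket scaleW actW k"
  unfolding cohomology_isomorphic_def
proof (rule quotients_isomorphicI[OF linear_evaluate V.subspace_cocycles V.subspace_coboundaries W.subspace_coboundaries])
  fix \<omega> assume "\<omega> \<in> cocycles vf_scale derivations vf_bracket scaleT T k"
  then have \<omega>: "\<omega> \<in> V.C k" "V.\<d> \<omega> = (\<lambda>xs. 0)" by (auto simp: V.cocycles_iff zero_fun_def)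
  then show "evaluate \<omega> \<in> cocycles vf_scale lie_plus vf_bracket scaleW actW k"
    by (simp add: W.cocycles_iff evaluate_in_cochains zero_fun_def evaluate_zero flip: evaluate_differential)
  assume b: "evaluate \<omega> \<in> coboundaries vf_scale lie_plus vf_bracket scaleW actW k"
  show "\<omega> \<in> coboundaries vf_scale derivations vf_bracket scaleT T k"
  proof (cases k)
    case 0
    \<comment> \<open>In degree 0 the only coboundary is zero, so the cocycle itself lies in the
      kernel.\<close>
    then show ?thesis
      using \<omega> b kernel_cocycle_0[of \<omega>] by (simp add: kernel_cochains_def zero_fun_def)
  next
    case (Suc k')
    then obtain c where c: "c \<in> W.C k'" "evaluate \<omega> = W.\<d> c" using b by (auto simp: W.coboundaries_Suc simp del: coboundaries.simps)
    \<comment> \<open>A lift of the primitive changes the cocycle by a coboundary into one in the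
      kernel, where it is exact.\<close>
    obtain \<eta> where \<eta>: "\<eta> \<in> V.C k'" "evaluate \<eta> = c" using evaluate_surj[OF c(1)] by blast
    have "(\<lambda>xs. \<omega> xs - V.\<d> \<eta> xs) \<in> kernel_cochains (Suc k')"
      using \<omega> \<eta> c Suc by (simp add: kernel_cochains_def evaluate_diff evaluate_differential V.cochains_diff
          V.cartan_differential_in_cochains)
    moreover have "V.\<d> (\<lambda>xs. \<omega> xs - V.\<d> \<eta> xs) = (\<lambda>xs. 0)"
      by (simp add: fun_eq_iff V.cartan_differential_diff \<omega> V.cartan_differential_squared[OF V.cochain_of[OF \<eta>(1)]])
    ultimately obtain \<zeta> where \<zeta>: "\<zeta> \<in> kernel_cochains k'" "(\<lambda>xs. \<omega> xs - V.\<d> \<eta> xs) = V.\<d> \<zeta>"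
      using kernel_cocycle_Suc by blast
    have "\<omega> = V.\<d> (\<lambda>xs. \<eta> xs + \<zeta> xs)"
      using fun_cong[OF \<zeta>(2)] by (simp add: fun_eq_iff V.cartan_differential_add algebra_simps)
    then show ?thesis
      using \<eta> \<zeta> Suc V.cochains_add[of \<eta> k' \<zeta>] by (auto simp: V.coboundaries_Suc kernel_cochains_def simp del: coboundaries.simps)
  qed
next
  fix \<omega> assume "\<omega> \<in> coboundaries vf_scale derivations vf_bracket scaleT T k"
  then show "evaluate \<omega> \<in> coboundaries vf_scale lie_plus vf_bracket scaleW actW k"
    by (cases k) (auto simp: V.coboundaries_Suc W.coboundaries_Suc evaluate_differential evaluate_in_cochains
        evaluate_def zero_fun_def simp del: coboundaries.simps(2))
next
  interpret WC: vector_space "pointwise_scale scaleW :: 'k \<Rightarrow> (('n, 'k) vfield list \<Rightarrow> _) \<Rightarrow> _"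
    by (rule vector_space_pointwise_scale[OF W_vs])
  fix c assume "c \<in> cocycles vf_scale lie_plus vf_bracket scaleW actW k"
  then have c: "c \<in> W.C k" "W.\<d> c = (\<lambda>xs. 0)" by (auto simp: W.cocycles_iff zero_fun_def)
  obtain \<omega> where \<omega>: "\<omega> \<in> V.C k" "evaluate \<omega> = c" using evaluate_surj[OF c(1)] by blast
  \<comment> \<open>The lift of a cocycle need not be closed, but its differential is a cocycle in
    the kernel. Subtracting a primitive taken from the kernel makes the lift closed and leaves its
    evaluation unchanged.\<close>
  have "V.\<d> \<omega> \<in> kernel_cochains (Suc k)"
    using \<omega> c by (simp add: kernel_cochains_def evaluate_differential V.cartan_differential_in_cochains)
  moreover have "V.\<d> (V.\<d> \<omega>) = (\<lambda>xs. 0)"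
    by (rule ext) (rule V.cartan_differential_squared[OF V.cochain_of[OF \<omega>(1)]])
  ultimately obtain \<zeta> where \<zeta>: "\<zeta> \<in> kernel_cochains k" "V.\<d> \<omega> = V.\<d> \<zeta>" using kernel_cocycle_Suc by blast
  have "(\<lambda>xs. \<omega> xs - \<zeta> xs) \<in> cocycles vf_scale derivations vf_bracket scaleT T k"
    using \<omega> \<zeta> by (simp add: V.cocycles_iff kernel_cochains_def V.cochains_diff fun_eq_iff V.cartan_differential_diff)
  moreover have "c - evaluate (\<lambda>xs. \<omega> xs - \<zeta> xs) = 0"
    using \<omega> \<zeta> by (simp add: evaluate_diff kernel_cochains_def fun_eq_iff)
  ultimately show "\<exists>z\<in>cocycles vf_scale derivations vf_bracket scaleT T k. c - evaluate z \<in> coboundaries vf_scale lie_plus vf_bracket scaleW actW k"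
    using WC.subspace_0[OF W.subspace_coboundaries] by (intro bexI[of _ "\<lambda>xs. \<omega> xs - \<zeta> xs"]) simp_all
qed

end

theorem corollary7p2:
  fixes scaleW :: "'k::field_char_0 \<Rightarrow> 'w::ab_group_add \<Rightarrow> 'w"
    and actW :: "('n::finite, 'k) vfield \<Rightarrow> 'w \<Rightarrow> 'w"
  assumes "lie_module vf_scale lie_plus vf_bracket scaleW actW"
    and "\<exists>Basis. finite_dimensional_vector_space scaleW Basis"
  shows "\<forall>k. cohomology_isomorphic
    vf_scale (derivations :: ('n, 'k) vfield set) vf_bracket (coeff_scale scaleW) (tensor_act scaleW actW)
    vf_scale (lie_plus :: ('n, 'k) vfield set) vf_bracket scaleW actW k"
proof -
  interpret tensor_module scaleW actW using assms(1) by (rule tensor_module.intro)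
  show ?thesis by (intro allI cohomology_isomorphic_evaluate)
qed

end
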